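(* Let $N\geq 1$ be an integer and let $\Psi\in C([1,\infty))$ with $\Psi>0$ on $[1,\infty)$. The following conditions are equivalent: (i) $\Psi$ satisfies property (P) in $\mathbb{R}^N$. (ii) $\Psi$ satisfies property (P') in $\mathbb{R}^N$. (iii) $\displaystyle\int_1^\infty \frac{1}{h'}=\infty$ for every nondecreasing function $h\in C([1,\infty))$ with $h\geq 0$ and $h\leq \Psi$ in $[1,\infty)$.
   Context: $B_R=\{x\in\mathbb{R}^N: |x|<R\}$. Property (P) in $\mathbb{R}^N$: a function $0<\Psi\in C([1,\infty))$ satisfies (P) if whenever $\varphi\in L^\infty_{loc}(\mathbb{R}^N)$ is a positive function and $\sigma\in H^1_{loc}(\mathbb{R}^N)$ satisfies $\sigma\,\mathrm{div}(\varphi^2\nabla\sigma)\geq 0$ in $\mathbb{R}^N$ in the distributional sense, and $\int_{B_R}(\varphi\sigma)^2\,dx\leq \Psi(R)$ for every $R\geq 1$, then $\sigma$ is necessarily constant. Property (P') in $\mathbb{R}^N$: the same as (P), with the inequality replaced by the equation $\mathrm{div}(\varphi^2\nabla\sigma)=0$ in $\mathbb{R}^N$ in the distributional sense. That is, $0<\Psi\in C([1,\infty))$ satisfies (P') if whenever $\varphi\in L^\infty_{loc}(\mathbb{R}^N)$ is a positive function, $\sigma\in H^1_{loc}(\mathbb{R}^N)$ satisfies $\mathrm{div}(\varphi^2\nabla\sigma)=0$ in the distributional sense, and $\int_{B_R}(\varphi\sigma)^2\,dx\leq\Psi(R)$ for every $R\geq 1$, then $\sigma$ is constant. Here $\sigma\,\mathrm{div}(\varphi^2\nabla\sigma)\geq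 0$ in the distributional sense means $\int_{\mathbb{R}^N}\left(\eta\,\varphi^2|\nabla\sigma|^2+\varphi^2\sigma\,\nabla\sigma\cdot\nabla\eta\right)dx\leq 0$ for every $0\leq\eta\in C_c^\infty(\mathbb{R}^N)$, and $\mathrm{div}(\varphi^2\nabla\sigma)=0$ in the distributional sense means $\int_{\mathbb{R}^N}\varphi^2\nabla\sigma\cdot\nabla\eta\,dx=0$ for every $\eta\in C_c^\infty(\mathbb{R}^N)$. As usual for such function classes, positivity of $\varphi$ and constancy of $\sigma$ are understood almost everywhere. For a nondecreasing function $h$, $h'\geq 0$ denotes its derivative, which exists almost everywhere; $1/h'$ is taken to be $+\infty$ where $h'=0$, and $\int 1/h'$ is a Lebesgue integral with values in $[0,+\infty]$. *)

theory Defs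
  imports "HOL-Analysis.Analysis"
begin

text \<open>Euclidean space \<open>\<real>\<^sup>N\<close> is \<open>real ^ 'n\<close> with \<open>N = CARD('n) \<ge> 1\<close>. Functions in the spaces below are
  Lebesgue measurable representatives; all conditions on them are invariant under
  modification on Lebesgue null sets.\<close>

definition partial_deriv :: "'n::finite \<Rightarrow> (real^'n \<Rightarrow> real) \<Rightarrow> real^'n \<Rightarrow> real" where
  "partial_deriv i f x = frechet_derivative f (at x) (axis i 1)"

definition grad :: "(real^'n::finite \<Rightarrow> real) \<Rightarrow> real^'n \<Rightarrow> real^'n" where
  "grad f x = (\<chi> i. partial_deriv i f x)"

primrec Ck :: "nat \<Rightarrow> (real^'n::finite \<Rightarrow> real) \<Rightarrow> bool" where
  "Ck 0 f \<longleftrightarrow> continuous_on UNIV f"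
| "Ck (Suc k) f \<longleftrightarrow> (\<forall>x. f differentiable (at x)) \<and> (\<forall>i. Ck k (partial_deriv i f))"

definition Cc_infinity :: "(real^'n::finite \<Rightarrow> real) set" where
  "Cc_infinity = {\<eta>. (\<forall>k. Ck k \<eta>) \<and> compact (closure {x. \<eta> x \<noteq> 0})}"

definition Linf_loc :: "(real^'n::finite \<Rightarrow> real) set" where
  "Linf_loc = {f. f \<in> borel_measurable lebesgue \<and>
     (\<forall>K. compact K \<longrightarrow> (\<exists>C. AE x in lebesgue. x \<in> K \<longrightarrow> \<bar>f x\<bar> \<le> C))}"

definition L2_loc :: "(real^'n::finite \<Rightarrow> 'b::euclidean_space) set" where
  "L2_loc = {f. f \<in> borel_measurable lebesgue \<and>
     (\<forall>K. compact K \<longrightarrow> set_integrable lebesgue K (\<lambda>x. (norm (f x))\<^sup>2))}"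

text \<open>\<open>G\<close> is a locally square-integrable weak gradient of \<open>\<sigma>\<close>; such a \<open>G\<close> is unique up to
  null sets.\<close>

definition weak_gradient :: "(real^'n::finite \<Rightarrow> real) \<Rightarrow> (real^'n \<Rightarrow> real^'n) \<Rightarrow> bool" where
  "weak_gradient \<sigma> G \<longleftrightarrow> G \<in> L2_loc \<and>
     (\<forall>\<eta>\<in>Cc_infinity. \<forall>i.
        (LINT x|lebesgue. \<sigma> x * partial_deriv i \<eta> x) = - (LINT x|lebesgue. G x $ i * \<eta> x))"

definition H1_loc :: "(real^'n::finite \<Rightarrow> real) set" where
  "H1_loc = {\<sigma>. \<sigma> \<in> L2_loc \<and> (\<exists>G. weak_gradient \<sigma> G)}"

text \<open>The two differential conditions
  \<open>\<sigma> div (\<phi>\<^sup>2 \<nabla>\<sigma>) \<ge> 0\<close> and \<open>div (\<phi>\<^sup>2 \<nabla>\<sigma>) = 0\<close> in the distributional sense, where \<open>G\<close> stands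
  for \<open>\<nabla>\<sigma>\<close>.\<close>

definition sigma_div_nonneg ::
  "(real^'n::finite \<Rightarrow> real) \<Rightarrow> (real^'n \<Rightarrow> real) \<Rightarrow> (real^'n \<Rightarrow> real^'n) \<Rightarrow> bool" where
  "sigma_div_nonneg \<phi> \<sigma> G \<longleftrightarrow>
     (\<forall>\<eta>\<in>Cc_infinity. (\<forall>x. 0 \<le> \<eta> x) \<longrightarrow>
        (LINT x|lebesgue. \<eta> x * (\<phi> x)\<^sup>2 * (norm (G x))\<^sup>2
                        + (\<phi> x)\<^sup>2 * \<sigma> x * (G x \<bullet> grad \<eta> x)) \<le> 0)"

definition div_zero :: "(real^'n::finite \<Rightarrow> real) \<Rightarrow> (real^'n \<Rightarrow> real^'n) \<Rightarrow> bool" where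
  "div_zero \<phi> G \<longleftrightarrow>
     (\<forall>\<eta>\<in>Cc_infinity. (LINT x|lebesgue. (\<phi> x)\<^sup>2 * (G x \<bullet> grad \<eta> x)) = 0)"

text \<open>The type argument records the space \<open>\<real>\<^sup>N\<close> in which the property is considered. As weak
  gradients are unique almost everywhere, quantifying over all weak gradients \<open>G\<close> of
  \<open>\<sigma>\<close> amounts to taking \<open>G = \<nabla>\<sigma>\<close>.\<close>

definition property_P :: "'n::finite itself \<Rightarrow> (real \<Rightarrow> real) \<Rightarrow> bool" where
  "property_P N \<Psi> \<longleftrightarrow>
     (\<forall>(\<phi> :: real^'n \<Rightarrow> real) \<sigma> G.
        \<phi> \<in> Linf_loc \<longrightarrow> (AE x in lebesgue. 0 < \<phi> x) \<longrightarrow>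
        \<sigma> \<in> H1_loc \<longrightarrow> weak_gradient \<sigma> G \<longrightarrow> sigma_div_nonneg \<phi> \<sigma> G \<longrightarrow>
        (\<forall>R\<ge>1. (LINT x:ball 0 R|lebesgue. (\<phi> x * \<sigma> x)\<^sup>2) \<le> \<Psi> R) \<longrightarrow>
        (\<exists>c. AE x in lebesgue. \<sigma> x = c))"

definition property_P' :: "'n::finite itself \<Rightarrow> (real \<Rightarrow> real) \<Rightarrow> bool" where
  "property_P' N \<Psi> \<longleftrightarrow>
     (\<forall>(\<phi> :: real^'n \<Rightarrow> real) \<sigma> G.
        \<phi> \<in> Linf_loc \<longrightarrow> (AE x in lebesgue. 0 < \<phi> x) \<longrightarrow>
        \<sigma> \<in> H1_loc \<longrightarrow> weak_gradient \<sigma> G \<longrightarrow> div_zero \<phi> G \<longrightarrow>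
        (\<forall>R\<ge>1. (LINT x:ball 0 R|lebesgue. (\<phi> x * \<sigma> x)\<^sup>2) \<le> \<Psi> R) \<longrightarrow>
        (\<exists>c. AE x in lebesgue. \<sigma> x = c))"

text \<open>\<open>\<integral>\<^sub>1\<^sup>\<infinity> 1/h'\<close> with values in \<open>[0,\<infinity>]\<close>. In \<open>ennreal\<close>, \<open>1 / 0 = \<infinity>\<close>. The value of \<open>deriv h\<close> is
  unspecified where \<open>h\<close> is not differentiable, which for monotone \<open>h\<close> is a null set.\<close>

definition integral_recip_deriv :: "(real \<Rightarrow> real) \<Rightarrow> ennreal" where
  "integral_recip_deriv h = (\<integral>\<^sup>+x\<in>{1..}. 1 / ennreal (deriv h x) \<partial>lebesgue)"

end

theory Submission
  imports Defs "HOL-Computational_Algebra.Polynomial"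
begin

text \<open>Write \<open>h(R)\<close> and \<open>D(R)\<close> for the integrals of \<open>(\<phi>\<sigma>)\<^sup>2\<close> and of \<open>\<phi>\<^sup>2|\<nabla>\<sigma>|\<^sup>2\<close> over \<open>B\<^sub>R\<close>.

(iii) implies (i). Testing \<open>\<sigma> div(\<phi>\<^sup>2\<nabla>\<sigma>) \<ge> 0\<close> with a cutoff between \<open>B\<^sub>r\<close> and \<open>B\<^sub>R\<close> yields the
Caccioppoli inequality \<open>(D(r)(R - r))\<^sup>2 \<le> C (h(R) - h(r)) (D(R) - D(r))\<close> (\<open>caccioppoli\<close>). It is a
discrete form of \<open>D\<^sup>2 \<le> C h' D'\<close>, that is, of \<open>1/h' \<le> C (- 1/D)'\<close>, and so \<open>1/h'\<close> is integrable at
infinity as soon as \<open>D\<close> is positive somewhere. To conclude without differentiating \<open>h\<close> or \<open>D\<close>, and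
to obtain a function that is admissible from radius \<open>1\<close> on, half of \<open>h\<close> is interpolated linearly on a
grid along which \<open>h\<close> and \<open>D\<close> at most double; the integral of the reciprocal slope is then a
telescoping sum (\<open>admissible_from_growth\<close>). Under (iii) this forces \<open>D = 0\<close>, hence
\<open>\<nabla>\<sigma> = 0\<close> almost everywhere and \<open>\<sigma>\<close> is constant (\<open>weak_gradient_zero_imp_const\<close>).

(i) implies (ii). A solution of \<open>div(\<phi>\<^sup>2\<nabla>\<sigma>) = 0\<close> satisfies the inequality in (i) with equality: test
the equation with \<open>\<eta>\<sigma>\<close>. This product is only an \<open>H\<^sup>1\<close> function, so it is replaced by its
mollifications, whose gradients converge weakly in \<open>L\<^sup>2\<close> (\<open>div_zero_imp_sigma_div_nonneg\<close>).

(ii) implies (iii). Suppose that \<open>h\<close> is admissible with \<open>\<integral> 1/h' < \<infinity>\<close>. The increments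
\<open>f(r) = h(r) - h(r - 1)\<close> are continuous, their integral over \<open>[2,R]\<close> is at most \<open>h(R)\<close> by
telescoping, and \<open>1/f(r)\<close> is at most the integral of \<open>1/h'\<close> over \<open>[r - 1,r]\<close> by the Cauchy-Schwarz
inequality; hence \<open>\<integral> 1/f < \<infinity>\<close> (\<open>continuous_density_of_admissible\<close>). Extend \<open>f\<close> to an even
positive function \<open>F\<close> on the line, let \<open>\<sigma>(x)\<close> be an antiderivative of \<open>1/F\<close> evaluated at one coordinate
\<open>x\<^sub>i\<close>, and let \<open>\<phi>\<^sup>2 = \<kappa> F(x\<^sub>i) w\<close> with an integrable weight \<open>w\<close> in the remaining coordinates. Then
\<open>\<phi>\<^sup>2\<nabla>\<sigma> = \<kappa> w e\<^sub>i\<close> has divergence zero, and since \<open>\<sigma>\<close> is bounded, the growth of \<open>\<integral> (\<phi>\<sigma>)\<^sup>2\<close> is that of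
\<open>\<integral> F\<close>, which stays below \<open>\<Psi>\<close> for small \<open>\<kappa>\<close> (\<open>property_P'_imp_integral_infinite\<close>). The derivative
of \<open>h\<close> enters only in the bound for \<open>1/f\<close>, which rests on Lebesgue's theorem that monotone functions are
differentiable almost everywhere (\<open>mono_continuous_differentiable_AE\<close>).\<close>

section \<open>Test functions and integration by parts\<close>

lemma integrable_continuous_compact_support:
  fixes f :: "'a::euclidean_space \<Rightarrow> real"
  assumes cont: "continuous_on UNIV f" and K: "compact K" "\<And>x. x \<notin> K \<Longrightarrow> f x = 0"
  shows "integrable lborel f"
proof -
  have "integrable lborel (\<lambda>x. indicator K x *\<^sub>R f x)"
    using K(1) by (rule borel_integrable_compact) (rule continuous_on_subset[OF cont], simp)
  moreover have "(\<lambda>x. indicator K x *\<^sub>R f x) = f"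
    using K(2) by (fastforce simp: indicator_def)
  ultimately show ?thesis by simp
qed

lemma bounded_continuous_compact_support:
  fixes f :: "'a::euclidean_space \<Rightarrow> real"
  assumes cont: "continuous_on UNIV f" and K: "compact K" "\<And>x. x \<notin> K \<Longrightarrow> f x = 0"
  obtains M where "0 \<le> M" "\<And>x. \<bar>f x\<bar> \<le> M"
proof -
  have "bounded (f ` K)"
    using compact_continuous_image[OF continuous_on_subset[OF cont] K(1)] compact_imp_bounded by blast
  then obtain M where "\<And>x. x \<in> K \<Longrightarrow> \<bar>f x\<bar> \<le> M" by (auto simp: bounded_iff)
  then have "\<bar>f x\<bar> \<le> max M 0" for x using K(2)[of x] by (cases "x \<in> K") (auto simp: le_max_iff_disj)
  then show ?thesis using that[of "max M 0"] by simp
qed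

lemma lborel_integral_shift:
  fixes f :: "'a::euclidean_space \<Rightarrow> 'b::{banach, second_countable_topology}"
  assumes [measurable]: "f \<in> borel_measurable borel"
  shows "(LINT x|lborel. f (x + c)) = (LINT x|lborel. f x)"
    and "integrable lborel (\<lambda>x. f (x + c)) \<longleftrightarrow> integrable lborel f"
proof -
  have "(LINT x|lborel. f x) = (LINT x|distr lborel borel ((+) c). f x)"
    by (simp add: lborel_distr_plus)
  also have "\<dots> = (LINT x|lborel. f (x + c))" by (subst integral_distr) (auto simp: add.commute)
  finally show "(LINT x|lborel. f (x + c)) = (LINT x|lborel. f x)" by simp
  have "integrable lborel f \<longleftrightarrow> integrable (distr lborel borel ((+) c)) f"
    by (simp add: lborel_distr_plus)
  also have "\<dots> \<longleftrightarrow> integrable lborel (\<lambda>x. f (x + c))"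
    by (subst integrable_distr_eq) (auto simp: add.commute)
  finally show "integrable lborel (\<lambda>x. f (x + c)) \<longleftrightarrow> integrable lborel f" by simp
qed

text \<open>The difference quotients of \<open>u\<close> in direction \<open>e\<close> have integral zero by translation invariance, and by the
mean value theorem they are bounded on a fixed compact set, so dominated convergence applies. This replaces
an integration over lines.\<close>

lemma integral_directional_derivative_eq_0:
  fixes u v :: "'a::euclidean_space \<Rightarrow> real"
  assumes u: "continuous_on UNIV u" and v: "continuous_on UNIV v"
    and deriv: "\<And>x. ((\<lambda>t. u (x + t *\<^sub>R e)) has_real_derivative v x) (at 0)"
    and K: "compact K" "\<And>x. x \<notin> K \<Longrightarrow> u x = 0"
  shows "(LINT x|lborel. v x) = 0"
proof -
  have [measurable]: "u \<in> borel_measurable borel" "v \<in> borel_measurable borel"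
    using u v by (auto intro: borel_measurable_continuous_onI)
  have deriv': "((\<lambda>t. u (x + t *\<^sub>R e)) has_real_derivative v (x + s *\<^sub>R e)) (at s)" for x s
  proof -
    have "((\<lambda>t. u ((x + s *\<^sub>R e) + t *\<^sub>R e)) has_real_derivative v (x + s *\<^sub>R e)) (at 0)"
      by (rule deriv)
    then show ?thesis
      using DERIV_shift[of "\<lambda>t. u (x + t *\<^sub>R e)" "v (x + s *\<^sub>R e)" 0 s]
      by (simp add: algebra_simps)
  qed
  have v0: "v x = 0" if "x \<notin> K" for x
  proof -
    have "((\<lambda>t. u (x + t *\<^sub>R e)) has_real_derivative 0) (at 0)"
    proof (rule DERIV_cong_ev[THEN iffD1, OF refl _ refl DERIV_const])
      have "open ((\<lambda>t. x + t *\<^sub>R e) -` (- K))"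
        using K(1) by (intro open_vimage continuous_intros) (simp add: compact_imp_closed open_Compl)
      then have "\<forall>\<^sub>F t in nhds 0. t \<in> (\<lambda>t. x + t *\<^sub>R e) -` (- K)"
        using that by (intro eventually_nhds_in_open) auto
      then show "\<forall>\<^sub>F t in nhds 0. 0 = u (x + t *\<^sub>R e)"
        by eventually_elim (use K(2) in auto)
    qed
    then show ?thesis using deriv[of x] DERIV_unique by blast
  qed
  obtain M where M: "0 \<le> M" "\<And>x. \<bar>v x\<bar> \<le> M"
    using bounded_continuous_compact_support[OF v K(1) v0] by blast
  \<comment> \<open>\<open>K'\<close> below contains the supports of all difference quotients with steps in \<open>[0,1]\<close>.\<close>
  define d where "d = (\<lambda>n. inverse (real (Suc n)))"
  have d: "d n > 0" "d n \<le> 1" "d \<longlonglongrightarrow> 0" for n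
    unfolding d_def using LIMSEQ_inverse_real_of_nat by (auto simp: filterlim_def field_simps)
  define K' where "K' = (\<lambda>p. fst p - snd p *\<^sub>R e) ` (K \<times> {0..1})"
  have K': "compact K'"
    unfolding K'_def by (intro compact_continuous_image compact_Times K continuous_intros) auto
  have meas_K': "K' \<in> sets lborel" using K' by (simp add: borel_compact)
  define q where "q = (\<lambda>n x. (u (x + d n *\<^sub>R e) - u x) / d n)"
  have qbound: "\<bar>q n x\<bar> \<le> M * indicator K' x" for n x
  proof (cases "x \<in> K'")
    case True
    obtain z where "u (x + d n *\<^sub>R e) - u x = (d n - 0) * v (x + z *\<^sub>R e)"
      using MVT2[of 0 "d n" "\<lambda>t. u (x + t *\<^sub>R e)" "\<lambda>t. v (x + t *\<^sub>R e)"] d(1)[of n] deriv'[of x] by auto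
    then have "q n x = v (x + z *\<^sub>R e)" using d(1)[of n] by (simp add: q_def)
    then show ?thesis using M True by simp
  next
    case False
    have "x + s *\<^sub>R e \<notin> K" if "s \<in> {0..1}" for s
    proof
      assume "x + s *\<^sub>R e \<in> K"
      then have "x \<in> K'" unfolding K'_def using that by (intro image_eqI[of _ _ "(x + s *\<^sub>R e, s)"]) auto
      with False show False by simp
    qed
    from this[of 0] this[of "d n"] have "u x = 0" "u (x + d n *\<^sub>R e) = 0"
      using d(1,2)[of n] K(2) by auto
    then show ?thesis using False by (simp add: q_def)
  qed
  have "(\<lambda>n. LINT x|lborel. q n x) \<longlonglongrightarrow> (LINT x|lborel. v x)"
  proof (rule integral_dominated_convergence[where w = "\<lambda>x. M * indicator K' x"])
    show "integrable lborel (\<lambda>x. M * indicator K' x)"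
      using K' meas_K' emeasure_compact_finite[OF K'] by (intro integrable_mult_right integrable_real_indicator) auto
    show "AE x in lborel. (\<lambda>n. q n x) \<longlonglongrightarrow> v x"
    proof (rule AE_I2)
      fix x
      have "((\<lambda>t. (u (x + t *\<^sub>R e) - u x) / t) \<longlongrightarrow> v x) (at 0)"
        using deriv[of x] by (simp add: DERIV_def)
      then show "(\<lambda>n. q n x) \<longlonglongrightarrow> v x"
        unfolding q_def using d(1)
        by (intro tendsto_compose_at[of d 0 sequentially "\<lambda>t. (u (x + t *\<^sub>R e) - u x) / t", unfolded o_def] d)
           (auto simp: less_imp_neq[symmetric] eventually_sequentially intro!: exI[of _ 0])
    qed
  qed (use qbound in \<open>auto simp: q_def\<close>)
  moreover have "(LINT x|lborel. q n x) = 0" for n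
  proof -
    have "integrable lborel u" using integrable_continuous_compact_support[OF u K] .
    then show ?thesis
      unfolding q_def using lborel_integral_shift[of u "d n *\<^sub>R e"] by simp
  qed
  ultimately show ?thesis by (simp add: LIMSEQ_const_iff)
qed

lemma Cc_infinity_continuous: "\<eta> \<in> Cc_infinity \<Longrightarrow> continuous_on UNIV \<eta>"
  unfolding Cc_infinity_def using Ck.simps(1) by blast

text \<open>A derivative given by an inner product identifies \<open>grad\<close>, whose definition goes through partial derivatives.\<close>

lemma grad_eqI:
  assumes "(f has_derivative (\<lambda>v. w \<bullet> v)) (at x)"
  shows "grad f x = w" "partial_deriv i f x = w $ i" "f differentiable (at x)"
proof -
  show p: "partial_deriv i f x = w $ i" for i
    unfolding partial_deriv_def frechet_derivative_at[OF assms, symmetric] by (simp add: inner_axis)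
  show "grad f x = w" by (simp add: grad_def p vec_eq_iff)
  show "f differentiable (at x)" using assms differentiable_def by blast
qed

lemma differentiable_has_derivative_grad:
  assumes "f differentiable (at x)"
  shows "(f has_derivative (\<lambda>v. grad f x \<bullet> v)) (at x)"
proof -
  have D: "(f has_derivative frechet_derivative f (at x)) (at x)"
    using frechet_derivative_works assms by blast
  then interpret linear "frechet_derivative f (at x)" by (rule has_derivative_linear)
  have "frechet_derivative f (at x) v = grad f x \<bullet> v" for v
  proof -
    have "frechet_derivative f (at x) v = frechet_derivative f (at x) (\<Sum>i\<in>UNIV. (v $ i) *\<^sub>R axis i 1)"
      using basis_expansion[of v] by (simp add: scalar_mult_eq_scaleR)
    also have "\<dots> = (\<Sum>i\<in>UNIV. (v $ i) * partial_deriv i f x)"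
      by (simp add: sum scale partial_deriv_def)
    finally show ?thesis by (simp add: grad_def inner_vec_def mult.commute)
  qed
  then have "frechet_derivative f (at x) = (\<lambda>v. grad f x \<bullet> v)" by blast
  with D show ?thesis by simp
qed

lemma Cc_infinity_zero_outside:
  assumes "x \<notin> closure {x. \<eta> x \<noteq> (0::real)}"
  shows "\<eta> x = 0"
  using assms closure_subset[of "{x. \<eta> x \<noteq> 0}"] by blast

lemma Cc_infinity_has_derivative:
  assumes "\<eta> \<in> Cc_infinity"
  shows "(\<eta> has_derivative (\<lambda>v. grad \<eta> x \<bullet> v)) (at x)"
proof (rule differentiable_has_derivative_grad)
  have "Ck 1 \<eta>" using assms by (auto simp: Cc_infinity_def)
  then show "\<eta> differentiable (at x)" by simp
qed

lemma Cc_infinity_partial_deriv: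
  assumes "\<eta> \<in> Cc_infinity"
  shows "continuous_on UNIV (partial_deriv i \<eta>)"
    and "((\<lambda>t. \<eta> (x + t *\<^sub>R axis i 1)) has_real_derivative partial_deriv i \<eta> x) (at 0)"
    and "x \<notin> closure {x. \<eta> x \<noteq> 0} \<Longrightarrow> partial_deriv i \<eta> x = 0"
    and "partial_deriv i \<eta> \<in> Cc_infinity"
proof -
  have "Ck 1 \<eta>" using assms by (auto simp: Cc_infinity_def)
  then show "continuous_on UNIV (partial_deriv i \<eta>)" by simp
  have "(\<eta> has_derivative (\<lambda>v. grad \<eta> x \<bullet> v)) (at (x + 0 *\<^sub>R axis i 1))" for x
    using Cc_infinity_has_derivative[OF assms, of x] by simp
  then have "((\<lambda>t. \<eta> (x + t *\<^sub>R axis i 1)) has_derivative (\<lambda>t. grad \<eta> x \<bullet> (t *\<^sub>R axis i 1))) (at 0)" for x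
    by (rule has_derivative_compose[rotated]) (auto intro!: derivative_eq_intros)
  moreover have "(\<lambda>t. grad \<eta> x \<bullet> (t *\<^sub>R axis i 1)) = (*) (partial_deriv i \<eta> x)" for x
    by (rule ext) (simp add: grad_def inner_axis)
  ultimately show D: "((\<lambda>t. \<eta> (x + t *\<^sub>R axis i 1)) has_real_derivative partial_deriv i \<eta> x) (at 0)" for x
    unfolding has_field_derivative_def by metis
  have out: "\<eta> y = 0" if "y \<notin> closure {x. \<eta> x \<noteq> 0}" for y
    using that closure_subset[of "{x. \<eta> x \<noteq> 0}"] by blast
  show 0: "partial_deriv i \<eta> x = 0" if "x \<notin> closure {x. \<eta> x \<noteq> 0}" for x
  proof -
    have "((\<lambda>t. \<eta> (x + t *\<^sub>R axis i 1)) has_real_derivative 0) (at 0)"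
    proof (rule DERIV_cong_ev[THEN iffD1, OF refl _ refl DERIV_const])
      have "open ((\<lambda>t. x + t *\<^sub>R axis i 1) -` (- closure {x. \<eta> x \<noteq> 0}))"
        by (intro open_vimage continuous_intros) simp
      then have "\<forall>\<^sub>F t in nhds 0. t \<in> (\<lambda>t. x + t *\<^sub>R axis i 1) -` (- closure {x. \<eta> x \<noteq> 0})"
        using that by (intro eventually_nhds_in_open) auto
      then show "\<forall>\<^sub>F t in nhds 0. 0 = \<eta> (x + t *\<^sub>R axis i 1)"
      proof eventually_elim
        case (elim t)
        then show ?case using out[of "x + t *\<^sub>R axis i 1"] by simp
      qed
    qed
    then show ?thesis using D[of x] DERIV_unique by blast
  qed
  have "{x. partial_deriv i \<eta> x \<noteq> 0} \<subseteq> closure {x. \<eta> x \<noteq> 0}" using 0 by blast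
  then have "compact (closure {x. partial_deriv i \<eta> x \<noteq> 0})"
    using assms bounded_subset compact_imp_bounded unfolding Cc_infinity_def compact_closure by blast
  moreover have "Ck k (partial_deriv i \<eta>)" for k
  proof -
    have "Ck (Suc k) \<eta>" using assms by (auto simp: Cc_infinity_def)
    then show ?thesis by simp
  qed
  ultimately show "partial_deriv i \<eta> \<in> Cc_infinity"
    unfolding Cc_infinity_def by simp
qed

section \<open>Almost everywhere differentiability of continuous monotone functions\<close>

text \<open>Adding the identity to a monotone function makes it expanding, so that the inverse is Lipschitz.\<close>

lemma homeo_inverse:
  fixes h :: "real \<Rightarrow> real"
  assumes mono: "mono h" and cont: "continuous_on UNIV h"
  defines "H \<equiv> \<lambda>x. x + h x"
  shows "bij H" "strict_mono H" "continuous_on UNIV H" 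
    "\<And>a b. \<bar>inv H b - inv H a\<bar> \<le> \<bar>b - a\<bar>"
proof -
  show sm: "strict_mono H"
    unfolding H_def by (intro strict_monoI) (meson add_less_le_mono less_imp_le mono monoD)
  show c: "continuous_on UNIV H"
    unfolding H_def by (intro continuous_intros cont)
  have "\<exists>x. H x = y" for y
  proof -
    define b where "b = \<bar>y\<bar> + \<bar>h 0\<bar>"
    have "b \<ge> 0" by (simp add: b_def)
    have "h (-b) \<le> h 0" "h 0 \<le> h b" using mono \<open>b \<ge> 0\<close> by (auto intro!: monoD[OF mono])
    then have "H (-b) \<le> y" "y \<le> H b" unfolding H_def b_def by auto
    then obtain x where "H x = y"
      using IVT'[of H "-b" y b] c \<open>b \<ge> 0\<close> continuous_on_subset by (metis neg_le_0_iff_le order_trans subset_UNIV)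
    then show ?thesis by blast
  qed
  then have "surj H" by (metis surjI)
  then show bij: "bij H" using sm strict_mono_imp_inj_on by (simp add: bij_def)
  have *: "\<bar>x - y\<bar> \<le> \<bar>H x - H y\<bar>" for x y
    using monoD[OF mono, of x y] monoD[OF mono, of y x] unfolding H_def by (cases "x \<le> y") auto
  show "\<bar>inv H b - inv H a\<bar> \<le> \<bar>b - a\<bar>" for a b
    using *[of "inv H b" "inv H a"] \<open>surj H\<close> by (simp add: surj_f_inv_f)
qed

text \<open>The differentiation theorem \<open>integrable_ccontinuous_explicit\<close> concerns averages over cubes to the right of a point;
applied to \<open>w\<close> and to its reflection it gives both one-sided derivatives.\<close>

lemma has_real_derivative_indefinite_integral_AE:
  fixes w u :: "real \<Rightarrow> real"
  assumes "\<And>a b. a \<le> b \<Longrightarrow> (w has_integral (u b - u a)) {a..b}"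
  obtains N where "negligible N" "\<And>x. x \<notin> N \<Longrightarrow> (u has_real_derivative w x) (at x)"
proof -
  have int: "w integrable_on cbox a b" for a b
    using assms[of a b] by (cases "a \<le> b") (auto simp: has_integral_iff)
  have int': "(\<lambda>x. w (- x)) integrable_on cbox a b" for a b
    using int[of "-b" "-a"] integrable_reflect[of w "-a" "-b"] by simp
  obtain N1 where N1: "negligible N1" "\<And>x e. \<lbrakk>x \<notin> N1; 0 < e\<rbrakk> \<Longrightarrow>
      \<exists>d>0. \<forall>h. 0 < h \<and> h < d \<longrightarrow> \<bar>integral {x .. x + h} w / h - w x\<bar> < e"
    using integrable_ccontinuous_explicit[OF int] by (auto simp: divide_inverse mult.commute)
  obtain N2 where N2: "negligible N2" "\<And>x e. \<lbrakk>x \<notin> N2; 0 < e\<rbrakk> \<Longrightarrow>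
      \<exists>d>0. \<forall>h. 0 < h \<and> h < d \<longrightarrow> \<bar>integral {x .. x + h} (\<lambda>x. w (-x)) / h - w (-x)\<bar> < e"
    using integrable_ccontinuous_explicit[OF int'] by (auto simp: divide_inverse mult.commute)
  have neg: "negligible (uminus ` N2)"
  proof (rule negligible_locally_Lipschitz_image[OF _ N2(1)])
    show "\<exists>T B. open T \<and> x \<in> T \<and> (\<forall>y\<in>N2 \<inter> T. norm (- y - - x) \<le> B * norm (y - x))" for x
      by (intro exI[of _ UNIV] exI[of _ 1]) auto
  qed simp
  have I1: "integral {x .. x + h} w = u (x + h) - u x" if "h > 0" for x h
    using assms[of x "x+h"] that by (simp add: has_integral_iff)
  have I2: "integral {-x .. -x + h} (\<lambda>x. w (-x)) = u x - u (x - h)" if "h > 0" for x h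
    using assms[of "x-h" x] that has_integral_reflect_real[of w "u x - u (x-h)" x "x-h"]
    by (simp add: has_integral_iff)
  show ?thesis
  proof (rule that[of "N1 \<union> uminus ` N2"])
    show "negligible (N1 \<union> uminus ` N2)" using N1(1) neg by (rule negligible_Un)
    fix x assume "x \<notin> N1 \<union> uminus ` N2"
    then have x: "x \<notin> N1" "- x \<notin> N2" by (auto simp: image_iff)
    show "(u has_real_derivative w x) (at x)"
      unfolding DERIV_def LIM_def
    proof (intro allI impI)
      fix e :: real assume e: "0 < e"
      obtain d1 where d1: "d1 > 0" "\<And>h. 0 < h \<Longrightarrow> h < d1 \<Longrightarrow> \<bar>(u (x+h) - u x)/h - w x\<bar> < e"
        using N1(2)[OF x(1) e] I1 by metis
      obtain d2 where d2: "d2 > 0" "\<And>h. 0 < h \<Longrightarrow> h < d2 \<Longrightarrow> \<bar>(u x - u (x-h))/h - w x\<bar> < e"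
        using N2(2)[OF x(2) e] I2[of _ x] by (metis minus_minus)
      have "\<bar>(u (x+h) - u x)/h - w x\<bar> < e" if "h \<noteq> 0" "\<bar>h\<bar> < min d1 d2" for h
      proof (cases "h > 0")
        case True then show ?thesis using d1 that by auto
      next
        case False
        then have "\<bar>(u x - u (x-(-h)))/(-h) - w x\<bar> < e" using d2(2)[of "-h"] that by auto
        moreover have "(u x - u (x-(-h)))/(-h) = (u (x+h) - u x)/h"
          using that by (simp add: field_simps)
        ultimately show ?thesis by simp
      qed
      then show "\<exists>s>0. \<forall>h. h \<noteq> 0 \<and> dist h 0 < s \<longrightarrow> dist ((u (x + h) - u x) / h) (w x) < e"
        using d1(1) d2(1) by (intro exI[of _ "min d1 d2"]) (auto simp: dist_real_def)
    qed
  qed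
qed

text \<open>Lebesgue's theorem for continuous monotone functions. The inverse \<open>u\<close> of \<open>H(x) = x + h(x)\<close> is Lipschitz.
Therefore the image of Lebesgue measure under \<open>H\<close>, which gives \<open>[a,b]\<close> the mass \<open>u(b) - u(a)\<close>, has a
density \<open>w\<close>, and \<open>u' = w\<close> almost everywhere. The exceptional points of \<open>H\<close> lie in the image under
\<open>u\<close> of a null set, which is null, or in the preimage under \<open>H\<close> of \<open>{w = 0}\<close>, which has measure
\<open>\<integral>\<^bsub>{w = 0}\<^esub> w = 0\<close>.\<close>

theorem mono_continuous_differentiable_AE:
  fixes h :: "real \<Rightarrow> real"
  assumes mono: "mono h" and cont: "continuous_on UNIV h"
  shows "AE x in lborel. h differentiable (at x)"
proof -
  define H where "H = (\<lambda>x. x + h x)"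
  define u where "u = inv H"
  note H = homeo_inverse[OF mono cont, folded H_def u_def]
  have Hu: "H (u y) = y" and uH: "u (H x) = x" for x y
    using H(1) by (auto simp: u_def bij_is_surj surj_f_inv_f bij_is_inj inv_f_f)
  have [measurable]: "H \<in> borel_measurable borel"
    using H(3) by (rule borel_measurable_continuous_onI)
  have umono: "u a \<le> u b \<longleftrightarrow> a \<le> b" for a b
    using strict_mono_less_eq[OF H(2), of "u a" "u b"] by (simp add: Hu)
  have uneg: "negligible (u ` A)" if "negligible A" for A
  proof (rule negligible_locally_Lipschitz_image[OF _ that])
    show "\<exists>T B. open T \<and> x \<in> T \<and> (\<forall>y\<in>A \<inter> T. norm (u y - u x) \<le> B * norm (y - x))" for x
      using H(4) by (intro exI[of _ UNIV] exI[of _ 1]) auto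
  qed simp
  define M where "M = distr lborel borel H"
  have ac: "absolutely_continuous lborel M"
    unfolding absolutely_continuous_def
  proof
    fix A :: "real set" assume A: "A \<in> null_sets lborel"
    have "negligible A" using A by (simp add: negligible_iff_null_sets null_sets_completionI)
    then have "negligible (u ` A)" by (rule uneg)
    moreover have "u ` A = H -` A" using Hu uH by (auto simp: image_iff) metis+
    ultimately have "emeasure lebesgue (H -` A) = 0"
      by (simp add: negligible_iff_null_sets null_sets_def)
    moreover have "H -` A \<in> sets lborel"
      using A measurable_sets[of H borel borel A] by (simp add: null_sets_def)
    ultimately have "emeasure lborel (H -` A) = 0"
      by simp
    then show "A \<in> null_sets M"
      using A by (simp add: M_def null_sets_def emeasure_distr)
  qed
  obtain W where W[measurable]: "W \<in> borel_measurable lborel" and dens: "density lborel W = M"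
    using sigma_finite_measure.Radon_Nikodym[OF sigma_finite_lborel ac] by (auto simp: M_def)
  have MI: "emeasure M {a..b} = ennreal (u b - u a)" if "a \<le> b" for a b
  proof -
    have "H -` {a..b} = {u a .. u b}"
    proof (rule set_eqI)
      show "x \<in> H -` {a..b} \<longleftrightarrow> x \<in> {u a..u b}" for x
        using umono[of a "H x"] umono[of "H x" b] by (simp add: uH)
    qed
    then show ?thesis using that by (simp add: M_def emeasure_distr umono)
  qed
  have fin: "AE x in lborel. W x \<noteq> \<infinity>"
  proof -
    have "AE x in lborel. x \<in> {- real n..real n} \<longrightarrow> W x \<noteq> \<infinity>" for n
    proof -
      have "(\<integral>\<^sup>+x. W x * indicator {- real n..real n} x \<partial>lborel) = emeasure M {-real n..real n}"
        by (simp add: dens[symmetric] emeasure_density)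
      also have "\<dots> \<noteq> \<infinity>" using MI[of "-real n" "real n"] by simp
      finally have "AE x in lborel. W x * indicator {- real n..real n} x \<noteq> \<infinity>"
        by (intro nn_integral_PInf_AE) auto
      then show ?thesis by eventually_elim (auto simp: indicator_def)
    qed
    then have "AE x in lborel. \<forall>n. x \<in> {- real n..real n} \<longrightarrow> W x \<noteq> \<infinity>"
      unfolding AE_all_countable by blast
    then show ?thesis
    proof eventually_elim
      case (elim x)
      obtain n where "\<bar>x\<bar> \<le> real n" using real_arch_simple by blast
      then show ?case using elim[rule_format, of n] by (auto simp: abs_le_iff)
    qed
  qed
  define w where "w = (\<lambda>x. enn2real (W x))"
  have [measurable]: "w \<in> borel_measurable borel" using W by (auto simp: w_def)
  have wW: "AE x in lborel. ennreal (w x) = W x"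
    using fin by eventually_elim (simp add: w_def less_top)
  have hasint: "(w has_integral (u b - u a)) {a..b}" if "a \<le> b" for a b
  proof -
    have "(\<integral>\<^sup>+x. ennreal (w x * indicator {a..b} x) \<partial>lborel) = (\<integral>\<^sup>+x. W x * indicator {a..b} x \<partial>lborel)"
      by (rule nn_integral_cong_AE) (use wW in \<open>eventually_elim, auto simp: indicator_def\<close>)
    also have "\<dots> = ennreal (u b - u a)" using MI[OF that] by (simp add: dens[symmetric] emeasure_density)
    finally have "((\<lambda>x. w x * indicator {a..b} x) has_integral (u b - u a)) UNIV"
      using umono[of a b] that by (intro nn_integral_has_integral) (auto simp: w_def)
    moreover have "(\<lambda>x. w x * indicator {a..b} x) = (\<lambda>x. if x \<in> {a..b} then w x else 0)" by auto
    ultimately show ?thesis using has_integral_restrict_UNIV[of "{a..b}" w] by simp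
  qed
  obtain N where N: "negligible N" "\<And>x. x \<notin> N \<Longrightarrow> (u has_real_derivative w x) (at x)"
    using has_real_derivative_indefinite_integral_AE[OF hasint] by blast
  have 1: "negligible (u ` N)"
    using N(1) by (rule uneg)
  have 2: "AE x in lborel. w (H x) \<noteq> 0"
  proof -
    have "emeasure M {y. w y = 0} = (\<integral>\<^sup>+y. W y * indicator {y. w y = 0} y \<partial>lborel)"
      by (simp add: dens[symmetric] emeasure_density)
    also have "\<dots> = (\<integral>\<^sup>+(y::real). 0 \<partial>lborel)"
      by (rule nn_integral_cong_AE) (use wW in \<open>eventually_elim, auto simp: indicator_def\<close>)
    finally have "emeasure lborel (H -` {y. w y = 0}) = 0"
      by (simp add: M_def emeasure_distr)
    then show ?thesis by (intro AE_I[where N = "H -` {y. w y = 0}"]) (auto simp: vimage_def)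
  qed
  have 3: "AE x in lborel. x \<notin> u ` N"
    using AE_not_in[OF 1[unfolded negligible_iff_null_sets]] by (simp only: AE_completion_iff)
  from 2 3 show ?thesis
  proof eventually_elim
    case (elim x)
    have "H x \<notin> N" using elim(2) uH by (metis imageI)
    have "(H has_real_derivative inverse (w (H x))) (at x)"
    proof (rule DERIV_inverse_function[where f = u and g = H and a = "x - 1" and b = "x + 1"])
      show "DERIV u (H x) :> w (H x)" using N(2) \<open>H x \<notin> N\<close> .
      show "isCont H x" using H(3) by (simp add: continuous_on_eq_continuous_at)
    qed (use elim(1) uH in auto)
    then have "((\<lambda>y. H y - y) has_real_derivative inverse (w (H x)) - 1) (at x)"
      by (intro derivative_eq_intros) auto
    then have "(h has_real_derivative inverse (w (H x)) - 1) (at x)"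
      by (simp add: H_def)
    then show ?case using real_differentiable_def by blast
  qed
qed

section \<open>From an admissible function to a continuous density\<close>

lemma continuous_real_antiderivative:
  fixes f :: "real \<Rightarrow> real"
  assumes "continuous_on UNIV f"
  obtains F where "\<And>x. (F has_real_derivative f x) (at x)"
proof -
  have "\<exists>F. \<forall>x::real. (-\<infinity>::ereal) < x \<longrightarrow> x < (\<infinity>::ereal) \<longrightarrow> (F has_vector_derivative f x) (at x)"
    by (rule einterval_antiderivative)
      (use assms in \<open>auto simp: continuous_on_eq_continuous_at\<close>)
  then show ?thesis using that by (auto simp: has_real_derivative_iff_has_vector_derivative)
qed

text \<open>\<open>D\<close> is the lower limit of the forward difference quotients: this makes it Borel measurable everywhere,
and Fatou's lemma bounds its integral by the increment of \<open>h\<close>.\<close>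

lemma lower_derivative_mono:
  fixes h :: "real \<Rightarrow> real"
  assumes mono: "mono h" and cont: "continuous_on UNIV h"
  obtains D :: "real \<Rightarrow> ennreal" where
    "D \<in> borel_measurable borel"
    "AE x in lborel. D x = ennreal (deriv h x)"
    "\<And>a b. a \<le> b \<Longrightarrow> (\<integral>\<^sup>+x\<in>{a..b}. D x \<partial>lborel) \<le> ennreal (h b - h a)"
proof -
  have [measurable]: "h \<in> borel_measurable borel"
    using cont by (rule borel_measurable_continuous_onI)
  obtain P where P: "\<And>x. (P has_real_derivative h x) (at x)"
    using continuous_real_antiderivative[OF cont] by blast
  define e where "e = (\<lambda>n. inverse (real (Suc n)))"
  have e: "e n > 0" "e \<longlonglongrightarrow> 0" for n
    unfolding e_def using LIMSEQ_inverse_real_of_nat by (auto simp: filterlim_def)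
  define q where "q = (\<lambda>n x. (h (x + e n) - h x) / e n)"
  define D where "D = (\<lambda>x. liminf (\<lambda>n. ennreal (q n x)))"
  have [measurable]: "q n \<in> borel_measurable borel" for n unfolding q_def by measurable
  have q0: "0 \<le> q n x" for n x
    using monoD[OF mono, of x "x + e n"] e(1)[of n] by (auto simp: q_def)
  show ?thesis
  proof (rule that[of D])
    show "D \<in> borel_measurable borel" unfolding D_def by measurable
    from mono_continuous_differentiable_AE[OF mono cont]
    show "AE x in lborel. D x = ennreal (deriv h x)"
    proof eventually_elim
      case (elim x)
      then have "(h has_real_derivative deriv h x) (at x)"
        using DERIV_deriv_iff_real_differentiable by blast
      then have "((\<lambda>t. (h (x + t) - h x) / t) \<longlongrightarrow> deriv h x) (at 0)"
        by (simp add: DERIV_def)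
      then have "(\<lambda>n. q n x) \<longlonglongrightarrow> deriv h x"
        unfolding q_def using e
        by (intro tendsto_compose_at[of e 0 sequentially "\<lambda>t. (h (x + t) - h x) / t", unfolded o_def] e)
           (auto simp: less_imp_neq[symmetric] eventually_sequentially intro!: exI[of _ 0])
      then have "(\<lambda>n. ennreal (q n x)) \<longlonglongrightarrow> ennreal (deriv h x)"
        by (rule tendsto_ennrealI)
      then show ?case unfolding D_def by (intro lim_imp_Liminf) auto
    qed
    fix a b :: real assume ab: "a \<le> b"
    have int: "(\<integral>\<^sup>+x\<in>{a..b}. ennreal (q n x) \<partial>lborel) \<le> ennreal (h (b + e n) - h a)" for n
    proof -
      define Q where "Q = (\<lambda>x. (P (x + e n) - P x) / e n)"
      have Q: "DERIV Q x :> q n x" for x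
      proof -
        have "((\<lambda>x. P (x + e n)) has_real_derivative h (x + e n)) (at x)"
          using DERIV_shift[of P "h (x + e n)" x "e n"] P by simp
        then show ?thesis unfolding Q_def q_def
          using P[of x] e(1)[of n] by (auto intro!: derivative_eq_intros)
      qed
      have "(\<integral>\<^sup>+x\<in>{a..b}. ennreal (q n x) \<partial>lborel) = ennreal (Q b - Q a)"
        using nn_integral_FTC_Icc[of "q n" a b Q] Q q0 ab
        by (auto simp: indicator_def mult.commute intro: has_field_derivative_at_within)
      moreover have "h x \<le> Q x" "Q x \<le> h (x + e n)" for x
      proof -
        obtain z where z: "x < z" "z < x + e n" "P (x + e n) - P x = (x + e n - x) * h z"
          using MVT2[of x "x + e n" P h] P e(1)[of n] by auto
        then have "Q x = h z" using e(1)[of n] by (simp add: Q_def)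
        then show "h x \<le> Q x" "Q x \<le> h (x + e n)"
          using z monoD[OF mono] by (auto intro: less_imp_le)
      qed
      ultimately show ?thesis by (metis diff_mono ennreal_leI)
    qed
    have "(\<integral>\<^sup>+x\<in>{a..b}. D x \<partial>lborel) = (\<integral>\<^sup>+x. liminf (\<lambda>n. ennreal (q n x) * indicator {a..b} x) \<partial>lborel)"
      unfolding D_def by (intro nn_integral_cong) (auto simp: indicator_def Liminf_const)
    also have "\<dots> \<le> liminf (\<lambda>n. \<integral>\<^sup>+x\<in>{a..b}. ennreal (q n x) \<partial>lborel)"
      by (rule nn_integral_liminf) simp
    also have "\<dots> \<le> liminf (\<lambda>n. ennreal (h (b + e n) - h a))"
      by (rule Liminf_mono) (simp add: int)
    also have "\<dots> = ennreal (h b - h a)"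
    proof (rule lim_imp_Liminf)
      have "(\<lambda>n. b + e n) \<longlonglongrightarrow> b + 0" by (intro tendsto_intros e)
      then have "(\<lambda>n. h (b + e n)) \<longlonglongrightarrow> h b"
        using cont by (intro isCont_tendsto_compose[of b h]) (auto simp: continuous_on_eq_continuous_at)
      then show "(\<lambda>n. ennreal (h (b + e n) - h a)) \<longlonglongrightarrow> ennreal (h b - h a)"
        by (intro tendsto_intros)
    qed simp
    finally show "(\<integral>\<^sup>+x\<in>{a..b}. D x \<partial>lborel) \<le> ennreal (h b - h a)" .
  qed
qed

text \<open>The arithmetic-geometric mean inequality for \<open>1/D\<close> and \<open>l\<^sup>2 D\<close>. It extends to \<open>D = 0\<close> and \<open>D = \<infinity>\<close>
because then one of the two summands is infinite.\<close>

lemma ennreal_reciprocal_AM_GM: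
  assumes "l > 0"
  shows "ennreal (2 * l) \<le> 1 / D + ennreal (l\<^sup>2) * D"
proof (cases D)
  case (real d)
  show ?thesis
  proof (cases "d = 0")
    case True then show ?thesis using real by simp
  next
    case False
    have "0 \<le> (1 - l * d)\<^sup>2 / d" using real by simp
    also have "\<dots> = 1 / d + l\<^sup>2 * d - 2 * l" using False by (simp add: field_simps power2_eq_square)
    finally have "ennreal (2 * l) \<le> ennreal (1 / d + l\<^sup>2 * d)" by (intro ennreal_leI) simp
    also have "\<dots> = 1 / D + ennreal (l\<^sup>2) * D"
      using real False by (simp add: ennreal_plus ennreal_mult divide_ennreal flip: ennreal_1)
    finally show ?thesis .
  qed
next
  case top then show ?thesis using assms by (simp add: ennreal_mult_top)
qed

text \<open>The Cauchy-Schwarz inequality \<open>1 \<le> \<integral> D \<integral> 1/D\<close> on an interval of length \<open>1\<close>, obtained by integrating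
\<open>2l \<le> 1/D + l\<^sup>2 D\<close> and choosing \<open>l = 1/f\<close>. In this form it also shows that \<open>f = 0\<close> is impossible.\<close>

lemma reciprocal_increment_le:
  fixes D :: "real \<Rightarrow> ennreal" and f :: real
  assumes [measurable]: "D \<in> borel_measurable borel"
    and f: "0 \<le> f" "(\<integral>\<^sup>+x\<in>{r-1..r}. D x \<partial>lborel) \<le> ennreal f"
    and fin: "(\<integral>\<^sup>+x\<in>{r-1..r}. 1 / D x \<partial>lborel) < \<infinity>"
  shows "0 < f" "ennreal (1 / f) \<le> (\<integral>\<^sup>+x\<in>{r-1..r}. 1 / D x \<partial>lborel)"
proof -
  define J where "J = (\<integral>\<^sup>+x\<in>{r-1..r}. 1 / D x \<partial>lborel)"
  have *: "ennreal (2 * l) \<le> J + ennreal (l\<^sup>2 * f)" if "l > 0" for l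
  proof -
    have "ennreal (2 * l) = (\<integral>\<^sup>+x. ennreal (2 * l) * indicator {r-1..r} x \<partial>lborel)"
      by (simp add: nn_integral_cmult_indicator)
    also have "\<dots> \<le> (\<integral>\<^sup>+x. 1 / D x * indicator {r-1..r} x + ennreal (l\<^sup>2) * (D x * indicator {r-1..r} x) \<partial>lborel)"
      using ennreal_reciprocal_AM_GM[OF that] by (intro nn_integral_mono) (auto simp: indicator_def)
    also have "\<dots> = J + ennreal (l\<^sup>2) * (\<integral>\<^sup>+x\<in>{r-1..r}. D x \<partial>lborel)"
      unfolding J_def by (subst nn_integral_add) (auto simp: nn_integral_cmult)
    also have "\<dots> \<le> J + ennreal (l\<^sup>2) * ennreal f"
      using f by (intro add_mono mult_mono) auto
    finally show ?thesis using f by (simp add: ennreal_mult)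
  qed
  obtain j where j: "J = ennreal j" "j \<ge> 0" using fin by (cases J) (auto simp: J_def)
  have **: "2 * l \<le> j + l\<^sup>2 * f" if "l > 0" for l
    using *[OF that] j f by (simp add: ennreal_plus[symmetric] ennreal_le_iff del: ennreal_plus)
  show "0 < f" using **[of "j + 1"] f j by (cases "f = 0") auto
  then show "ennreal (1 / f) \<le> (\<integral>\<^sup>+x\<in>{r-1..r}. 1 / D x \<partial>lborel)"
    using **[of "1 / f"] j unfolding J_def[symmetric]
    by (simp add: power2_eq_square field_simps ennreal_leI)
qed

text \<open>Passing from \<open>h'\<close> to the unit increments of \<open>h\<close> averages \<open>h'\<close>: the result is continuous, its integral is still
controlled by \<open>h\<close> because the increments look backwards, and by convexity of the reciprocal the integral of
the reciprocal does not grow.\<close>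

lemma continuous_density_of_admissible:
  fixes h :: "real \<Rightarrow> real"
  assumes cont: "continuous_on {1..} h" and mono: "mono_on {1..} h" and nonneg: "\<And>r. r \<ge> 1 \<Longrightarrow> 0 \<le> h r"
    and fin: "integral_recip_deriv h \<noteq> \<infinity>"
  obtains f where "continuous_on UNIV f" "\<And>r. r \<ge> 2 \<Longrightarrow> 0 < f r"
    "\<And>R. R \<ge> 2 \<Longrightarrow> (\<integral>\<^sup>+r\<in>{2..R}. ennreal (f r) \<partial>lborel) \<le> ennreal (h R)"
    "(\<integral>\<^sup>+r\<in>{2..}. ennreal (1 / f r) \<partial>lborel) < \<infinity>" "0 < h 2"
proof -
  define g where "g = (\<lambda>x. h (max 1 x))"
  have gmono: "mono g" unfolding g_def by (intro monoI mono_onD[OF mono]) auto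
  have gcont: "continuous_on UNIV g" unfolding g_def
    by (rule continuous_on_compose2[OF cont]) (auto intro!: continuous_intros)
  have g0: "0 \<le> g x" for x by (simp add: g_def nonneg)
  obtain D where D[measurable]: "D \<in> borel_measurable borel"
    and Dae: "AE x in lborel. D x = ennreal (deriv g x)"
    and Dint: "\<And>a b. a \<le> b \<Longrightarrow> (\<integral>\<^sup>+x\<in>{a..b}. D x \<partial>lborel) \<le> ennreal (g b - g a)"
    using lower_derivative_mono[OF gmono gcont] by metis
  have J: "(\<integral>\<^sup>+x\<in>{1..}. 1 / D x \<partial>lborel) = integral_recip_deriv h"
  proof -
    have "AE x in lborel. x \<noteq> (1::real)" by (rule AE_lborel_singleton)
    with Dae have "AE x in lborel. 1 / D x * indicator {1..} x = 1 / ennreal (deriv h x) * indicator {1..} x"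
    proof eventually_elim
      case (elim x)
      show ?case
      proof (cases "1 < x")
        case True
        have "deriv g x = deriv h x"
        proof (rule deriv_cong_ev)
          show "\<forall>\<^sub>F x in nhds x. g x = h x"
            using eventually_nhds_in_open[of "{1<..}" x] True
            by (auto elim!: eventually_mono simp: g_def)
        qed simp
        then show ?thesis using elim by simp
      qed (use elim in auto)
    qed
    then show ?thesis
      unfolding integral_recip_deriv_def nn_integral_completion by (rule nn_integral_cong_AE)
  qed
  define f where "f = (\<lambda>r. g r - g (r - 1))"
  have fcont: "continuous_on UNIV f" unfolding f_def
    by (intro continuous_intros gcont continuous_on_compose2[OF gcont]) auto
  then have [measurable]: "f \<in> borel_measurable borel" by (rule borel_measurable_continuous_onI)
  have f0: "0 \<le> f r" for r using monoD[OF gmono, of "r-1" r] by (simp add: f_def)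
  have Jr: "(\<integral>\<^sup>+x\<in>{r-1..r}. 1 / D x \<partial>lborel) \<le> integral_recip_deriv h" if "r \<ge> 2" for r
    unfolding J[symmetric] using that by (intro nn_integral_mono) (auto simp: indicator_def)
  then have Jfin: "(\<integral>\<^sup>+x\<in>{r-1..r}. 1 / D x \<partial>lborel) < \<infinity>" if "r \<ge> 2" for r
    using that fin by (metis le_less_trans less_top infinity_ennreal_def)
  have pos: "0 < f r" and rec: "ennreal (1 / f r) \<le> (\<integral>\<^sup>+x\<in>{r-1..r}. 1 / D x \<partial>lborel)" if "r \<ge> 2" for r
    using reciprocal_increment_le[OF D f0 _ Jfin[OF that], of r] Dint[of "r-1" r] by (auto simp: f_def)
  show ?thesis
  proof (rule that[of f])
    show "continuous_on UNIV f" by fact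
    show "\<And>r. r \<ge> 2 \<Longrightarrow> 0 < f r" by fact
    show "0 < h 2" using pos[of 2] nonneg[of 1] by (simp add: f_def g_def)
    show "(\<integral>\<^sup>+r\<in>{2..R}. ennreal (f r) \<partial>lborel) \<le> ennreal (h R)" if R: "R \<ge> 2" for R
    proof -
      obtain P where P: "\<And>x. (P has_real_derivative g x) (at x)"
        using continuous_real_antiderivative[OF gcont] by blast
      define Q where "Q = (\<lambda>x. P x - P (x - 1))"
      have Q: "DERIV Q x :> f x" for x
      proof -
        have "((\<lambda>x. P (x - 1)) has_real_derivative g (x - 1)) (at x)"
          using DERIV_shift[of P "g (x - 1)" x "-1"] P by simp
        then show ?thesis unfolding Q_def f_def
          using P[of x] by (auto intro!: derivative_eq_intros)
      qed
      have "(\<integral>\<^sup>+r\<in>{2..R}. ennreal (f r) \<partial>lborel) = ennreal (Q R - Q 2)"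
        using nn_integral_FTC_Icc[of f 2 R Q] Q f0 R
        by (auto simp: indicator_def mult.commute intro: has_field_derivative_at_within)
      moreover have "0 \<le> Q x" "Q x \<le> g x" for x
      proof -
        obtain z where z: "x - 1 < z" "z < x" "P x - P (x - 1) = (x - (x - 1)) * g z"
          using MVT2[of "x - 1" x P g] P by auto
        then have "Q x = g z" by (simp add: Q_def)
        then show "0 \<le> Q x" "Q x \<le> g x"
          using z monoD[OF gmono, of z x] g0 by auto
      qed
      ultimately show ?thesis using R
        by (auto simp: g_def max_def intro!: ennreal_leI) (smt (verit))
    qed
    have "(\<integral>\<^sup>+r\<in>{2..}. ennreal (1 / f r) \<partial>lborel)
        \<le> (\<integral>\<^sup>+r. (\<integral>\<^sup>+x. indicator {2..} r * (1 / D x * indicator {r-1..r} x) \<partial>lborel) \<partial>lborel)"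
      using rec by (intro nn_integral_mono) (auto simp: indicator_def)
    also have "\<dots> = (\<integral>\<^sup>+x. (\<integral>\<^sup>+r. indicator {2..} r * (1 / D x * indicator {r-1..r} x) \<partial>lborel) \<partial>lborel)"
    proof (rule lborel_pair.Fubini')
      have "(\<lambda>p::real\<times>real. indicator {2..} (snd p) * (1 / D (fst p) * (if snd p - 1 \<le> fst p \<and> fst p \<le> snd p then 1 else 0))) \<in> borel_measurable (lborel \<Otimes>\<^sub>M lborel)"
        by measurable
      then show "(\<lambda>(x::real, r::real). indicator {2..} r * (1 / D x * indicator {r-1..r} x)) \<in> borel_measurable (lborel \<Otimes>\<^sub>M lborel)"
        by (simp add: case_prod_unfold indicator_def)
    qed
    also have "\<dots> \<le> (\<integral>\<^sup>+x. (\<integral>\<^sup>+r. (1 / D x * indicator {1..} x) * indicator {x..x+1} r \<partial>lborel) \<partial>lborel)"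
      by (intro nn_integral_mono) (auto simp: indicator_def)
    also have "\<dots> = integral_recip_deriv h"
      unfolding J[symmetric] by (subst nn_integral_cmult_indicator) auto
    finally show "(\<integral>\<^sup>+r\<in>{2..}. ennreal (1 / f r) \<partial>lborel) < \<infinity>"
      using fin by (metis le_less_trans less_top infinity_ennreal_def)
  qed
qed

section \<open>Counterexamples depending on one variable\<close>

lemma integral_by_parts_test_function:
  fixes s g :: "real^'n::finite \<Rightarrow> real"
  assumes s: "continuous_on UNIV s" and g: "continuous_on UNIV g"
    and deriv: "\<And>x. ((\<lambda>t. s (x + t *\<^sub>R axis i 1)) has_real_derivative g x) (at 0)"
    and \<eta>: "\<eta> \<in> Cc_infinity"
  shows "(LINT x|lebesgue. s x * partial_deriv i \<eta> x) = - (LINT x|lebesgue. g x * \<eta> x)"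
proof -
  define K where "K = closure {x. \<eta> x \<noteq> 0}"
  have K: "compact K" using \<eta> by (simp add: K_def Cc_infinity_def)
  have 0: "\<eta> x = 0" "partial_deriv i \<eta> x = 0" if "x \<notin> K" for x
    using that Cc_infinity_partial_deriv(3)[OF \<eta>] closure_subset[of "{x. \<eta> x \<noteq> 0}"] by (auto simp: K_def)
  note cont = Cc_infinity_continuous[OF \<eta>] Cc_infinity_partial_deriv(1)[OF \<eta>]
  have c1: "continuous_on UNIV (\<lambda>x. s x * partial_deriv i \<eta> x)"
    and c2: "continuous_on UNIV (\<lambda>x. g x * \<eta> x)"
    by (intro continuous_intros s g cont)+
  have int: "integrable lborel (\<lambda>x. s x * partial_deriv i \<eta> x)" "integrable lborel (\<lambda>x. g x * \<eta> x)"
    using integrable_continuous_compact_support[OF c1 K] integrable_continuous_compact_support[OF c2 K] 0 by auto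
  have "(LINT x|lborel. s x * partial_deriv i \<eta> x + g x * \<eta> x) = 0"
  proof (rule integral_directional_derivative_eq_0[where u = "\<lambda>x. s x * \<eta> x" and K = K and e = "axis i 1"])
    show "((\<lambda>t. s (x + t *\<^sub>R axis i 1) * \<eta> (x + t *\<^sub>R axis i 1)) has_real_derivative
        s x * partial_deriv i \<eta> x + g x * \<eta> x) (at 0)" for x
      using DERIV_mult[OF deriv[of x] Cc_infinity_partial_deriv(2)[OF \<eta>, of x i]]
      by (simp add: algebra_simps)
  qed (use 0 K s cont c1 c2 in \<open>auto intro!: continuous_intros\<close>)
  then have "(LINT x|lborel. s x * partial_deriv i \<eta> x) = - (LINT x|lborel. g x * \<eta> x)"
    using int by simp
  moreover have "(LINT x|lebesgue. s x * partial_deriv i \<eta> x) = (LINT x|lborel. s x * partial_deriv i \<eta> x)"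
    "(LINT x|lebesgue. g x * \<eta> x) = (LINT x|lborel. g x * \<eta> x)"
    using c1 c2 by (auto intro!: integral_completion borel_measurable_continuous_onI)
  ultimately show ?thesis by simp
qed

lemma continuous_imp_L2_loc:
  fixes f :: "real^'n::finite \<Rightarrow> 'b::euclidean_space"
  assumes f: "continuous_on UNIV f"
  shows "f \<in> L2_loc"
  unfolding L2_loc_def
proof (safe)
  have [measurable]: "f \<in> borel_measurable borel" using f by (rule borel_measurable_continuous_onI)
  then show "f \<in> borel_measurable lebesgue" by (simp add: measurable_completion)
  fix K :: "(real^'n) set" assume K: "compact K"
  then have [measurable]: "K \<in> sets borel" by (rule borel_compact)
  have "integrable lborel (\<lambda>x. indicator K x *\<^sub>R (norm (f x))\<^sup>2)"
    using K by (rule borel_integrable_compact) (intro continuous_intros continuous_on_subset[OF f], simp)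
  then show "set_integrable lebesgue K (\<lambda>x. (norm (f x))\<^sup>2)"
    unfolding set_integrable_def by (simp add: integrable_completion)
qed

lemma continuous_imp_Linf_loc:
  fixes f :: "real^'n::finite \<Rightarrow> real"
  assumes f: "continuous_on UNIV f"
  shows "f \<in> Linf_loc"
  unfolding Linf_loc_def
proof (safe)
  have "f \<in> borel_measurable borel" using f by (rule borel_measurable_continuous_onI)
  then show "f \<in> borel_measurable lebesgue" by (simp add: measurable_completion)
  fix K :: "(real^'n) set" assume K: "compact K"
  have "bounded (f ` K)"
    using compact_continuous_image[OF continuous_on_subset[OF f] K] compact_imp_bounded by blast
  then show "\<exists>C. AE x in lebesgue. x \<in> K \<longrightarrow> \<bar>f x\<bar> \<le> C" by (auto simp: bounded_iff)
qed

text \<open>A positive continuous weight in the coordinates other than \<open>e\<close> with finite integral over their span.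
It makes a function of one coordinate integrable over slabs.\<close>

definition transverse_weight :: "'a::euclidean_space \<Rightarrow> 'a \<Rightarrow> real" where
  "transverse_weight e x = (\<Prod>b\<in>Basis - {e}. exp (- \<bar>x \<bullet> b\<bar>))"

lemma transverse_weight:
  "continuous_on UNIV (transverse_weight e)" "0 < transverse_weight e x"
  "e \<in> Basis \<Longrightarrow> transverse_weight e (x + t *\<^sub>R e) = transverse_weight e x"
proof -
  show "continuous_on UNIV (transverse_weight e)"
    unfolding transverse_weight_def by (intro continuous_intros)
  show "0 < transverse_weight e x" unfolding transverse_weight_def by (intro prod_pos) simp
  show "transverse_weight e (x + t *\<^sub>R e) = transverse_weight e x" if "e \<in> Basis"
    unfolding transverse_weight_def
    by (rule prod.cong) (use that in \<open>auto simp: inner_add_left inner_not_same_Basis\<close>)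
qed

lemma nn_integral_even:
  fixes f :: "real \<Rightarrow> ennreal"
  assumes [measurable]: "f \<in> borel_measurable borel" and even: "\<And>x. f (- x) = f x"
  shows "(\<integral>\<^sup>+x. f x \<partial>lborel) = 2 * (\<integral>\<^sup>+x\<in>{0..}. f x \<partial>lborel)"
proof -
  have "AE x in lborel. x \<noteq> (0::real)" by (rule AE_lborel_singleton)
  then have "(\<integral>\<^sup>+x. f x \<partial>lborel) = (\<integral>\<^sup>+x. f x * indicator {0..} x + f x * indicator {..0} x \<partial>lborel)"
    by (intro nn_integral_cong_AE) (auto simp: indicator_def elim!: eventually_mono)
  also have "\<dots> = (\<integral>\<^sup>+x\<in>{0..}. f x \<partial>lborel) + (\<integral>\<^sup>+x\<in>{..0}. f x \<partial>lborel)"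
    by (rule nn_integral_add) auto
  also have "(\<integral>\<^sup>+x\<in>{..0}. f x \<partial>lborel) = (\<integral>\<^sup>+x\<in>{0..}. f x \<partial>lborel)"
    by (subst nn_integral_real_affine[where c = "-1" and t = 0])
       (auto simp: even indicator_def intro!: nn_integral_cong)
  finally show ?thesis by (simp add: mult_2)
qed

lemma nn_integral_exp_abs: "(\<integral>\<^sup>+t. ennreal (exp (- \<bar>t\<bar>)) \<partial>lborel) = 2"
proof -
  have "(\<integral>\<^sup>+t. ennreal (exp (- \<bar>t\<bar>)) \<partial>lborel) = 2 * (\<integral>\<^sup>+t\<in>{0..}. ennreal (exp (- \<bar>t\<bar>)) \<partial>lborel)"
    by (rule nn_integral_even) auto
  also have "(\<integral>\<^sup>+t\<in>{0..}. ennreal (exp (- \<bar>t\<bar>)) \<partial>lborel) = (\<integral>\<^sup>+t\<in>{0..}. ennreal (exp (- t)) \<partial>lborel)"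
    by (rule nn_integral_cong) (auto simp: indicator_def)
  also have "\<dots> = ennreal (0 - (- exp (- 0)))"
  proof -
    have "((\<lambda>x::real. - exp (- x)) \<longlongrightarrow> - 0) at_top"
      by (intro tendsto_minus filterlim_compose[OF exp_at_bot filterlim_uminus_at_bot_at_top])
    then have "(\<integral>\<^sup>+t. ennreal (exp (- t)) * indicator {0..} t \<partial>lborel) = ennreal (0 - (- exp (- 0)))"
      by (intro nn_integral_FTC_atLeast) (auto intro!: derivative_eq_intros)
    then show ?thesis .
  qed
  finally show ?thesis by simp
qed

lemma nn_integral_transverse_weight:
  fixes f :: "real \<Rightarrow> ennreal" and e :: "'a::euclidean_space"
  assumes [measurable]: "f \<in> borel_measurable borel" and e: "e \<in> Basis"
  shows "(\<integral>\<^sup>+x. f (x \<bullet> e) * ennreal (transverse_weight e x) \<partial>lborel)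
       = (\<integral>\<^sup>+t. f t \<partial>lborel) * 2 ^ (DIM('a) - 1)"
proof -
  define g where "g = (\<lambda>b::'a. if b = e then f else (\<lambda>t. ennreal (exp (- \<bar>t\<bar>))))"
  have [measurable]: "g b \<in> borel_measurable borel" for b by (auto simp: g_def)
  have "f (x \<bullet> e) * ennreal (transverse_weight e x) = (\<Prod>b\<in>Basis. g b (x \<bullet> b))" for x
    by (subst prod.remove[OF finite_Basis e]) (simp add: transverse_weight_def g_def prod_ennreal)
  then have "(\<integral>\<^sup>+x. f (x \<bullet> e) * ennreal (transverse_weight e x) \<partial>lborel) = (\<Prod>b\<in>Basis. \<integral>\<^sup>+t. g b t \<partial>lborel)"
    by (simp add: nn_integral_lborel_prod)
  also have "\<dots> = (\<integral>\<^sup>+t. f t \<partial>lborel) * (\<Prod>b\<in>Basis - {e}. 2)"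
    by (subst prod.remove[OF finite_Basis e]) (simp add: g_def nn_integral_exp_abs)
  finally show ?thesis using e by simp
qed

lemma continuous_AE_eq_const:
  fixes f :: "'a::euclidean_space \<Rightarrow> real"
  assumes f: "continuous_on UNIV f" and ae: "AE x in lebesgue. f x = c"
  shows "f x = c"
proof -
  have op: "open {x. f x \<noteq> c}" using f by (intro open_Collect_neq) auto
  then have "{x. f x \<noteq> c} \<in> sets lebesgue" by (simp add: borel_open)
  moreover have "AE x in lebesgue. x \<notin> {x. f x \<noteq> c}" using ae by simp
  ultimately have "{x. f x \<noteq> c} \<in> null_sets lebesgue" by (simp only: AE_iff_null_sets)
  then have "negligible {x. f x \<noteq> c}" by (simp add: negligible_iff_null_sets)
  with op have "{x. f x \<noteq> c} = {}" using open_not_negligible by blast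
  then show ?thesis by blast
qed


text \<open>The antiderivative vanishing at \<open>0\<close> is odd, so a bound from above on the right half line bounds it on
both sides.\<close>

lemma bounded_antiderivative_even:
  fixes g :: "real \<Rightarrow> real"
  assumes cont: "continuous_on UNIV g" and nonneg: "\<And>x. 0 \<le> g x" and even: "\<And>x. g (- x) = g x"
    and fin: "(\<integral>\<^sup>+t\<in>{a..}. ennreal (g t) \<partial>lborel) < \<infinity>"
  obtains s C where "\<And>x. (s has_real_derivative g x) (at x)" "\<And>x. \<bar>s x\<bar> \<le> C"
proof -
  have [measurable]: "g \<in> borel_measurable borel" using cont by (rule borel_measurable_continuous_onI)
  obtain s0 where s0: "\<And>x. (s0 has_real_derivative g x) (at x)"
    using continuous_real_antiderivative[OF cont] by blast
  define s where "s = (\<lambda>x. s0 x - s0 0)"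
  have s: "(s has_real_derivative g x) (at x)" for x
    unfolding s_def using s0[of x] by (auto intro!: derivative_eq_intros)
  have odd: "s (- x) = - s x" for x
  proof -
    have "((\<lambda>x. s x + s (- x)) has_real_derivative 0) (at x)" for x
    proof -
      have "((\<lambda>x. s (- x)) has_real_derivative g (- x) * (- 1)) (at x)"
        by (rule DERIV_chain2[OF s]) (auto intro!: derivative_eq_intros)
      from DERIV_add[OF s[of x] this] show ?thesis by (simp add: even)
    qed
    then have "s x + s (- x) = s 0 + s (- 0)" by (rule DERIV_isconst_all[rule_format, of "\<lambda>x. s x + s (- x)"]) 
    then show ?thesis by (simp add: s_def)
  qed
  define I where "I = (\<integral>\<^sup>+t\<in>{a..}. ennreal (g t) \<partial>lborel)"
  have le: "s x \<le> s a + enn2real I" for x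
  proof (cases "a \<le> x")
    case True
    have "ennreal (s x - s a) = (\<integral>\<^sup>+t\<in>{a..x}. ennreal (g t) \<partial>lborel)"
      using nn_integral_FTC_Icc[of g a x s] s nonneg True
      by (auto simp: indicator_def mult.commute intro: has_field_derivative_at_within)
    also have "\<dots> \<le> I" unfolding I_def by (intro nn_integral_mono) (auto simp: indicator_def)
    finally have "s x - s a \<le> enn2real I"
      using fin unfolding I_def[symmetric] by (cases I) (auto simp: ennreal_le_iff2)
    then show ?thesis by simp
  next
    case False
    then have "s x \<le> s a" using s nonneg by (intro DERIV_nonneg_imp_nondecreasing[of x a s]) auto
    then show ?thesis by (simp add: add_increasing2)
  qed
  show ?thesis
  proof (rule that[OF s])
    show "\<bar>s x\<bar> \<le> s a + enn2real I" for x using le[of x] le[of "-x"] by (auto simp: odd)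
  qed
qed

lemma positive_lower_bound:
  fixes \<Psi> :: "real \<Rightarrow> real"
  assumes \<Psi>: "continuous_on {1..} \<Psi>" "\<And>R. 1 \<le> R \<Longrightarrow> 0 < \<Psi> R" and c: "0 < c" "\<And>R. R \<ge> a \<Longrightarrow> c \<le> \<Psi> R"
  obtains m where "0 < m" "\<And>R. 1 \<le> R \<Longrightarrow> m \<le> \<Psi> R"
proof -
  have "continuous_on {1..max 1 a} \<Psi>" by (rule continuous_on_subset[OF \<Psi>(1)]) auto
  then obtain x where x: "x \<in> {1..max 1 a}" "\<forall>y\<in>{1..max 1 a}. \<Psi> x \<le> \<Psi> y"
    using continuous_attains_inf[of "{1..max 1 a}" \<Psi>] by auto
  show ?thesis
  proof (rule that[of "min c (\<Psi> x)"])
    show "0 < min c (\<Psi> x)" using x(1) \<Psi>(2) c by auto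
    show "min c (\<Psi> x) \<le> \<Psi> R" if "1 \<le> R" for R
      using x(2) c(2)[of R] that by (cases "R \<le> max 1 a") (auto simp: min_le_iff_disj)
  qed
qed

text \<open>The counterexample to (ii). All the data are functions of the single coordinate \<open>x\<^sub>i\<close> apart from the weight, which
does not depend on \<open>x\<^sub>i\<close>; both the weak gradient and the vanishing divergence thus reduce to integration by
parts along \<open>x\<^sub>i\<close>.\<close>

theorem property_P'_imp_integral_infinite:
  fixes \<Psi> h :: "real \<Rightarrow> real"
  assumes \<Psi>: "continuous_on {1..} \<Psi>" "\<And>R. 1 \<le> R \<Longrightarrow> 0 < \<Psi> R"
    and h: "continuous_on {1..} h" "mono_on {1..} h" "\<And>r. 1 \<le> r \<Longrightarrow> 0 \<le> h r" "\<And>r. 1 \<le> r \<Longrightarrow> h r \<le> \<Psi> r"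
    and P': "property_P' TYPE('n::finite) \<Psi>"
  shows "integral_recip_deriv h = \<infinity>"
proof (rule ccontr)
  assume fin: "integral_recip_deriv h \<noteq> \<infinity>"
  obtain f where f: "continuous_on UNIV f" "\<And>r. r \<ge> 2 \<Longrightarrow> 0 < f r"
    "\<And>R. R \<ge> 2 \<Longrightarrow> (\<integral>\<^sup>+r\<in>{2..R}. ennreal (f r) \<partial>lborel) \<le> ennreal (h R)"
    "(\<integral>\<^sup>+r\<in>{2..}. ennreal (1 / f r) \<partial>lborel) < \<infinity>" and h2: "0 < h 2"
    by (rule continuous_density_of_admissible[OF h(1,2) _ fin]) (erule h(3), rule that)
  have "h 2 \<le> \<Psi> R" if "R \<ge> 2" for R
    using mono_onD[OF h(2), of 2 R] h(4)[of R] that by auto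
  from positive_lower_bound[OF \<Psi> h2 this] obtain m where m: "0 < m" "\<And>R. 1 \<le> R \<Longrightarrow> m \<le> \<Psi> R"
    by blast
  define F where "F = (\<lambda>t. f (max 2 \<bar>t\<bar>))"
  have Fcont: "continuous_on UNIV F" unfolding F_def
    by (intro continuous_on_compose2[OF f(1)] continuous_intros) auto
  then have [measurable]: "F \<in> borel_measurable borel" by (rule borel_measurable_continuous_onI)
  have Fpos: "0 < F t" for t using f(2) by (simp add: F_def)
  have even: "F (- t) = F t" for t by (simp add: F_def)
  have "(\<integral>\<^sup>+t\<in>{2..}. ennreal (1 / F t) \<partial>lborel) = (\<integral>\<^sup>+r\<in>{2..}. ennreal (1 / f r) \<partial>lborel)"
    by (rule nn_integral_cong) (auto simp: F_def indicator_def)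
  then have Frec: "(\<integral>\<^sup>+t\<in>{2..}. ennreal (1 / F t) \<partial>lborel) < \<infinity>" using f(4) by simp
  have rec_cont: "continuous_on UNIV (\<lambda>t. 1 / F t)"
    using Fcont Fpos by (intro continuous_intros) (auto simp: less_imp_neq[symmetric])
  have rec_nonneg: "0 \<le> 1 / F t" and rec_even: "1 / F (- t) = 1 / F t" for t
    using Fpos[of t] by (auto simp: even)
  obtain s C where s: "\<And>x. (s has_real_derivative 1 / F x) (at x)" and C: "\<And>x. \<bar>s x\<bar> \<le> C"
    by (rule bounded_antiderivative_even[OF rec_cont rec_nonneg rec_even Frec]) (rule that)
  have C0: "0 \<le> C" using C[of 0] by linarith
  \<comment> \<open>The first summand of \<open>A\<close> accounts for \<open>[-2,2]\<close>, where \<open>F\<close> is constant, the second for both tails.\<close>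
  define A where "A = 4 * f 2 / m + 2"
  have A0: "0 \<le> A" using m(1) f(2)[of 2] by (simp add: A_def)
  have Fint: "(\<integral>\<^sup>+t\<in>{-R..R}. ennreal (F t) \<partial>lborel) \<le> ennreal (A * \<Psi> R)" if R: "1 \<le> R" for R
  proof -
    have "(\<integral>\<^sup>+t\<in>{-R..R}. ennreal (F t) \<partial>lborel)
        = 2 * (\<integral>\<^sup>+t\<in>{0..}. ennreal (F t) * indicator {-R..R} t \<partial>lborel)"
      by (rule nn_integral_even) (auto simp: even indicator_def)
    also have "(\<integral>\<^sup>+t\<in>{0..}. ennreal (F t) * indicator {-R..R} t \<partial>lborel)
        \<le> (\<integral>\<^sup>+t. ennreal (f 2) * indicator {0..2} t + ennreal (f t) * indicator {2..R} t \<partial>lborel)"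
      by (rule nn_integral_mono) (auto simp: F_def indicator_def max_def)
    also have "\<dots> = ennreal (f 2) * 2 + (\<integral>\<^sup>+t\<in>{2..R}. ennreal (f t) \<partial>lborel)"
      using borel_measurable_continuous_onI[OF f(1)] by (subst nn_integral_add) (auto simp: nn_integral_cmult_indicator)
    also have "(\<integral>\<^sup>+t\<in>{2..R}. ennreal (f t) \<partial>lborel) \<le> ennreal (\<Psi> R)"
    proof (cases "R \<ge> 2")
      case True
      then show ?thesis using f(3)[OF True] h(4)[OF R] by (meson ennreal_leI order_trans)
    next
      case False then show ?thesis by simp
    qed
    finally have "(\<integral>\<^sup>+t\<in>{-R..R}. ennreal (F t) \<partial>lborel) \<le> 2 * (ennreal (f 2) * 2 + ennreal (\<Psi> R))"
      by (simp add: mult_left_mono add_left_mono)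
    also have "\<dots> = ennreal ((f 2 + f 2 + \<Psi> R) + (f 2 + f 2 + \<Psi> R))"
      unfolding mult_2 mult_2_right using f(2)[of 2] \<Psi>(2)[OF R]
      by (simp only: ennreal_plus add_nonneg_nonneg less_imp_le order_refl)
    also have "\<dots> \<le> ennreal (A * \<Psi> R)"
    proof (rule ennreal_leI)
      have "4 * f 2 = 4 * f 2 / m * m" using m by simp
      also have "\<dots> \<le> 4 * f 2 / m * \<Psi> R" using m f(2)[of 2] R by (intro mult_left_mono) auto
      finally show "(f 2 + f 2 + \<Psi> R) + (f 2 + f 2 + \<Psi> R) \<le> A * \<Psi> R" by (simp add: A_def algebra_simps)
    qed
    finally show ?thesis .
  qed
  fix i :: 'n
  define e where "e = (axis i 1 :: real^'n)"
  have e: "e \<in> Basis" "x \<bullet> e = x $ i" for x by (auto simp: e_def inner_axis)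
  define n where "n = (2::real) ^ (DIM(real^'n) - 1)"
  have n: "n > 0" by (simp add: n_def)
  have p: "0 \<le> C\<^sup>2 * A * n" using A0 n by simp
  define \<kappa> where "\<kappa> = 1 / (C\<^sup>2 * A * n + 1)"
  have \<kappa>: "\<kappa> > 0" "\<kappa> * (C\<^sup>2 * A * n) \<le> 1"
    using p by (simp_all add: \<kappa>_def)
  let ?w = "transverse_weight e"
  define \<phi> where "\<phi> = (\<lambda>x. sqrt (\<kappa> * F (x $ i) * ?w x))"
  define \<sigma> where "\<sigma> = (\<lambda>x::real^'n. s (x $ i))"
  define G where "G = (\<lambda>x::real^'n. axis i (1 / F (x $ i)))"
  have Fi: "continuous_on UNIV (\<lambda>x::real^'n. F (x $ i))"
    by (intro continuous_on_compose2[OF Fcont] continuous_intros) auto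
  have \<phi>2: "(\<phi> x)\<^sup>2 = \<kappa> * F (x $ i) * ?w x" for x
    using \<kappa>(1) Fpos[of "x $ i"] transverse_weight(2)[of e x] by (simp add: \<phi>_def)
  have \<phi>pos: "0 < \<phi> x" for x using \<kappa>(1) Fpos[of "x $ i"] transverse_weight(2)[of e x] by (simp add: \<phi>_def)
  have \<phi>cont: "continuous_on UNIV \<phi>"
    unfolding \<phi>_def by (intro continuous_intros Fi transverse_weight)
  have scont: "continuous_on UNIV s" using s by (meson DERIV_continuous_on has_field_derivative_at_within)
  have \<sigma>cont: "continuous_on UNIV \<sigma>"
    unfolding \<sigma>_def by (intro continuous_on_compose2[OF scont] continuous_intros) auto
  have Gcont': "continuous_on UNIV (\<lambda>x::real^'n. 1 / F (x $ i))"
    using Fpos by (intro continuous_intros Fi) (auto simp: less_imp_neq[symmetric])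
  have Gax: "G = (\<lambda>x. (1 / F (x $ i)) *\<^sub>R axis i 1)" by (auto simp: G_def vec_eq_iff axis_def)
  have Gcont: "continuous_on UNIV G" unfolding Gax by (intro continuous_intros Gcont')
  have "weak_gradient \<sigma> G"
    unfolding weak_gradient_def
  proof (intro conjI ballI allI)
    show "G \<in> L2_loc" using Gcont by (rule continuous_imp_L2_loc)
    fix \<eta> :: "real^'n \<Rightarrow> real" and j assume \<eta>: "\<eta> \<in> Cc_infinity"
    show "(LINT x|lebesgue. \<sigma> x * partial_deriv j \<eta> x) = - (LINT x|lebesgue. G x $ j * \<eta> x)"
    proof (rule integral_by_parts_test_function[OF \<sigma>cont _ _ \<eta>])
      show "continuous_on UNIV (\<lambda>x. G x $ j)" by (intro continuous_intros Gcont)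
      show "((\<lambda>t. \<sigma> (x + t *\<^sub>R axis j 1)) has_real_derivative G x $ j) (at 0)" for x
      proof (cases "j = i")
        case True
        have "((\<lambda>t. s (x $ i + t)) has_real_derivative 1 / F (x $ i)) (at 0)"
          using s[of "x $ i"] DERIV_shift[of s "1 / F (x $ i)" 0 "x $ i"] by (simp add: add.commute)
        then show ?thesis using True by (simp add: \<sigma>_def G_def)
      next
        case False
        then show ?thesis by (simp add: \<sigma>_def G_def axis_def)
      qed
    qed
  qed
  moreover have "div_zero \<phi> G"
    unfolding div_zero_def
  proof
    fix \<eta> :: "real^'n \<Rightarrow> real" assume \<eta>: "\<eta> \<in> Cc_infinity"
    have "(\<phi> x)\<^sup>2 * (G x \<bullet> grad \<eta> x) = (\<kappa> * ?w x) * partial_deriv i \<eta> x" for x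
      using Fpos[of "x $ i"] by (simp add: \<phi>2 G_def inner_axis' grad_def)
    moreover have "(LINT x|lebesgue. (\<kappa> * ?w x) * partial_deriv i \<eta> x) = - (LINT x|lebesgue. 0 * \<eta> x)"
    proof (rule integral_by_parts_test_function[OF _ _ _ \<eta>])
      show "continuous_on UNIV (\<lambda>x. \<kappa> * ?w x)" by (intro continuous_intros transverse_weight)
      show "((\<lambda>t. \<kappa> * ?w (x + t *\<^sub>R axis i 1)) has_real_derivative 0) (at 0)" for x
        using transverse_weight(3)[OF e(1), of x, unfolded e_def] by (simp add: e_def)
    qed simp
    ultimately show "(LINT x|lebesgue. (\<phi> x)\<^sup>2 * (G x \<bullet> grad \<eta> x)) = 0" by simp
  qed
  moreover have "(LINT x:ball 0 R|lebesgue. (\<phi> x * \<sigma> x)\<^sup>2) \<le> \<Psi> R" if R: "1 \<le> R" for R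
  proof -
    have [measurable]: "\<phi> \<in> borel_measurable borel" "\<sigma> \<in> borel_measurable borel"
      using \<phi>cont \<sigma>cont by (auto intro: borel_measurable_continuous_onI)
    have pt: "indicator (ball 0 R) x * (\<phi> x * \<sigma> x)\<^sup>2 \<le> \<kappa> * C\<^sup>2 * (indicator {-R..R} (x \<bullet> e) * F (x \<bullet> e) * ?w x)" for x
    proof (cases "x \<in> ball 0 R")
      case True
      then have "\<bar>x $ i\<bar> \<le> R" using component_le_norm_cart[of x i] by simp
      moreover have "(\<sigma> x)\<^sup>2 \<le> C\<^sup>2" using C C0 by (simp add: \<sigma>_def abs_le_square_iff[symmetric])
      then have "(\<phi> x * \<sigma> x)\<^sup>2 \<le> \<kappa> * F (x $ i) * ?w x * C\<^sup>2"
        unfolding power_mult_distrib \<phi>2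
        using \<kappa>(1) Fpos[of "x $ i"] transverse_weight(2)[of e x] by (intro mult_left_mono) auto
      ultimately show ?thesis using True by (auto simp: e(2) algebra_simps indicator_def abs_le_iff)
    next
      case False
      then show ?thesis
        using \<kappa>(1) Fpos[of "x $ i"] transverse_weight(2)[of e x] by (simp add: e(2))
    qed
    have "(\<integral>\<^sup>+x. ennreal (indicator (ball 0 R) x * (\<phi> x * \<sigma> x)\<^sup>2) \<partial>lborel)
       \<le> (\<integral>\<^sup>+x. ennreal (\<kappa> * C\<^sup>2) * ((ennreal (F (x \<bullet> e)) * indicator {-R..R} (x \<bullet> e)) * ennreal (?w x)) \<partial>lborel)"
    proof (rule nn_integral_mono)
      fix x
      have "ennreal (\<kappa> * C\<^sup>2) * ((ennreal (F (x \<bullet> e)) * indicator {-R..R} (x \<bullet> e)) * ennreal (?w x))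
        = ennreal (\<kappa> * C\<^sup>2 * (indicator {-R..R} (x \<bullet> e) * F (x \<bullet> e) * ?w x))"
        using \<kappa>(1) Fpos[of "x \<bullet> e"] transverse_weight(2)[of e x]
        by (auto simp: indicator_def ennreal_mult[symmetric])
      then show "ennreal (indicator (ball 0 R) x * (\<phi> x * \<sigma> x)\<^sup>2) \<le>
          ennreal (\<kappa> * C\<^sup>2) * ((ennreal (F (x \<bullet> e)) * indicator {-R..R} (x \<bullet> e)) * ennreal (?w x))"
        using ennreal_leI[OF pt[of x]] by simp
    qed
    also have "\<dots> = ennreal (\<kappa> * C\<^sup>2) * ((\<integral>\<^sup>+t\<in>{-R..R}. ennreal (F t) \<partial>lborel) * 2 ^ (DIM(real^'n) - 1))"
    proof (subst nn_integral_cmult)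
      have [measurable]: "?w \<in> borel_measurable borel"
        using transverse_weight(1) by (rule borel_measurable_continuous_onI)
      show "(\<lambda>x. (ennreal (F (x \<bullet> e)) * indicator {-R..R} (x \<bullet> e)) * ennreal (?w x)) \<in> borel_measurable lborel"
        by measurable
    qed (subst nn_integral_transverse_weight[OF _ e(1)], auto)
    also have "\<dots> \<le> ennreal (\<kappa> * C\<^sup>2) * (ennreal (A * \<Psi> R) * ennreal n)"
      using Fint[OF R] by (intro mult_left_mono mult_mono) (auto simp: n_def ennreal_power[symmetric])
    also have "\<dots> = ennreal (\<kappa> * (C\<^sup>2 * A * n) * \<Psi> R)"
      using \<kappa> A0 n \<Psi>(2)[OF R] by (simp add: ennreal_mult[symmetric] algebra_simps)
    also have "\<dots> \<le> ennreal (\<Psi> R)"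
      using \<kappa>(2) \<Psi>(2)[OF R] by (intro ennreal_leI) (simp add: mult_left_le_one_le)
    finally have le: "(\<integral>\<^sup>+x. ennreal (indicator (ball 0 R) x * (\<phi> x * \<sigma> x)\<^sup>2) \<partial>lborel) \<le> ennreal (\<Psi> R)" .
    have [measurable]: "ball (0::real^'n) R \<in> sets borel" by simp
    have m: "(\<lambda>x. indicator (ball 0 R) x * (\<phi> x * \<sigma> x)\<^sup>2 :: real) \<in> borel_measurable borel" by measurable
    have "(LINT x:ball 0 R|lebesgue. (\<phi> x * \<sigma> x)\<^sup>2) = (LINT x|lborel. indicator (ball 0 R) x * (\<phi> x * \<sigma> x)\<^sup>2)"
      unfolding set_lebesgue_integral_def real_scaleR_def using m by (intro integral_completion) simp
    also have "\<dots> \<le> \<Psi> R"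
      using le \<Psi>(2)[OF R] m by (subst integral_eq_nn_integral) (auto simp: enn2real_leI)
    finally show ?thesis .
  qed
  moreover have "\<phi> \<in> Linf_loc" using \<phi>cont by (rule continuous_imp_Linf_loc)
  moreover have "\<sigma> \<in> H1_loc"
    using continuous_imp_L2_loc[OF \<sigma>cont] \<open>weak_gradient \<sigma> G\<close> by (auto simp: H1_loc_def)
  ultimately obtain c where "AE x in lebesgue. \<sigma> x = c"
    using P' \<phi>pos unfolding property_P'_def by blast
  then have "\<sigma> x = c" for x by (rule continuous_AE_eq_const[OF \<sigma>cont])
  from this[of 0] this[of "axis i 1"] have "s 0 = s 1" by (simp add: \<sigma>_def)
  moreover have "s 0 < s 1" using s Fpos by (intro DERIV_pos_imp_increasing[of 0 1 s]) (auto intro!: exI)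
  ultimately show False by simp
qed

section \<open>Smooth cutoffs and mollifiers\<close>

text \<open>The one-dimensional counterpart of \<open>Ck\<close>, stated through some derivative so that no choice of \<open>deriv\<close> has to
be computed.\<close>

primrec real_Ck :: "nat \<Rightarrow> (real \<Rightarrow> real) \<Rightarrow> bool" where
  "real_Ck 0 f \<longleftrightarrow> continuous_on UNIV f"
| "real_Ck (Suc k) f \<longleftrightarrow> (\<exists>f'. (\<forall>x. (f has_real_derivative f' x) (at x)) \<and> real_Ck k f')"

lemma real_Ck_SucI: "(\<And>x. (f has_real_derivative f' x) (at x)) \<Longrightarrow> real_Ck k f' \<Longrightarrow> real_Ck (Suc k) f"
  by auto

lemma real_Ck_SucD: "real_Ck (Suc k) f \<Longrightarrow> real_Ck k f"
proof (induction k arbitrary: f)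
  case 0
  then obtain f' where "\<And>x. (f has_real_derivative f' x) (at x)" by auto
  then show ?case unfolding real_Ck.simps by (meson DERIV_continuous_on has_field_derivative_at_within)
next
  case (Suc k)
  from Suc.prems obtain f' where f': "\<And>x. (f has_real_derivative f' x) (at x)" "real_Ck (Suc k) f'"
    unfolding real_Ck.simps(2)[of "Suc k"] by blast
  show ?case using f'(1) Suc.IH[OF f'(2)] by (rule real_Ck_SucI)
qed

lemma real_Ck_const: "real_Ck k (\<lambda>x. c)"
  by (induction k arbitrary: c) (auto intro!: exI[of _ "\<lambda>x. 0"])

lemma real_Ck_add: "real_Ck k f \<Longrightarrow> real_Ck k g \<Longrightarrow> real_Ck k (\<lambda>x. f x + g x)"
proof (induction k arbitrary: f g)
  case 0 then show ?case by (auto intro!: continuous_intros)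
next
  case (Suc k)
  then obtain f' g' where *: "\<forall>x. (f has_real_derivative f' x) (at x)" "real_Ck k f'"
    "\<forall>x. (g has_real_derivative g' x) (at x)" "real_Ck k g'" by auto
  then show ?case using Suc.IH[of f' g']
    by (auto intro!: exI[of _ "\<lambda>x. f' x + g' x"] DERIV_add)
qed

lemma real_Ck_mult: "real_Ck k f \<Longrightarrow> real_Ck k g \<Longrightarrow> real_Ck k (\<lambda>x. f x * g x)"
proof (induction k arbitrary: f g)
  case 0 then show ?case by (auto intro!: continuous_intros)
next
  case (Suc k)
  obtain f' g' where *: "\<forall>x. (f has_real_derivative f' x) (at x)" "real_Ck k f'"
    "\<forall>x. (g has_real_derivative g' x) (at x)" "real_Ck k g'" using Suc.prems by auto
  have "real_Ck k (\<lambda>x. f' x * g x + g' x * f x)"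
    using * Suc.prems[THEN real_Ck_SucD] by (intro real_Ck_add Suc.IH) auto
  moreover have "((\<lambda>x. f x * g x) has_real_derivative f' x * g x + g' x * f x) (at x)" for x
    using * by (intro DERIV_mult) auto
  ultimately show ?case by (rule real_Ck_SucI[rotated])
qed

lemma real_Ck_reflect: "real_Ck k f \<Longrightarrow> real_Ck k (\<lambda>x. f (1 - x))"
proof (induction k arbitrary: f)
  case 0 then show ?case by (auto intro!: continuous_on_compose2[of UNIV f] continuous_intros)
next
  case (Suc k)
  then obtain f' where *: "\<And>x. (f has_real_derivative f' x) (at x)" "real_Ck k f'" by auto
  have "((\<lambda>x. f (1 - x)) has_real_derivative f' (1 - x) * (- 1)) (at x)" for x
    by (rule DERIV_chain2[OF *(1)]) (auto intro!: derivative_eq_intros)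
  moreover have "real_Ck k (\<lambda>x. f' (1 - x) * (- 1))" by (intro real_Ck_mult real_Ck_const Suc.IH *)
  ultimately show ?case by (rule real_Ck_SucI)
qed

text \<open>The functions \<open>p(1/x) exp(-1/x)\<close>, extended by \<open>0\<close> to \<open>x \<le> 0\<close>. With polynomials \<open>p\<close> as a parameter the
family is closed under differentiation, so smoothness of \<open>exp(-1/x)\<close> follows by a single computation.\<close>

definition flat :: "real poly \<Rightarrow> real \<Rightarrow> real" where
  "flat p x = (if x > 0 then poly p (1 / x) * exp (- (1 / x)) else 0)"

lemma poly_times_exp_tendsto_0: "((\<lambda>y. poly p y * exp (- y)) \<longlongrightarrow> (0::real)) at_top"
proof -
  have "((\<lambda>y::real. \<Sum>i\<le>degree p. coeff p i * (y ^ i / exp y)) \<longlongrightarrow> (\<Sum>i\<le>degree p. coeff p i * 0)) at_top"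
    by (intro tendsto_sum tendsto_mult_left tendsto_power_div_exp_0)
  then show ?thesis by (simp add: poly_altdef sum_distrib_right exp_minus divide_inverse mult.assoc)
qed

lemma flat_has_derivative:
  "(flat p has_real_derivative flat (pCons 0 (pCons 0 (p - pderiv p))) x) (at x)"
proof -
  consider "x > 0" | "x < 0" | "x = 0" by linarith
  then show ?thesis
  proof cases
    case 1
    have "((\<lambda>x. poly p (1 / x) * exp (- (1 / x))) has_real_derivative
        poly p (1 / x) * (exp (- (1 / x)) * (1 / x\<^sup>2)) + poly (pderiv p) (1 / x) * (- (1 / x\<^sup>2)) * exp (- (1 / x))) (at x)"
      using 1 by (auto intro!: derivative_eq_intros DERIV_chain2[OF poly_DERIV] simp: power2_eq_square divide_simps)
    moreover have "poly p (1 / x) * (exp (- (1 / x)) * (1 / x\<^sup>2)) + poly (pderiv p) (1 / x) * (- (1 / x\<^sup>2)) * exp (- (1 / x))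
      = flat (pCons 0 (pCons 0 (p - pderiv p))) x"
      using 1 by (simp add: flat_def field_simps power2_eq_square)
    ultimately have "((\<lambda>x. poly p (1 / x) * exp (- (1 / x))) has_real_derivative
        flat (pCons 0 (pCons 0 (p - pderiv p))) x) (at x)" by simp
    moreover have "\<forall>\<^sub>F y in nhds x. flat p y = poly p (1 / y) * exp (- (1 / y))"
      using eventually_nhds_in_open[of "{0<..}" x] 1 by (auto elim!: eventually_mono simp: flat_def)
    ultimately show ?thesis by (subst DERIV_cong_ev[OF refl _ refl])
  next
    case 2
    have "\<forall>\<^sub>F y in nhds x. flat p y = 0"
      using eventually_nhds_in_open[of "{..<0}" x] 2 by (auto elim!: eventually_mono simp: flat_def)
    then have "(flat p has_real_derivative 0) (at x)" by (subst DERIV_cong_ev[OF refl _ refl]) auto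
    then show ?thesis using 2 by (simp add: flat_def)
  next
    case 3
    have "((\<lambda>h. (flat p (0 + h) - flat p 0) / h) \<longlongrightarrow> 0) (at 0)"
    proof (rule filterlim_split_at)
      have "\<forall>\<^sub>F h in at_left 0. (0::real) = (flat p (0 + h) - flat p 0) / h"
        by (auto simp: eventually_at_filter flat_def)
      then show "((\<lambda>h. (flat p (0 + h) - flat p 0) / h) \<longlongrightarrow> 0) (at_left 0)"
        by (rule Lim_transform_eventually[OF tendsto_const])
      have "((\<lambda>h. poly (pCons 0 p) (inverse h) * exp (- (inverse h))) \<longlongrightarrow> 0) (at_right 0)"
        by (rule filterlim_compose[OF poly_times_exp_tendsto_0 filterlim_inverse_at_top_right])
      moreover have "\<forall>\<^sub>F h in at_right 0. poly (pCons 0 p) (inverse h) * exp (- (inverse h)) = (flat p (0 + h) - flat p 0) / h"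
        by (auto simp: eventually_at_filter flat_def field_simps)
      ultimately show "((\<lambda>h. (flat p (0 + h) - flat p 0) / h) \<longlongrightarrow> 0) (at_right 0)"
        by (rule Lim_transform_eventually)
    qed
    then show ?thesis using 3 by (simp add: DERIV_def flat_def)
  qed
qed

lemma real_Ck_flat: "real_Ck k (flat p)"
proof (induction k arbitrary: p)
  case 0
  show ?case unfolding real_Ck.simps
    by (intro continuous_at_imp_continuous_on ballI DERIV_isCont[OF flat_has_derivative])
next
  case (Suc k)
  show ?case by (rule real_Ck_SucI[OF flat_has_derivative Suc.IH])
qed

lemma flat_1: "flat 1 x = (if x > 0 then exp (- (1 / x)) else 0)" by (simp add: flat_def)

text \<open>The step descends from \<open>1\<close> to \<open>0\<close>: it is the integral from \<open>t\<close> to \<open>1\<close> of the bump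
\<open>exp(-1/t) exp(-1/(1 - t))\<close>, normalised to start at \<open>1\<close>.\<close>

lemma smooth_step:
  obtains step step' :: "real \<Rightarrow> real" and C where "\<And>k. real_Ck k step" "\<And>t. (step has_real_derivative step' t) (at t)"
    "\<And>t. t \<le> 0 \<Longrightarrow> step t = 1" "\<And>t. t \<ge> 1 \<Longrightarrow> step t = 0" "\<And>t. 0 \<le> step t"
    "\<And>t. \<bar>step' t\<bar> \<le> C" "\<And>t. t \<le> 0 \<or> t \<ge> 1 \<Longrightarrow> step' t = 0" "0 < C"
proof -
  define b where "b = (\<lambda>t. flat 1 t * flat 1 (1 - t))"
  have Db: "real_Ck k b" for k unfolding b_def by (intro real_Ck_mult real_Ck_reflect real_Ck_flat)
  have "continuous_on UNIV b" using Db[of 0] by simp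
  then obtain B where B: "\<And>x. (B has_real_derivative b x) (at x)"
    using continuous_real_antiderivative by blast
  have f01: "0 \<le> flat 1 x" "flat 1 x \<le> 1" for x by (auto simp: flat_1)
  have b01: "0 \<le> b x" "b x \<le> 1" for x unfolding b_def using f01 by (auto intro: mult_le_one)
  have b0: "b t = 0" if "t \<le> 0 \<or> t \<ge> 1" for t using that by (auto simp: b_def flat_1)
  have bpos: "b t > 0" if "0 < t" "t < 1" for t using that by (simp add: b_def flat_1)
  have Bmono: "B x \<le> B y" if "x \<le> y" for x y
    using that by (rule DERIV_nonneg_imp_nondecreasing) (use B b01 in blast)
  have Bcont: "continuous_on S B" for S
    by (intro continuous_at_imp_continuous_on ballI DERIV_isCont[OF B])
  have Bl: "B t = B 0" if "t \<le> 0" for t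
  proof (cases "t = 0")
    case False
    have "B 0 = B t"
    proof (rule DERIV_isconst_end[OF _ Bcont])
      show "t < 0" using False that by simp
      show "(B has_real_derivative 0) (at x)" if "x < 0" for x
        using B[of x] b0[of x] that by simp
    qed
    then show ?thesis by simp
  qed simp
  have Br: "B t = B 1" if "1 \<le> t" for t
  proof (cases "t = 1")
    case False
    show ?thesis
    proof (rule DERIV_isconst_end[OF _ Bcont])
      show "1 < t" using False that by simp
      show "(B has_real_derivative 0) (at x)" if "1 < x" for x
        using B[of x] b0[of x] that by simp
    qed
  qed simp
  define Z where "Z = B 1 - B 0"
  have Z: "Z > 0"
  proof -
    have "B 0 < B 1"
    proof (rule DERIV_pos_imp_increasing_open[OF _ _ Bcont])
      show "\<exists>y. (B has_real_derivative y) (at x) \<and> 0 < y" if "0 < x" "x < 1" for x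
        using B bpos[OF that] by blast
    qed simp
    then show ?thesis by (simp add: Z_def)
  qed
  define step where "step = (\<lambda>t. (B 1 - B t) * (1 / Z))"
  define step' where "step' = (\<lambda>t. b t * (- (1 / Z)))"
  have D: "(step has_real_derivative step' t) (at t)" for t
    unfolding step_def step'_def using B[of t] Z by (auto intro!: derivative_eq_intros)
  show ?thesis
  proof (rule that[of step step' "1 / Z"])
    show "real_Ck k step" for k
    proof (rule real_Ck_SucD)
      have "real_Ck k step'" unfolding step'_def by (intro real_Ck_mult real_Ck_const Db)
      then show "real_Ck (Suc k) step" using D by auto
    qed
    show "step t = 1" if "t \<le> 0" for t using Bl[OF that] Z by (simp add: step_def Z_def)
    show "step t = 0" if "t \<ge> 1" for t using Br[OF that] Z by (simp add: step_def Z_def)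
    show "0 \<le> step t" for t
      using Bmono[of t 1] Br[of t] Z by (cases "t \<le> 1") (auto simp: step_def)
    show "\<bar>step' t\<bar> \<le> 1 / Z" for t using b01[of t] Z by (simp add: step'_def abs_mult divide_right_mono)
    show "step' t = 0" if "t \<le> 0 \<or> t \<ge> 1" for t using b0[OF that] by (simp add: step'_def)
    show "(step has_real_derivative step' t) (at t)" for t by (rule D)
    show "0 < 1 / Z" using Z by simp
  qed
qed

lemma Ck_SucD: "Ck (Suc k) f \<Longrightarrow> Ck k f"
proof (induction k arbitrary: f)
  case 0
  then show ?case by (auto intro!: differentiable_imp_continuous_within simp: continuous_on_eq_continuous_within)
next
  case (Suc k)
  show ?case unfolding Ck.simps(2)[of k]
    using Suc.prems[unfolded Ck.simps(2)[of "Suc k"]] Suc.IH by blast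
qed

lemma Ck_SucI:
  assumes "\<And>x. f differentiable (at x)" "\<And>i x. partial_deriv i f x = g i x" "\<And>i. Ck k (g i)"
  shows "Ck (Suc k) f"
proof -
  have "partial_deriv i f = g i" for i using assms(2) by blast
  then show ?thesis unfolding Ck.simps using assms(1,3) by metis
qed

lemma Ck_const: "Ck k (\<lambda>x. c)"
proof (induction k arbitrary: c)
  case (Suc k)
  have "((\<lambda>x::real^'a. c) has_derivative (\<lambda>v. 0 \<bullet> v)) (at x)" for x by simp
  note * = grad_eqI[OF this]
  show ?case by (rule Ck_SucI[OF *(3) *(2) Suc.IH])
qed simp

lemma Ck_component: "Ck k (\<lambda>x. x $ j)"
proof (cases k)
  case (Suc l)
  have "((\<lambda>x::real^'a. x $ j) has_derivative (\<lambda>v. axis j 1 \<bullet> v)) (at x)" for x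
    using bounded_linear_imp_has_derivative[OF bounded_linear_vec_nth, of j "at x"]
    by (simp add: inner_axis')
  note * = grad_eqI[OF this]
  show ?thesis unfolding Suc by (rule Ck_SucI[OF *(3) *(2) Ck_const])
qed (simp add: continuous_on_component)

lemma Ck_add: "Ck k f \<Longrightarrow> Ck k g \<Longrightarrow> Ck k (\<lambda>x. f x + g x)"
proof (induction k arbitrary: f g)
  case 0 then show ?case by (auto intro!: continuous_intros)
next
  case (Suc k)
  have "((\<lambda>x. f x + g x) has_derivative (\<lambda>v. (grad f x + grad g x) \<bullet> v)) (at x)" for x
    unfolding inner_add_left using Suc.prems
    by (intro has_derivative_add differentiable_has_derivative_grad) auto
  note * = grad_eqI[OF this]
  show ?case
  proof (rule Ck_SucI[OF *(3)])
    show "partial_deriv i (\<lambda>x. f x + g x) x = partial_deriv i f x + partial_deriv i g x" for i x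
      unfolding *(2) by (simp add: grad_def)
    show "Ck k (\<lambda>x. partial_deriv i f x + partial_deriv i g x)" for i
      by (rule Suc.IH) (use Suc.prems in simp_all)
  qed
qed

lemma partial_deriv_mult:
  assumes "f differentiable (at x)" "g differentiable (at x)"
  shows "partial_deriv i (\<lambda>x. f x * g x) x = f x * partial_deriv i g x + partial_deriv i f x * g x"
    "(\<lambda>x. f x * g x) differentiable (at x)"
proof -
  have "((\<lambda>x. f x * g x) has_derivative (\<lambda>v. f x * (grad g x \<bullet> v) + (grad f x \<bullet> v) * g x)) (at x)"
    using assms by (intro has_derivative_mult differentiable_has_derivative_grad)
  moreover have "(\<lambda>v. f x * (grad g x \<bullet> v) + (grad f x \<bullet> v) * g x) = (\<lambda>v. (f x *\<^sub>R grad g x + g x *\<^sub>R grad f x) \<bullet> v)"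
    by (auto simp: inner_add_left)
  ultimately have "((\<lambda>x. f x * g x) has_derivative (\<lambda>v. (f x *\<^sub>R grad g x + g x *\<^sub>R grad f x) \<bullet> v)) (at x)"
    by simp
  from grad_eqI[OF this]
  show "partial_deriv i (\<lambda>x. f x * g x) x = f x * partial_deriv i g x + partial_deriv i f x * g x"
    "(\<lambda>x. f x * g x) differentiable (at x)" by (auto simp: grad_def)
qed

lemma Ck_mult: "Ck k f \<Longrightarrow> Ck k g \<Longrightarrow> Ck k (\<lambda>x. f x * g x)"
proof (induction k arbitrary: f g)
  case 0 then show ?case by (auto intro!: continuous_intros)
next
  case (Suc k)
  have d: "f differentiable (at x)" "g differentiable (at x)" for x using Suc.prems by simp_all
  show ?case
  proof (rule Ck_SucI[OF partial_deriv_mult(2)[OF d] partial_deriv_mult(1)[OF d]])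
    show "Ck k (\<lambda>x. f x * partial_deriv i g x + partial_deriv i f x * g x)" for i
      using Suc.prems by (intro Ck_add Suc.IH Ck_SucD[OF Suc.prems(1)] Ck_SucD[OF Suc.prems(2)]) simp_all
  qed
qed

lemma partial_deriv_compose:
  assumes "(f has_real_derivative f' (g x)) (at (g x))" "g differentiable (at x)"
  shows "partial_deriv i (\<lambda>x. f (g x)) x = f' (g x) * partial_deriv i g x"
    "(\<lambda>x. f (g x)) differentiable (at x)" "grad (\<lambda>x. f (g x)) x = f' (g x) *\<^sub>R grad g x"
proof -
  have "((\<lambda>x. f (g x)) has_derivative (\<lambda>v. f' (g x) * (grad g x \<bullet> v))) (at x)"
    using has_derivative_compose[OF differentiable_has_derivative_grad[OF assms(2)] assms(1)[unfolded has_field_derivative_def]] .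
  then have "((\<lambda>x. f (g x)) has_derivative (\<lambda>v. (f' (g x) *\<^sub>R grad g x) \<bullet> v)) (at x)" by simp
  from grad_eqI[OF this]
  show "partial_deriv i (\<lambda>x. f (g x)) x = f' (g x) * partial_deriv i g x"
    "(\<lambda>x. f (g x)) differentiable (at x)" "grad (\<lambda>x. f (g x)) x = f' (g x) *\<^sub>R grad g x" by (auto simp: grad_def)
qed

lemma Ck_compose: "real_Ck k f \<Longrightarrow> Ck k g \<Longrightarrow> Ck k (\<lambda>x. f (g x))"
proof (induction k arbitrary: f)
  case 0 then show ?case by (auto intro: continuous_on_compose2)
next
  case (Suc k)
  obtain f' where f': "\<And>x. (f has_real_derivative f' x) (at x)" "real_Ck k f'" using Suc.prems(1) by auto
  have d: "g differentiable (at x)" for x using Suc.prems(2) by simp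
  show ?case
  proof (rule Ck_SucI[OF partial_deriv_compose(2)[where f = f and f' = f' and g = g, OF f'(1) d]
        partial_deriv_compose(1)[where f = f and f' = f' and g = g, OF f'(1) d]])
    have "Ck k (partial_deriv i g)" for i using Suc.prems(2) by simp
    then show "Ck k (\<lambda>x. f' (g x) * partial_deriv i g x)" for i
      by (rule Ck_mult[OF Suc.IH[OF f'(2) Ck_SucD[OF Suc.prems(2)]]])
  qed
qed

lemma Ck_reflect: "Ck k f \<Longrightarrow> Ck k (\<lambda>y. f (c - y))"
  and partial_deriv_reflect: "f differentiable (at (c - x)) \<Longrightarrow> partial_deriv i (\<lambda>y. f (c - y)) x = - partial_deriv i f (c - x)"
proof -
  have D: "((\<lambda>y. f (c - y)) has_derivative (\<lambda>v. (- grad f (c - x)) \<bullet> v)) (at x)"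
    if "f differentiable (at (c - x))" for f :: "real^'a \<Rightarrow> real" and x
  proof -
    have "((\<lambda>y. c - y) has_derivative (\<lambda>v. - v)) (at x)" by (auto intro!: derivative_eq_intros)
    from has_derivative_compose[OF this differentiable_has_derivative_grad[OF that]]
    show ?thesis by simp
  qed
  have p: "partial_deriv i (\<lambda>y. f (c - y)) x = - partial_deriv i f (c - x)"
    if "f differentiable (at (c - x))" for f :: "real^'a \<Rightarrow> real" and x i
    using grad_eqI(2)[OF D[OF that]] by (simp add: grad_def)
  then show "f differentiable (at (c - x)) \<Longrightarrow> partial_deriv i (\<lambda>y. f (c - y)) x = - partial_deriv i f (c - x)" .
  show "Ck k f \<Longrightarrow> Ck k (\<lambda>y. f (c - y))"
  proof (induction k arbitrary: f)
    case 0 then show ?case by (auto intro!: continuous_on_compose2[of UNIV f] continuous_intros)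
  next
    case (Suc k)
    have d: "f differentiable (at (c - x))" for x using Suc.prems by simp
    show ?case
    proof (rule Ck_SucI[OF grad_eqI(3)[OF D[OF d]]])
      show "partial_deriv i (\<lambda>y. f (c - y)) x = (- 1) * partial_deriv i f (c - x)" for i x
        using p[OF d] by simp
      show "Ck k (\<lambda>x. (- 1) * partial_deriv i f (c - x))" for i
        by (rule Ck_mult[OF Ck_const Suc.IH]) (use Suc.prems in simp)
    qed
  qed
qed

lemma Ck_sum: "finite A \<Longrightarrow> (\<And>i. i \<in> A \<Longrightarrow> Ck k (f i)) \<Longrightarrow> Ck k (\<lambda>x. \<Sum>i\<in>A. f i x)"
  by (induction A rule: finite_induct) (auto intro: Ck_add Ck_const)

lemma Ck_inner_self: "Ck k (\<lambda>x. x \<bullet> x)"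
  unfolding inner_vec_def inner_real_def by (intro Ck_sum Ck_mult Ck_component) simp

definition radial_cutoff :: "real \<Rightarrow> real \<Rightarrow> real \<Rightarrow> (real^'n::finite \<Rightarrow> real) \<Rightarrow> bool" where
  "radial_cutoff C r R \<eta> \<longleftrightarrow> \<eta> \<in> Cc_infinity \<and> (\<forall>x. 0 \<le> \<eta> x) \<and> (\<forall>x. norm x \<le> r \<longrightarrow> \<eta> x = 1)
      \<and> (\<forall>x. norm x \<ge> R \<longrightarrow> \<eta> x = 0) \<and> (\<forall>x. norm x \<le> r \<or> norm x \<ge> R \<longrightarrow> grad \<eta> x = 0)
      \<and> (\<forall>x. norm (grad \<eta> x) \<le> C / (R - r))"

text \<open>A smooth step composed with \<open>(|x|\<^sup>2 - r\<^sup>2)/(R\<^sup>2 - r\<^sup>2)\<close>, which is smooth also at the origin. As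
\<open>R\<^sup>2 - r\<^sup>2 = (R - r)(R + r)\<close>, its gradient is at most \<open>2R/(R\<^sup>2 - r\<^sup>2) \<le> 2/(R - r)\<close> times a constant
that depends neither on \<open>r\<close> nor on \<open>R\<close>.\<close>

lemma radial_cutoff_exists:
  obtains C where "0 < C"
    "\<And>r R. 0 \<le> r \<Longrightarrow> r < R \<Longrightarrow> \<exists>\<eta> :: real^'n::finite \<Rightarrow> real. radial_cutoff C r R \<eta>"
proof -
  obtain step step' C where step: "\<And>k. real_Ck k step" "\<And>t. (step has_real_derivative step' t) (at t)"
    "\<And>t. t \<le> 0 \<Longrightarrow> step t = 1" "\<And>t. t \<ge> 1 \<Longrightarrow> step t = 0" "\<And>t. 0 \<le> step t"
    "\<And>t. \<bar>step' t\<bar> \<le> C" "\<And>t. t \<le> 0 \<or> t \<ge> 1 \<Longrightarrow> step' t = 0" "0 < C"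
    by (rule smooth_step) (rule that)
  show ?thesis
  proof (rule that[of "2 * C"])
    show "0 < 2 * C" using step(8) by simp
    fix r R :: real assume r: "0 \<le> r" "r < R"
    define k where "k = 1 / (R\<^sup>2 - r\<^sup>2)"
    have rR: "r\<^sup>2 < R\<^sup>2" using r by (simp add: power_strict_mono)
    then have k: "k > 0" by (simp add: k_def)
    define g where "g = (\<lambda>x::real^'n. k * (x \<bullet> x + - r\<^sup>2))"
    define \<eta> where "\<eta> = (\<lambda>x. step (g x))"
    have gk: "Ck l g" for l unfolding g_def by (intro Ck_mult Ck_add Ck_const Ck_inner_self)
    have ck: "Ck l \<eta>" for l unfolding \<eta>_def by (rule Ck_compose[OF step(1) gk])
    have g0: "g x \<le> 0" if "norm x \<le> r" for x
      using that k by (auto simp: g_def mult_le_0_iff dot_square_norm power_mono)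
    have g1: "g x \<ge> 1" if "norm x \<ge> R" for x
    proof -
      have "R\<^sup>2 - r\<^sup>2 \<le> (norm x)\<^sup>2 - r\<^sup>2" using that r power_mono[of R "norm x" 2] by simp
      then show ?thesis using rR by (simp add: g_def k_def dot_square_norm)
    qed
    have "(g has_derivative (\<lambda>v. ((2 * k) *\<^sub>R x) \<bullet> v)) (at x)" for x
      unfolding g_def by (auto intro!: derivative_eq_intros simp: inner_commute)
    note gg = grad_eqI[OF this]
    have grad: "grad \<eta> x = step' (g x) *\<^sub>R ((2 * k) *\<^sub>R x)" for x
      unfolding \<eta>_def partial_deriv_compose(3)[where f = step and f' = step' and g = g, OF step(2) gg(3)] gg(1) ..
    have out: "\<eta> x = 0" if "norm x \<ge> R" for x using step(4) g1 that by (simp add: \<eta>_def)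
    have zero: "grad \<eta> x = 0" if "norm x \<le> r \<or> norm x \<ge> R" for x
      using step(7) g0 g1 that by (auto simp: grad)
    have bound: "norm (grad \<eta> x) \<le> 2 * C / (R - r)" for x
    proof (cases "norm x \<ge> R")
      case True then show ?thesis using zero[of x] r step(8) by simp
    next
      case False
      have "norm (grad \<eta> x) = \<bar>step' (g x)\<bar> * (2 * k * norm x)"
        unfolding grad norm_scaleR using k by (simp only: abs_mult abs_numeral abs_of_pos mult.assoc)
      also have "\<dots> \<le> C * (2 * k * R)"
      proof (rule mult_mono[OF step(6)])
        show "2 * k * norm x \<le> 2 * k * R" using False k by simp
      qed (use step(8) k in simp_all)
      also have "\<dots> \<le> 2 * C / (R - r)"
      proof -
        have "k * R \<le> 1 / (R - r)"
        proof -
          have "R / ((R - r) * (R + r)) \<le> 1 / (R - r)" using r by (simp add: divide_simps)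
          moreover have "R\<^sup>2 - r\<^sup>2 = (R - r) * (R + r)" by (simp add: power2_eq_square algebra_simps)
          ultimately show ?thesis by (simp add: k_def)
        qed
        then show ?thesis using step(8) mult_left_mono[of "k * R" "1 / (R - r)" "2 * C"] by (simp add: mult.assoc mult.left_commute)
      qed
      finally show ?thesis .
    qed
    have "{x. \<eta> x \<noteq> 0} \<subseteq> ball 0 R" using out by (auto simp: not_le[symmetric])
    then have "compact (closure {x. \<eta> x \<noteq> 0})" unfolding compact_closure using bounded_ball bounded_subset by blast
    then have "\<eta> \<in> Cc_infinity" using ck by (simp add: Cc_infinity_def)
    moreover have \<eta>0: "0 \<le> \<eta> x" for x using step(5) by (simp add: \<eta>_def)
    moreover have "\<forall>x. norm x \<le> r \<longrightarrow> \<eta> x = 1" using g0 step(3) by (simp add: \<eta>_def)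
    ultimately have "radial_cutoff (2 * C) r R \<eta>"
      unfolding radial_cutoff_def using out zero bound \<eta>0 by (intro conjI) blast+
    then show "\<exists>\<eta> :: real^'n \<Rightarrow> real. radial_cutoff (2 * C) r R \<eta>" by blast
  qed
qed

lemma mollifier:
  fixes e :: real assumes e: "e > 0"
  obtains \<rho> :: "real^'n::finite \<Rightarrow> real" where "\<rho> \<in> Cc_infinity" "\<And>x. 0 \<le> \<rho> x" "\<And>x. norm x \<ge> e \<Longrightarrow> \<rho> x = 0"
    "integrable lborel \<rho>" "(LINT x|lborel. \<rho> x) = 1"
proof -
  define g where "g = (\<lambda>x::real^'n. e\<^sup>2 + (-1) * (x \<bullet> x))"
  define f where "f = (\<lambda>x. flat 1 (g x))"
  have gk: "Ck l g" for l unfolding g_def by (intro Ck_mult Ck_add Ck_const Ck_inner_self)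
  have ck: "Ck l f" for l unfolding f_def by (rule Ck_compose[OF real_Ck_flat gk])
  have f0: "0 \<le> f x" for x by (simp add: f_def flat_1)
  have out: "f x = 0" if "norm x \<ge> e" for x
  proof -
    have "e\<^sup>2 \<le> (norm x)\<^sup>2" using that e by (intro power_mono) simp_all
    then have "\<not> g x > 0" unfolding g_def power2_norm_eq_inner by simp
    then show ?thesis unfolding f_def flat_1 by (rule if_not_P)
  qed
  have cont: "continuous_on UNIV f" using ck[of 0] by simp
  have out': "f x = 0" if "x \<notin> cball 0 e" for x using that out[of x] by simp
  have int: "integrable lborel f"
    by (rule integrable_continuous_compact_support[OF cont compact_cball[of 0 e]]) (rule out')
  define Z where "Z = (LINT x|lborel. f x)"
  have "Z \<noteq> 0"
  proof
    assume "Z = 0"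
    then have "AE x in lborel. f x = 0" unfolding Z_def using int f0 by (subst (asm) integral_nonneg_eq_0_iff_AE) auto
    then have "AE x in lebesgue. f x = 0" by (rule AE_completion)
    from continuous_AE_eq_const[OF cont this, of 0] show False using e by (simp add: f_def g_def flat_1)
  qed
  moreover have "0 \<le> Z" unfolding Z_def using f0 by (simp add: integral_nonneg_AE)
  ultimately have Z: "Z > 0" by simp
  have "{x. (1 / Z) * f x \<noteq> 0} \<subseteq> ball 0 e" using out by (auto simp: not_le[symmetric])
  then have "compact (closure {x. (1 / Z) * f x \<noteq> 0})" unfolding compact_closure using bounded_ball bounded_subset by blast
  then have "(\<lambda>x. (1 / Z) * f x) \<in> Cc_infinity"
    unfolding Cc_infinity_def using Ck_mult[OF Ck_const ck] by blast
  then show ?thesis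
  proof (rule that)
    show "0 \<le> (1 / Z) * f x" for x using f0 Z by simp
    show "(1 / Z) * f x = 0" if "norm x \<ge> e" for x using out[OF that] by simp
    show "integrable lborel (\<lambda>x. (1 / Z) * f x)" using int by (rule integrable_mult_right)
    show "(LINT x|lborel. (1 / Z) * f x) = 1" using Z unfolding Z_def[symmetric] integral_mult_right_zero by simp
  qed
qed

section \<open>Convolution with test functions\<close>

definition convolution :: "(real^'n::finite \<Rightarrow> real) \<Rightarrow> (real^'n \<Rightarrow> real) \<Rightarrow> real^'n \<Rightarrow> real" where
  "convolution u \<rho> x = (LINT y|lborel. u y * \<rho> (x - y))"

lemma integrable_mult_bounded:
  fixes u f :: "'a::euclidean_space \<Rightarrow> real"
  assumes u: "integrable lborel u" and f: "f \<in> borel_measurable borel" "\<And>y. \<bar>f y\<bar> \<le> M"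
  shows "integrable lborel (\<lambda>y. u y * f y)"
proof (rule Bochner_Integration.integrable_bound)
  show "integrable lborel (\<lambda>y. M * u y)" using u by (rule integrable_mult_right)
  show "(\<lambda>y. u y * f y) \<in> borel_measurable lborel"
    using borel_measurable_integrable[OF u] f(1) by simp
  have "\<bar>u y * f y\<bar> \<le> \<bar>M * u y\<bar>" for y
  proof -
    have "\<bar>u y\<bar> * \<bar>f y\<bar> \<le> \<bar>u y\<bar> * \<bar>M\<bar>" using f(2)[of y] by (intro mult_left_mono) linarith+
    then show ?thesis by (simp only: abs_mult mult.commute)
  qed
  then show "AE y in lborel. norm (u y * f y) \<le> norm (M * u y)" by simp
qed

lemma continuous_shift_measurable:
  fixes \<rho> :: "'a::euclidean_space \<Rightarrow> real"
  assumes "continuous_on UNIV \<rho>"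
  shows "(\<lambda>y. \<rho> (x - y)) \<in> borel_measurable borel"
  by (intro borel_measurable_continuous_onI continuous_on_compose2[OF assms] continuous_intros) simp

lemma conv_continuous:
  assumes u: "integrable lborel u" and \<rho>: "continuous_on UNIV \<rho>" "\<And>y. \<bar>\<rho> y\<bar> \<le> M"
  shows "continuous_on UNIV (convolution u \<rho>)"
proof (intro continuous_at_imp_continuous_on ballI)
  fix x
  show "isCont (convolution u \<rho>) x"
    unfolding continuous_at_sequentially o_def convolution_def
  proof (intro allI impI)
    fix X assume X: "X \<longlonglongrightarrow> x"
    show "(\<lambda>n. LINT y|lborel. u y * \<rho> (X n - y)) \<longlonglongrightarrow> (LINT y|lborel. u y * \<rho> (x - y))"
    proof (rule integral_dominated_convergence[where w = "\<lambda>y. \<bar>u y\<bar> * M"])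
      show "integrable lborel (\<lambda>y. \<bar>u y\<bar> * M)" using u by (intro integrable_mult_left integrable_abs)
      have "(\<lambda>n. u y * \<rho> (X n - y)) \<longlonglongrightarrow> u y * \<rho> (x - y)" for y
        using \<rho>(1) X by (intro tendsto_intros isCont_tendsto_compose[of "x - y" \<rho>])
          (simp_all add: continuous_on_eq_continuous_at)
      then show "AE y in lborel. (\<lambda>n. u y * \<rho> (X n - y)) \<longlonglongrightarrow> u y * \<rho> (x - y)" by simp
      have "\<bar>u y * \<rho> (X n - y)\<bar> \<le> \<bar>u y\<bar> * M" for y n
        unfolding abs_mult using \<rho>(2) by (intro mult_left_mono) simp_all
      then show "\<And>n. AE y in lborel. norm (u y * \<rho> (X n - y)) \<le> \<bar>u y\<bar> * M" by simp
      show "(\<lambda>y. u y * \<rho> (x - y)) \<in> borel_measurable lborel" "\<And>n. (\<lambda>y. u y * \<rho> (X n - y)) \<in> borel_measurable lborel"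
        using borel_measurable_integrable[OF u] continuous_shift_measurable[OF \<rho>(1)] by simp_all
    qed
  qed
qed

lemma Cc_infinity_bounded:
  assumes "\<eta> \<in> Cc_infinity"
  obtains M where "0 \<le> M" "\<And>x. \<bar>\<eta> x\<bar> \<le> M"
proof -
  have "compact (closure {x. \<eta> x \<noteq> 0})" using assms by (simp add: Cc_infinity_def)
  moreover have "\<eta> x = 0" if "x \<notin> closure {x. \<eta> x \<noteq> 0}" for x
    using that closure_subset[of "{x. \<eta> x \<noteq> 0}"] by blast
  ultimately show ?thesis
    using bounded_continuous_compact_support[OF Cc_infinity_continuous[OF assms]] that by blast
qed

lemma Cc_infinity_grad_bounded:
  assumes "\<eta> \<in> Cc_infinity"
  obtains L where "0 \<le> L" "\<And>x. norm (grad \<eta> x) \<le> L" "\<And>x h. \<bar>\<eta> (x + h) - \<eta> x\<bar> \<le> L * norm h"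
proof -
  have "\<forall>i. \<exists>M. 0 \<le> M \<and> (\<forall>x. \<bar>partial_deriv i \<eta> x\<bar> \<le> M)"
    using Cc_infinity_bounded[OF Cc_infinity_partial_deriv(4)[OF assms]] by metis
  then obtain M where M: "\<And>i. 0 \<le> M i" "\<And>i x. \<bar>partial_deriv i \<eta> x\<bar> \<le> M i" by metis
  define L where "L = (\<Sum>i\<in>UNIV. M i)"
  have L: "norm (grad \<eta> x) \<le> L" for x
  proof -
    have "norm (grad \<eta> x) \<le> (\<Sum>i\<in>UNIV. \<bar>grad \<eta> x $ i\<bar>)" by (rule norm_le_l1_cart)
    also have "\<dots> \<le> L" unfolding L_def using M(2) by (intro sum_mono) (simp add: grad_def)
    finally show ?thesis .
  qed
  have "\<bar>\<eta> (x + h) - \<eta> x\<bar> \<le> L * norm h" for x h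
  proof -
    have "norm (\<eta> (x + h) - \<eta> x) \<le> L * norm ((x + h) - x)"
    proof (rule differentiable_bound[where S = UNIV and f' = "\<lambda>x v. grad \<eta> x \<bullet> v"])
      show "(\<eta> has_derivative (\<lambda>v. grad \<eta> x \<bullet> v)) (at x within UNIV)" for x
        using Cc_infinity_has_derivative[OF assms] by simp
      show "onorm (\<lambda>v. grad \<eta> x \<bullet> v) \<le> L" for x
      proof (rule onorm_le)
        fix v
        have "norm (grad \<eta> x \<bullet> v) \<le> norm (grad \<eta> x) * norm v" by (rule Cauchy_Schwarz_ineq2[folded real_norm_def])
        also have "\<dots> \<le> L * norm v" using L by (intro mult_right_mono) simp_all
        finally show "norm (grad \<eta> x \<bullet> v) \<le> L * norm v" .
      qed
    qed simp_all
    then show ?thesis by simp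
  qed
  moreover have "0 \<le> L" unfolding L_def using M(1) by (intro sum_nonneg)
  ultimately show ?thesis using that L by blast
qed

text \<open>Differentiation under the integral sign. The Lipschitz bound of the test function dominates the difference
quotients, uniformly in the direction of the increment.\<close>

lemma conv_has_derivative:
  assumes u: "integrable lborel u" and \<rho>: "\<rho> \<in> Cc_infinity"
  shows "(convolution u \<rho> has_derivative (\<lambda>v. (\<chi> i. convolution u (partial_deriv i \<rho>) x) \<bullet> v)) (at x)"
proof -
  obtain M where M: "0 \<le> M" "\<And>x. \<bar>\<rho> x\<bar> \<le> M" using Cc_infinity_bounded[OF \<rho>] by blast
  obtain L where L: "0 \<le> L" "\<And>x. norm (grad \<rho> x) \<le> L" "\<And>x h. \<bar>\<rho> (x + h) - \<rho> x\<bar> \<le> L * norm h"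
    using Cc_infinity_grad_bounded[OF \<rho>] by blast
  have \<rho>m: "(\<lambda>y. \<rho> (z - y)) \<in> borel_measurable borel" for z
    by (rule continuous_shift_measurable[OF Cc_infinity_continuous[OF \<rho>]])
  have pm: "(\<lambda>y. partial_deriv i \<rho> (z - y)) \<in> borel_measurable borel" for z i
    by (rule continuous_shift_measurable[OF Cc_infinity_partial_deriv(1)[OF \<rho>]])
  have int: "integrable lborel (\<lambda>y. u y * \<rho> (z - y))" for z
    by (rule integrable_mult_bounded[OF u \<rho>m M(2)])
  have pint: "integrable lborel (\<lambda>y. u y * partial_deriv i \<rho> (x - y))" for i
  proof -
    obtain M' where "\<And>x. \<bar>partial_deriv i \<rho> x\<bar> \<le> M'"
      using Cc_infinity_bounded[OF Cc_infinity_partial_deriv(4)[OF \<rho>]] by blast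
    then show ?thesis by (rule integrable_mult_bounded[OF u pm])
  qed
  have gsum: "u y * (grad \<rho> (x - y) \<bullet> v) = (\<Sum>i\<in>UNIV. v $ i * (u y * partial_deriv i \<rho> (x - y)))" for y v
    by (simp add: inner_vec_def grad_def sum_distrib_left mult_ac)
  have gint: "integrable lborel (\<lambda>y. u y * (grad \<rho> (x - y) \<bullet> v))" for v
    unfolding gsum using pint by (intro Bochner_Integration.integrable_sum integrable_mult_right)
  have W: "(\<chi> i. convolution u (partial_deriv i \<rho>) x) \<bullet> v = (LINT y|lborel. u y * (grad \<rho> (x - y) \<bullet> v))" for v
  proof -
    have "(LINT y|lborel. u y * (grad \<rho> (x - y) \<bullet> v)) = (\<Sum>i\<in>UNIV. LINT y|lborel. v $ i * (u y * partial_deriv i \<rho> (x - y)))"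
      unfolding gsum using pint by (intro Bochner_Integration.integral_sum integrable_mult_right)
    then show ?thesis by (simp add: inner_vec_def convolution_def mult.commute)
  qed
  define q where "q = (\<lambda>h y. (\<rho> (x + h - y) - \<rho> (x - y) - grad \<rho> (x - y) \<bullet> h) / norm h)"
  have eq: "(convolution u \<rho> (x + h) - convolution u \<rho> x - (\<chi> i. convolution u (partial_deriv i \<rho>) x) \<bullet> h) / norm h
      = (LINT y|lborel. u y * q h y)" for h
  proof -
    have "(LINT y|lborel. u y * q h y) = (LINT y|lborel. (u y * \<rho> (x + h - y) - u y * \<rho> (x - y) - u y * (grad \<rho> (x - y) \<bullet> h)) / norm h)"
      unfolding q_def by (simp add: algebra_simps)
    also have "\<dots> = (LINT y|lborel. u y * \<rho> (x + h - y) - u y * \<rho> (x - y) - u y * (grad \<rho> (x - y) \<bullet> h)) / norm h"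
      by (rule integral_divide_zero)
    also have "(LINT y|lborel. u y * \<rho> (x + h - y) - u y * \<rho> (x - y) - u y * (grad \<rho> (x - y) \<bullet> h))
      = convolution u \<rho> (x + h) - convolution u \<rho> x - (\<chi> i. convolution u (partial_deriv i \<rho>) x) \<bullet> h"
      unfolding W unfolding convolution_def
      by (simp only: Bochner_Integration.integral_diff[OF Bochner_Integration.integrable_diff[OF int int] gint]
          Bochner_Integration.integral_diff[OF int int])
    finally show ?thesis by simp
  qed
  have qm: "(\<lambda>y. q h y) \<in> borel_measurable borel" for h
  proof -
    have "(\<lambda>y. grad \<rho> (x - y) \<bullet> h) \<in> borel_measurable borel"
      unfolding inner_vec_def grad_def inner_real_def using pm by simp
    then show ?thesis unfolding q_def using \<rho>m by simp
  qed
  have qb: "\<bar>q h y\<bar> \<le> 2 * L" for h y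
  proof (cases "h = 0")
    case False
    have "\<bar>\<rho> (x + h - y) - \<rho> (x - y) - grad \<rho> (x - y) \<bullet> h\<bar> \<le> \<bar>\<rho> ((x - y) + h) - \<rho> (x - y)\<bar> + \<bar>grad \<rho> (x - y) \<bullet> h\<bar>"
      by (simp add: algebra_simps)
    also have "\<dots> \<le> L * norm h + norm (grad \<rho> (x - y)) * norm h"
      by (intro add_mono L(3) Cauchy_Schwarz_ineq2)
    also have "\<dots> \<le> L * norm h + L * norm h" using L(2) by (intro add_mono mult_right_mono) simp_all
    finally show ?thesis using False unfolding q_def by (simp add: abs_divide divide_le_eq)
  qed (simp add: q_def L(1))
  show ?thesis
    unfolding has_derivative_at
  proof
    show "bounded_linear (\<lambda>v. (\<chi> i. convolution u (partial_deriv i \<rho>) x) \<bullet> v)" by (rule bounded_linear_inner_right)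
    show "(\<lambda>h. norm (convolution u \<rho> (x + h) - convolution u \<rho> x - (\<chi> i. convolution u (partial_deriv i \<rho>) x) \<bullet> h) / norm h) \<midarrow>0\<rightarrow> 0"
      unfolding tendsto_at_iff_sequentially o_def
    proof (intro allI impI)
      fix X :: "nat \<Rightarrow> real^'a" assume X: "\<forall>i. X i \<in> UNIV - {0}" "X \<longlonglongrightarrow> 0"
      have "(\<lambda>n. LINT y|lborel. u y * q (X n) y) \<longlonglongrightarrow> (LINT y|lborel. 0 * u y)"
      proof (rule integral_dominated_convergence[where w = "\<lambda>y. \<bar>u y\<bar> * (2 * L)"])
        show "integrable lborel (\<lambda>y. \<bar>u y\<bar> * (2 * L))" using u by (intro integrable_mult_left integrable_abs)
        have "(\<lambda>n. u y * q (X n) y) \<longlonglongrightarrow> u y * 0" for y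
        proof (intro tendsto_intros)
          have "(\<lambda>h. norm (\<rho> ((x - y) + h) - \<rho> (x - y) - grad \<rho> (x - y) \<bullet> h) / norm h) \<midarrow>0\<rightarrow> 0"
            using Cc_infinity_has_derivative[OF \<rho>, of "x - y"] unfolding has_derivative_at by blast
          then have "(\<lambda>n. norm (\<rho> ((x - y) + X n) - \<rho> (x - y) - grad \<rho> (x - y) \<bullet> X n) / norm (X n)) \<longlonglongrightarrow> 0"
            using X unfolding tendsto_at_iff_sequentially o_def by blast
          then have "(\<lambda>n. \<bar>q (X n) y\<bar>) \<longlonglongrightarrow> 0" unfolding q_def by (simp add: algebra_simps)
          then show "(\<lambda>n. q (X n) y) \<longlonglongrightarrow> 0" by (rule tendsto_rabs_zero_cancel)
        qed
        then show "AE y in lborel. (\<lambda>n. u y * q (X n) y) \<longlonglongrightarrow> 0 * u y" by simp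
        have "\<bar>u y * q (X n) y\<bar> \<le> \<bar>u y\<bar> * (2 * L)" for y n
          unfolding abs_mult using qb by (intro mult_left_mono) simp_all
        then show "\<And>n. AE y in lborel. norm (u y * q (X n) y) \<le> \<bar>u y\<bar> * (2 * L)" by simp
        show "(\<lambda>y. 0 * u y) \<in> borel_measurable lborel" by simp
        show "\<And>n. (\<lambda>y. u y * q (X n) y) \<in> borel_measurable lborel"
          using borel_measurable_integrable[OF u] qm by simp
      qed
      then have "(\<lambda>n. \<bar>LINT y|lborel. u y * q (X n) y\<bar>) \<longlonglongrightarrow> 0" by (intro tendsto_rabs_zero) simp
      then show "(\<lambda>n. norm (convolution u \<rho> (x + X n) - convolution u \<rho> x - (\<chi> i. convolution u (partial_deriv i \<rho>) x) \<bullet> X n) / norm (X n)) \<longlonglongrightarrow> 0"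
        unfolding eq[symmetric] by simp
    qed
  qed
qed

lemma conv_Cc_infinity:
  assumes u: "integrable lborel u" and K: "compact K" "\<And>x. x \<notin> K \<Longrightarrow> u x = 0" and \<rho>: "\<rho> \<in> Cc_infinity"
  shows "convolution u \<rho> \<in> Cc_infinity" and "partial_deriv i (convolution u \<rho>) x = convolution u (partial_deriv i \<rho>) x"
proof -
  have p: "partial_deriv i (convolution u \<rho>) x = convolution u (partial_deriv i \<rho>) x" if "\<rho> \<in> Cc_infinity" for i x \<rho>
    using grad_eqI(2)[OF conv_has_derivative[OF u that]] by simp
  then show "partial_deriv i (convolution u \<rho>) x = convolution u (partial_deriv i \<rho>) x" using \<rho> .
  have "Ck k (convolution u \<rho>)" if "\<rho> \<in> Cc_infinity" for k \<rho>
    using that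
  proof (induction k arbitrary: \<rho>)
    case 0
    obtain M where M: "0 \<le> M" "\<And>x. \<bar>\<rho> x\<bar> \<le> M" using Cc_infinity_bounded[OF 0] by blast
    show ?case unfolding Ck.simps by (rule conv_continuous[OF u Cc_infinity_continuous[OF 0] M(2)])
  next
    case (Suc k)
    show ?case
      by (rule Ck_SucI[OF grad_eqI(3)[OF conv_has_derivative[OF u Suc.prems]] p[OF Suc.prems]])
         (rule Suc.IH[OF Cc_infinity_partial_deriv(4)[OF Suc.prems]])
  qed
  note ck = this[OF \<rho>]
  define S where "S = closure {x. \<rho> x \<noteq> 0}"
  have S: "compact S" using \<rho> by (simp add: S_def Cc_infinity_def)
  have "{x. convolution u \<rho> x \<noteq> 0} \<subseteq> {a + b |a b. a \<in> K \<and> b \<in> S}"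
  proof
    fix x assume x: "x \<in> {x. convolution u \<rho> x \<noteq> 0}"
    show "x \<in> {a + b |a b. a \<in> K \<and> b \<in> S}"
    proof (rule ccontr)
      assume no: "x \<notin> {a + b |a b. a \<in> K \<and> b \<in> S}"
      have z: "u y * \<rho> (x - y) = 0" for y
      proof (cases "y \<in> K")
        case True
        have "x - y \<notin> S"
        proof
          assume "x - y \<in> S"
          with True have "\<exists>a b. x = a + b \<and> a \<in> K \<and> b \<in> S"
            by (intro exI[of _ y] exI[of _ "x - y"]) simp
          with no show False by blast
        qed
        then have "\<rho> (x - y) = 0" using closure_subset[of "{x. \<rho> x \<noteq> 0}"] unfolding S_def by blast
        then show ?thesis by simp
      next
        case False then show ?thesis using K(2) by simp
      qed
      have "convolution u \<rho> x = 0" unfolding convolution_def by (simp only: z Bochner_Integration.integral_zero)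
      with x show False by simp
    qed
  qed
  then have "bounded {x. convolution u \<rho> x \<noteq> 0}"
    using compact_imp_bounded[OF compact_sums[OF K(1) S]] bounded_subset by blast
  then show "convolution u \<rho> \<in> Cc_infinity" using ck unfolding Cc_infinity_def compact_closure by blast
qed

section \<open>Weak convergence of mollifications\<close>

lemma square_diff_le:
  fixes a b c :: real
  shows "(a - b)\<^sup>2 \<le> 2 * (a - c)\<^sup>2 + 2 * (c - b)\<^sup>2"
proof -
  have "0 \<le> ((a - c) - (c - b))\<^sup>2" by simp
  then show ?thesis by (simp add: power2_eq_square algebra_simps)
qed

text \<open>A Lebesgue measurable function is an almost everywhere limit of continuous functions. For bounded
\<open>U\<close> with bounded support these may be truncated in value and in space, and then dominated convergence
turns this into convergence in \<open>L\<^sup>2\<close>.\<close>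

lemma L2_approx_continuous_bounded:
  fixes U :: "'a::euclidean_space \<Rightarrow> real"
  assumes [measurable]: "U \<in> borel_measurable borel" and bound: "\<And>x. \<bar>U x\<bar> \<le> M"
    and supp: "\<And>x. norm x > M \<Longrightarrow> U x = 0" and \<epsilon>: "\<epsilon> > 0"
  obtains g where "continuous_on UNIV g" "\<And>x. norm x > M + 1 \<Longrightarrow> g x = 0"
    "integrable lborel (\<lambda>x. (U x - g x)\<^sup>2)" "(LINT x|lborel. (U x - g x)\<^sup>2) < \<epsilon>"
proof -
  have M0: "0 \<le> M" using bound[of 0] by linarith
  have "U \<in> borel_measurable lebesgue" by (simp add: measurable_completion)
  then have "U measurable_on UNIV" by (rule lebesgue_measurable_imp_measurable_on) simp
  then obtain N g where N: "negligible N" and gc: "\<And>n. continuous_on UNIV (g n)"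
    and lim: "\<And>x. x \<notin> N \<Longrightarrow> (\<lambda>n. g n x) \<longlonglongrightarrow> U x"
    unfolding measurable_on_def by auto
  define k where "k = (\<lambda>x::'a. max 0 (min 1 (M + 1 - norm x)))"
  define f where "f = (\<lambda>n x. max (- M) (min M (g n x)) * k x)"
  have kc: "continuous_on UNIV k" unfolding k_def by (intro continuous_intros)
  have fc: "continuous_on UNIV (f n)" for n unfolding f_def by (intro continuous_intros gc kc)
  then have [measurable]: "f n \<in> borel_measurable borel" for n by (rule borel_measurable_continuous_onI)
  have f0: "f n x = 0" if "norm x > M + 1" for n x using that by (simp add: f_def k_def)
  have k01: "0 \<le> k x" "k x \<le> 1" for x by (simp_all add: k_def)
  have fb: "\<bar>f n x\<bar> \<le> M" for n x
  proof -
    have "\<bar>f n x\<bar> = \<bar>max (- M) (min M (g n x))\<bar> * k x" using k01[of x] by (simp add: f_def abs_mult)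
    also have "\<dots> \<le> M * 1" using k01[of x] M0 by (intro mult_mono) (simp_all add: abs_le_iff)
    finally show ?thesis by simp
  qed
  have flim: "(\<lambda>n. f n x) \<longlonglongrightarrow> U x" if "x \<notin> N" for x
  proof -
    have "(\<lambda>n. f n x) \<longlonglongrightarrow> max (- M) (min M (U x)) * k x"
      unfolding f_def by (intro tendsto_intros lim that)
    moreover have "max (- M) (min M (U x)) = U x" using bound[of x] by (simp add: abs_le_iff)
    moreover have "U x * k x = U x" using supp[of x] by (cases "norm x > M") (simp_all add: k_def)
    ultimately show ?thesis by simp
  qed
  define w where "w = (\<lambda>x::'a. (2 * M)\<^sup>2 * indicator (cball 0 (M + 1)) x)"
  have wint: "integrable lborel w"
    unfolding w_def using emeasure_compact_finite[OF compact_cball, of "0::'a" "M + 1"]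
    by (intro integrable_mult_right integrable_real_indicator) (simp_all add: borel_compact)
  have wb: "(U x - f n x)\<^sup>2 \<le> w x" for n x
  proof (cases "norm x > M + 1")
    case True
    then show ?thesis using supp[of x] f0[of x n] by (simp add: w_def)
  next
    case False
    have "\<bar>U x - f n x\<bar> \<le> \<bar>2 * M\<bar>" using bound[of x] fb[of n x] by linarith
    then show ?thesis using False unfolding w_def abs_le_square_iff by simp
  qed
  have AEN: "AE x in lborel. x \<notin> N"
    using AE_not_in[OF N[unfolded negligible_iff_null_sets]] by (simp only: AE_completion_iff)
  have "(\<lambda>n. LINT x|lborel. (U x - f n x)\<^sup>2) \<longlonglongrightarrow> (LINT x|(lborel::'a measure). 0)"
  proof (rule integral_dominated_convergence[OF _ _ wint])
    show "AE x in lborel. (\<lambda>n. (U x - f n x)\<^sup>2) \<longlonglongrightarrow> 0"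
      using AEN
    proof eventually_elim
      case (elim x)
      have "(\<lambda>n. (U x - f n x)\<^sup>2) \<longlonglongrightarrow> (U x - U x)\<^sup>2" by (intro tendsto_intros flim elim)
      then show ?case by simp
    qed
    show "\<And>n. AE x in lborel. norm ((U x - f n x)\<^sup>2) \<le> w x" using wb by simp
  qed simp_all
  then have "\<forall>\<^sub>F n in sequentially. (LINT x|lborel. (U x - f n x)\<^sup>2) < \<epsilon>"
    by (rule order_tendstoD(2)) (simp add: \<epsilon>)
  then obtain n where n: "(LINT x|lborel. (U x - f n x)\<^sup>2) < \<epsilon>"
    unfolding eventually_sequentially by blast
  have "integrable lborel (\<lambda>x. (U x - f n x)\<^sup>2)"
    by (rule Bochner_Integration.integrable_bound[OF wint]) (simp, use wb in \<open>simp add: w_def\<close>)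
  with fc f0 n show ?thesis using that by blast
qed

text \<open>Truncation reduces the density of the continuous functions in \<open>L\<^sup>2\<close> to the bounded case.\<close>

lemma L2_approx_continuous:
  fixes U :: "'a::euclidean_space \<Rightarrow> real"
  assumes [measurable]: "U \<in> borel_measurable borel" and int: "integrable lborel (\<lambda>x. (U x)\<^sup>2)" and \<epsilon>: "\<epsilon> > 0"
  obtains g B where "continuous_on UNIV g" "\<And>x. norm x > B \<Longrightarrow> g x = 0"
    "integrable lborel (\<lambda>x. (U x - g x)\<^sup>2)" "(LINT x|lborel. (U x - g x)\<^sup>2) < \<epsilon>"
proof -
  define T where "T = (\<lambda>n x. max (- real n) (min (real n) (U x)) * indicator (cball 0 (real n)) x)"
  have [measurable]: "cball (0::'a) (real n) \<in> sets borel" for n by simp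
  have [measurable]: "T n \<in> borel_measurable borel" for n unfolding T_def by measurable
  have Tle: "\<bar>U x - T n x\<bar> \<le> \<bar>U x\<bar>" for n x
    unfolding T_def by (cases "x \<in> cball 0 (real n)") (simp_all add: max_def min_def abs_if)
  have Tsq: "(U x - T n x)\<^sup>2 \<le> (U x)\<^sup>2" for n x
    using Tle[of x n] by (simp only: abs_le_square_iff)
  have lim: "(\<lambda>n. (U x - T n x)\<^sup>2) \<longlonglongrightarrow> 0" for x
  proof (rule tendsto_eventually)
    obtain m where m: "max \<bar>U x\<bar> (norm x) \<le> real m" using real_arch_simple by blast
    have "(U x - T n x)\<^sup>2 = 0" if "n \<ge> m" for n
    proof -
      have "\<bar>U x\<bar> \<le> real n" "norm x \<le> real n" using m that by linarith+
      then show ?thesis by (simp add: T_def abs_le_iff)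
    qed
    then show "\<forall>\<^sub>F n in sequentially. (U x - T n x)\<^sup>2 = 0" unfolding eventually_sequentially by blast
  qed
  have "(\<lambda>n. LINT x|lborel. (U x - T n x)\<^sup>2) \<longlonglongrightarrow> (LINT x|(lborel::'a measure). 0)"
    by (rule integral_dominated_convergence[OF _ _ int]) (use lim Tsq in simp_all)
  then have "\<forall>\<^sub>F n in sequentially. (LINT x|lborel. (U x - T n x)\<^sup>2) < \<epsilon> / 4"
    by (rule order_tendstoD(2)) (simp add: \<epsilon>)
  then obtain n where n: "(LINT x|lborel. (U x - T n x)\<^sup>2) < \<epsilon> / 4"
    unfolding eventually_sequentially by blast
  have intT: "integrable lborel (\<lambda>x. (U x - T n x)\<^sup>2)"
    by (rule Bochner_Integration.integrable_bound[OF int]) (simp, use Tsq in simp)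
  have Tb: "\<bar>T n x\<bar> \<le> real n" for x unfolding T_def indicator_def by (simp add: abs_le_iff minus_max_eq_min)
  have T0: "T n x = 0" if "norm x > real n" for x using that by (simp add: T_def)
  obtain g where g: "continuous_on UNIV g" "\<And>x. norm x > real n + 1 \<Longrightarrow> g x = 0"
    "integrable lborel (\<lambda>x. (T n x - g x)\<^sup>2)" "(LINT x|lborel. (T n x - g x)\<^sup>2) < \<epsilon> / 4"
  proof (rule L2_approx_continuous_bounded[of "T n" "real n" "\<epsilon> / 4"])
    show "0 < \<epsilon> / 4" using \<epsilon> by simp
  qed (use Tb T0 in \<open>simp_all\<close>)
  have [measurable]: "g \<in> borel_measurable borel" using g(1) by (rule borel_measurable_continuous_onI)
  have intS: "integrable lborel (\<lambda>x. 2 * (U x - T n x)\<^sup>2 + 2 * (T n x - g x)\<^sup>2)"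
    using intT g(3) by simp
  have intg: "integrable lborel (\<lambda>x. (U x - g x)\<^sup>2)"
    by (rule Bochner_Integration.integrable_bound[OF intS]) (simp, use square_diff_le[of "U _" "g _" "T n _"] in simp)
  have "(LINT x|lborel. (U x - g x)\<^sup>2) \<le> (LINT x|lborel. 2 * (U x - T n x)\<^sup>2 + 2 * (T n x - g x)\<^sup>2)"
    by (rule integral_mono[OF intg intS]) (rule square_diff_le)
  also have "\<dots> = 2 * (LINT x|lborel. (U x - T n x)\<^sup>2) + 2 * (LINT x|lborel. (T n x - g x)\<^sup>2)"
    using intT g(3) by simp
  also have "\<dots> < \<epsilon>" using n g(4) by simp
  finally have "(LINT x|lborel. (U x - g x)\<^sup>2) < \<epsilon>" .
  with g(1,2) intg show ?thesis using that by blast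
qed

text \<open>Translations are isometries of \<open>L\<^sup>2\<close>, so it suffices to move a continuous approximation, which is
uniformly continuous and supported in a fixed ball.\<close>

lemma L2_translation_continuous:
  fixes U :: "'a::euclidean_space \<Rightarrow> real"
  assumes [measurable]: "U \<in> borel_measurable borel" and int: "integrable lborel (\<lambda>x. (U x)\<^sup>2)" and \<epsilon>: "\<epsilon> > 0"
  obtains \<delta> where "\<delta> > 0" "\<And>y. norm y < \<delta> \<Longrightarrow> (\<integral>\<^sup>+x. ennreal ((U (x - y) - U x)\<^sup>2) \<partial>lborel) \<le> ennreal \<epsilon>"
proof -
  obtain g B where g: "continuous_on UNIV g" "\<And>x. norm x > B \<Longrightarrow> g x = 0"
    "integrable lborel (\<lambda>x. (U x - g x)\<^sup>2)" "(LINT x|lborel. (U x - g x)\<^sup>2) < \<epsilon> / 12"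
    using L2_approx_continuous[OF assms(1) int, of "\<epsilon> / 12"] \<epsilon> by auto
  have [measurable]: "g \<in> borel_measurable borel" using g(1) by (rule borel_measurable_continuous_onI)
  define C where "C = cball (0::'a) (B + 1)"
  have C: "emeasure lborel C < \<infinity>" "C \<in> sets lborel"
    unfolding C_def by (rule emeasure_compact_finite, simp, simp)
  define m where "m = measure lborel C"
  have mC: "emeasure lborel C = ennreal m" unfolding m_def using C by (simp add: emeasure_eq_ennreal_measure)
  have m0: "0 \<le> m" by (simp add: m_def)
  define c where "c = sqrt (\<epsilon> / (12 * (m + 1)))"
  have c: "c > 0" "c\<^sup>2 * m \<le> \<epsilon> / 12"
  proof -
    show "c > 0" using \<epsilon> m0 by (simp add: c_def)
    have "c\<^sup>2 * m = \<epsilon> / 12 * (m / (m + 1))" using \<epsilon> m0 by (simp add: c_def field_simps)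
    also have "\<dots> \<le> \<epsilon> / 12 * 1" using \<epsilon> m0 by (intro mult_left_mono) simp_all
    finally show "c\<^sup>2 * m \<le> \<epsilon> / 12" by simp
  qed
  have "uniformly_continuous_on (cball 0 (B + 2)) g"
    using g(1) by (intro compact_uniformly_continuous) (auto intro: continuous_on_subset)
  then obtain d where d: "d > 0" "\<And>x x'. x \<in> cball 0 (B + 2) \<Longrightarrow> x' \<in> cball 0 (B + 2) \<Longrightarrow> dist x' x < d \<Longrightarrow> dist (g x') (g x) < c"
    unfolding uniformly_continuous_on_def using c(1) by metis
  define \<delta> where "\<delta> = min d 1"
  show ?thesis
  proof (rule that[of \<delta>])
    show "\<delta> > 0" using d(1) by (simp add: \<delta>_def)
    fix y :: 'a assume y: "norm y < \<delta>"
    have gd: "(g (x - y) - g x)\<^sup>2 \<le> c\<^sup>2 * indicator C x" for x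
    proof (cases "x \<in> C")
      case True
      have "norm (x - y) \<le> norm x + norm y" by (rule norm_triangle_ineq4)
      then have "x - y \<in> cball 0 (B + 2)" "x \<in> cball 0 (B + 2)" "dist (x - y) x < d"
        using True y norm_minus_commute[of x y] by (simp_all add: C_def \<delta>_def dist_norm)
      then have "\<bar>g (x - y) - g x\<bar> < c" using d(2)[of x "x - y"] by (simp add: dist_real_def)
      then have "(g (x - y) - g x)\<^sup>2 \<le> c\<^sup>2" using abs_le_square_iff[of "g (x - y) - g x" c] c(1) by simp
      then show ?thesis using True by simp
    next
      case False
      have "norm x \<le> norm (x - y) + norm y" using norm_triangle_ineq[of "x - y" y] by simp
      then have "norm x > B" "norm (x - y) > B" using False y by (simp_all add: C_def \<delta>_def)
      then show ?thesis using g(2)[of x] g(2)[of "x - y"] by simp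
    qed
    have pt: "(U (x - y) - U x)\<^sup>2 \<le> 4 * (U (x - y) - g (x - y))\<^sup>2 + (4 * (c\<^sup>2 * indicator C x) + 4 * (U x - g x)\<^sup>2)" for x
    proof -
      have "(U (x - y) - U x)\<^sup>2 \<le> 2 * (U (x - y) - g (x - y))\<^sup>2 + 2 * (g (x - y) - U x)\<^sup>2" by (rule square_diff_le)
      moreover have "(g (x - y) - U x)\<^sup>2 \<le> 2 * (g (x - y) - g x)\<^sup>2 + 2 * (g x - U x)\<^sup>2" by (rule square_diff_le)
      moreover have "(g x - U x)\<^sup>2 = (U x - g x)\<^sup>2" by (rule power2_commute)
      moreover have "0 \<le> (U (x - y) - g (x - y))\<^sup>2" by simp
      ultimately show ?thesis using gd[of x] by linarith
    qed
    have i1: "integrable lborel (\<lambda>x. (U (x - y) - g (x - y))\<^sup>2)" "(LINT x|lborel. (U (x - y) - g (x - y))\<^sup>2) = (LINT x|lborel. (U x - g x)\<^sup>2)"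
      using lborel_integral_shift[of "\<lambda>x. (U x - g x)\<^sup>2" "- y"] g(3) by simp_all
    have i2: "integrable lborel (\<lambda>x. c\<^sup>2 * indicator C x)" "(LINT x|lborel. c\<^sup>2 * indicator C x) = c\<^sup>2 * m"
      using C by (simp_all add: m_def)
    have i3: "integrable lborel (\<lambda>x. 4 * (U (x - y) - g (x - y))\<^sup>2 + (4 * (c\<^sup>2 * indicator C x) + 4 * (U x - g x)\<^sup>2))"
      by (intro Bochner_Integration.integrable_add integrable_mult_right i1 i2 g(3))
    have "(\<integral>\<^sup>+x. ennreal ((U (x - y) - U x)\<^sup>2) \<partial>lborel) \<le> (\<integral>\<^sup>+x. ennreal (4 * (U (x - y) - g (x - y))\<^sup>2 + (4 * (c\<^sup>2 * indicator C x) + 4 * (U x - g x)\<^sup>2)) \<partial>lborel)"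
      by (intro nn_integral_mono ennreal_leI pt)
    also have "\<dots> = ennreal (LINT x|lborel. 4 * (U (x - y) - g (x - y))\<^sup>2 + (4 * (c\<^sup>2 * indicator C x) + 4 * (U x - g x)\<^sup>2))"
      by (rule nn_integral_eq_integral[OF i3]) (simp add: indicator_def)
    also have "(LINT x|lborel. 4 * (U (x - y) - g (x - y))\<^sup>2 + (4 * (c\<^sup>2 * indicator C x) + 4 * (U x - g x)\<^sup>2))
       = 4 * (LINT x|lborel. (U x - g x)\<^sup>2) + (4 * (c\<^sup>2 * m) + 4 * (LINT x|lborel. (U x - g x)\<^sup>2))"
      using i1 i2 g(3) by simp
    also have "\<dots> \<le> \<epsilon>" using g(4) c(2) by simp
    finally show "(\<integral>\<^sup>+x. ennreal ((U (x - y) - U x)\<^sup>2) \<partial>lborel) \<le> ennreal \<epsilon>" by (simp add: ennreal_leI)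
  qed
qed

lemma lborel_integral_reflect:
  fixes f :: "'a::euclidean_space \<Rightarrow> real"
  assumes [measurable]: "f \<in> borel_measurable borel"
  shows "(LINT y|lborel. f (x - y)) = (LINT y|lborel. f y)"
    and "integrable lborel (\<lambda>y. f (x - y)) \<longleftrightarrow> integrable lborel f"
proof -
  have eq: "lborel = distr lborel borel (\<lambda>y::'a. x - y)"
    using lborel_affine[of "-1" x] by (simp add: density_1)
  have "(LINT y|lborel. f y) = (LINT y|distr lborel borel (\<lambda>y. x - y). f y)" using eq by simp
  also have "\<dots> = (LINT y|lborel. f (x - y))" by (rule integral_distr) simp_all
  finally show "(LINT y|lborel. f (x - y)) = (LINT y|lborel. f y)" by simp
  have "integrable lborel f \<longleftrightarrow> integrable (distr lborel borel (\<lambda>y. x - y)) f" using eq by simp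
  also have "\<dots> \<longleftrightarrow> integrable lborel (\<lambda>y. f (x - y))" by (rule integrable_distr_eq) simp_all
  finally show "integrable lborel (\<lambda>y. f (x - y)) \<longleftrightarrow> integrable lborel f" by simp
qed

text \<open>The error \<open>\<integral> H (U * \<rho> - U)\<close> is the double integral of \<open>H(x) (U(x - y) - U(x)) \<rho>(y)\<close>. Bounding the first two
factors by \<open>(t H(x)\<^sup>2 + (U(x - y) - U(x))\<^sup>2/t)/2\<close> leaves a nonnegative integrand, to which Tonelli's theorem
applies; the weight \<open>t\<close> remains free, to be optimised later.\<close>

lemma conv_error:
  fixes U H \<rho> :: "real^'n::finite \<Rightarrow> real"
  assumes U[measurable]: "U \<in> borel_measurable borel" and Ui: "integrable lborel U"
    and H[measurable]: "H \<in> borel_measurable borel" and Hi: "integrable lborel (\<lambda>x. (H x)\<^sup>2)"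
    and \<rho>: "continuous_on UNIV \<rho>" "\<And>x. \<bar>\<rho> x\<bar> \<le> M" "\<And>x. 0 \<le> \<rho> x" "integrable lborel \<rho>" "(LINT x|lborel. \<rho> x) = 1"
    and B: "0 \<le> B" "\<And>y. \<rho> y \<noteq> 0 \<Longrightarrow> (\<integral>\<^sup>+x. ennreal ((U (x - y) - U x)\<^sup>2) \<partial>lborel) \<le> ennreal B"
    and t: "0 < t"
  shows "integrable lborel (\<lambda>x. H x * (convolution U \<rho> x - U x))"
    and "\<bar>LINT x|lborel. H x * (convolution U \<rho> x - U x)\<bar> \<le> (t * (LINT x|lborel. (H x)\<^sup>2) + B / t) / 2"
proof -
  have [measurable]: "\<rho> \<in> borel_measurable borel" using \<rho>(1) by (rule borel_measurable_continuous_onI)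
  have [measurable]: "convolution U \<rho> \<in> borel_measurable borel"
    by (rule borel_measurable_continuous_onI[OF conv_continuous[OF Ui \<rho>(1,2)]])
  define b where "b = (t * (LINT x|lborel. (H x)\<^sup>2) + B / t) / 2"
  have b0: "0 \<le> b" using t B(1) by (simp add: b_def)
  define F where "F = (\<lambda>x y. (t * (H x)\<^sup>2 + (U (x - y) - U x)\<^sup>2 / t) / 2 * \<rho> y)"
  have F0: "0 \<le> F x y" for x y using t \<rho>(3) by (simp add: F_def)
  have Fm: "(\<lambda>(x, y). ennreal (F x y)) \<in> borel_measurable (lborel \<Otimes>\<^sub>M lborel)"
    unfolding F_def by measurable
  have pt: "ennreal \<bar>H x * (convolution U \<rho> x - U x)\<bar> \<le> (\<integral>\<^sup>+y. ennreal (F x y) \<partial>lborel)" for x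
  proof -
    have i1: "integrable lborel (\<lambda>y. U y * \<rho> (x - y))"
      by (rule integrable_mult_bounded[OF Ui continuous_shift_measurable[OF \<rho>(1)] \<rho>(2)])
    have i2: "integrable lborel (\<lambda>y. U (x - y) * \<rho> y)" "(LINT y|lborel. U (x - y) * \<rho> y) = convolution U \<rho> x"
      using lborel_integral_reflect[of "\<lambda>y. U y * \<rho> (x - y)" x] i1 unfolding convolution_def by simp_all
    have i3: "integrable lborel (\<lambda>y. U x * \<rho> y)" using \<rho>(4) by simp
    have i4: "integrable lborel (\<lambda>y. H x * (U (x - y) * \<rho> y - U x * \<rho> y))"
      by (intro integrable_mult_right Bochner_Integration.integrable_diff i2 i3)
    have e: "H x * (convolution U \<rho> x - U x) = (LINT y|lborel. H x * (U (x - y) * \<rho> y - U x * \<rho> y))"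
      using i2 i3 \<rho>(5) by simp
    have "ennreal \<bar>H x * (convolution U \<rho> x - U x)\<bar> \<le> (\<integral>\<^sup>+y. ennreal (norm (H x * (U (x - y) * \<rho> y - U x * \<rho> y))) \<partial>lborel)"
      unfolding e real_norm_def[symmetric] by (rule integral_norm_bound_ennreal[OF i4])
    also have "\<dots> \<le> (\<integral>\<^sup>+y. ennreal (F x y) \<partial>lborel)"
    proof (intro nn_integral_mono ennreal_leI)
      fix y
      define a c where "a = \<bar>H x\<bar>" and "c = \<bar>U (x - y) - U x\<bar>"
      have "0 \<le> (t * a - c)\<^sup>2 / t" using t by simp
      also have "\<dots> = t * a\<^sup>2 + c\<^sup>2 / t - 2 * (a * c)" using t by (simp add: power2_eq_square field_simps)
      finally have "a * c \<le> (t * (H x)\<^sup>2 + (U (x - y) - U x)\<^sup>2 / t) / 2" by (simp add: a_def c_def)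
      then have "a * c * \<rho> y \<le> F x y" unfolding F_def using \<rho>(3) by (rule mult_right_mono)
      moreover have "norm (H x * (U (x - y) * \<rho> y - U x * \<rho> y)) = a * c * \<rho> y"
        using \<rho>(3)[of y] by (simp add: a_def c_def abs_mult left_diff_distrib[symmetric])
      ultimately show "norm (H x * (U (x - y) * \<rho> y - U x * \<rho> y)) \<le> F x y" by simp
    qed
    finally show ?thesis .
  qed
  have Fint: "(\<integral>\<^sup>+x. ennreal (F x y) \<partial>lborel) \<le> ennreal (b * \<rho> y)" for y
  proof (cases "\<rho> y = 0")
    case False
    then have \<rho>y: "\<rho> y > 0" using \<rho>(3)[of y] by simp
    have "(\<integral>\<^sup>+x. ennreal (F x y) \<partial>lborel)
        = (\<integral>\<^sup>+x. ennreal (t / 2 * \<rho> y) * ennreal ((H x)\<^sup>2) + ennreal (1 / (2 * t) * \<rho> y) * ennreal ((U (x - y) - U x)\<^sup>2) \<partial>lborel)"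
      using t \<rho>y by (intro nn_integral_cong) (simp add: F_def ennreal_mult[symmetric] ennreal_plus[symmetric] field_simps del: ennreal_plus)
    also have "\<dots> = ennreal (t / 2 * \<rho> y) * (\<integral>\<^sup>+x. ennreal ((H x)\<^sup>2) \<partial>lborel) + ennreal (1 / (2 * t) * \<rho> y) * (\<integral>\<^sup>+x. ennreal ((U (x - y) - U x)\<^sup>2) \<partial>lborel)"
      by (subst nn_integral_add) (simp_all add: nn_integral_cmult)
    also have "\<dots> \<le> ennreal (t / 2 * \<rho> y) * ennreal (LINT x|lborel. (H x)\<^sup>2) + ennreal (1 / (2 * t) * \<rho> y) * ennreal B"
      using nn_integral_eq_integral[OF Hi] B(2)[OF False] by (intro add_mono mult_left_mono) simp_all
    also have "\<dots> = ennreal (b * \<rho> y)"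
      using t \<rho>y B(1) by (simp add: b_def ennreal_mult[symmetric] ennreal_plus[symmetric] field_simps del: ennreal_plus)
    finally show ?thesis .
  qed (simp add: F_def)
  have "(\<integral>\<^sup>+x. ennreal (norm (H x * (convolution U \<rho> x - U x))) \<partial>lborel) \<le> (\<integral>\<^sup>+x. \<integral>\<^sup>+y. ennreal (F x y) \<partial>lborel \<partial>lborel)"
    using pt by (intro nn_integral_mono) simp
  also have "\<dots> = (\<integral>\<^sup>+y. \<integral>\<^sup>+x. ennreal (F x y) \<partial>lborel \<partial>lborel)"
    using lborel_pair.Fubini'[OF Fm] by simp
  also have "\<dots> \<le> (\<integral>\<^sup>+y. ennreal (b * \<rho> y) \<partial>lborel)" by (intro nn_integral_mono Fint)
  also have "\<dots> = ennreal (LINT y|lborel. b * \<rho> y)"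
    using b0 \<rho>(3,4) by (intro nn_integral_eq_integral) simp_all
  also have "(LINT y|lborel. b * \<rho> y) = b" using \<rho>(5) by simp
  finally have le: "(\<integral>\<^sup>+x. ennreal (norm (H x * (convolution U \<rho> x - U x))) \<partial>lborel) \<le> ennreal b" .
  show i: "integrable lborel (\<lambda>x. H x * (convolution U \<rho> x - U x))"
  proof (rule integrableI_bounded)
    show "(\<integral>\<^sup>+x. ennreal (norm (H x * (convolution U \<rho> x - U x))) \<partial>lborel) < \<infinity>"
      using le by (rule le_less_trans) simp
  qed simp
  have "ennreal (norm (LINT x|lborel. H x * (convolution U \<rho> x - U x))) \<le> ennreal b"
    using integral_norm_bound_ennreal[OF i] le by (rule order_trans)
  then show "\<bar>LINT x|lborel. H x * (convolution U \<rho> x - U x)\<bar> \<le> (t * (LINT x|lborel. (H x)\<^sup>2) + B / t) / 2"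
    using b0 unfolding b_def[symmetric] by simp
qed

section \<open>Mollified weak gradients\<close>

lemma lebesgue_integral_borel_representative:
  fixes F F' :: "'a::euclidean_space \<Rightarrow> real"
  assumes F': "F' \<in> borel_measurable borel" and ae: "AE x in lborel. F x = F' x"
  shows "(LINT x|lebesgue. F x) = (LINT x|lborel. F' x)"
    and "integrable lebesgue F \<longleftrightarrow> integrable lborel F'"
proof -
  have m': "F' \<in> borel_measurable lebesgue" using F' by (simp add: measurable_completion)
  have ae': "AE x in lebesgue. F' x = F x" using AE_completion[OF ae] by eventually_elim simp
  have m: "F \<in> borel_measurable lebesgue" by (rule borel_measurable_AE[OF m' ae'])
  have "(LINT x|lebesgue. F x) = (LINT x|lebesgue. F' x)"
    by (rule integral_cong_AE[OF m m']) (use ae' in \<open>eventually_elim, simp\<close>)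
  also have "\<dots> = (LINT x|lborel. F' x)" by (rule integral_completion) (simp add: F')
  finally show "(LINT x|lebesgue. F x) = (LINT x|lborel. F' x)" .
  have "integrable lebesgue F \<longleftrightarrow> integrable lebesgue F'"
    by (rule integrable_cong_AE[OF m m']) (use ae' in \<open>eventually_elim, simp\<close>)
  also have "\<dots> \<longleftrightarrow> integrable lborel F'" by (rule integrable_completion) (simp add: F')
  finally show "integrable lebesgue F \<longleftrightarrow> integrable lborel F'" .
qed

text \<open>Convolutions need Tonelli's theorem for integrands such as \<open>U(x - y)\<close>, which for a merely Lebesgue measurable
\<open>U\<close> need not be measurable on the product of the completed measure spaces. Hence Borel representatives,
integrated against \<open>lborel\<close>.\<close>

definition borel_L2_loc :: "('a::euclidean_space \<Rightarrow> real) \<Rightarrow> bool" where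
  "borel_L2_loc s \<longleftrightarrow> s \<in> borel_measurable borel \<and>
     (\<forall>K. compact K \<longrightarrow> integrable lborel (\<lambda>x. indicator K x * (s x)\<^sup>2))"

lemma L2_loc_borel_representative:
  fixes \<sigma> :: "real^'n::finite \<Rightarrow> real"
  assumes \<sigma>: "\<sigma> \<in> L2_loc"
  obtains s where "borel_L2_loc s" "AE x in lborel. \<sigma> x = s x"
proof -
  have "\<sigma> \<in> borel_measurable lebesgue" using \<sigma> by (simp add: L2_loc_def)
  from completion_ex_borel_measurable_real[OF this]
  obtain s where s: "s \<in> borel_measurable lborel" "AE x in lborel. \<sigma> x = s x" by blast
  then have [measurable]: "s \<in> borel_measurable borel" by simp
  have "integrable lborel (\<lambda>x. indicator K x * (s x)\<^sup>2)" if K: "compact K" for K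
  proof -
    have [measurable]: "K \<in> sets borel" using K by (rule borel_compact)
    have i: "integrable lebesgue (\<lambda>x. indicator K x *\<^sub>R (norm (\<sigma> x))\<^sup>2)"
      using \<sigma> K unfolding L2_loc_def set_integrable_def by blast
    have ae: "AE x in lborel. indicator K x *\<^sub>R (norm (\<sigma> x))\<^sup>2 = indicator K x * (s x)\<^sup>2"
      using s(2) by eventually_elim simp
    have m: "(\<lambda>x. indicator K x * (s x)\<^sup>2) \<in> borel_measurable borel" by measurable
    show ?thesis by (rule lebesgue_integral_borel_representative(2)[OF m ae, THEN iffD1, OF i])
  qed
  then have "borel_L2_loc s" by (simp add: borel_L2_loc_def)
  with s(2) show ?thesis using that by blast
qed

lemma L2_loc_component:
  fixes G :: "real^'n::finite \<Rightarrow> real^'n"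
  assumes G: "G \<in> L2_loc"
  shows "(\<lambda>x. G x $ i) \<in> L2_loc"
proof -
  have Gm: "G \<in> borel_measurable lebesgue" using G by (simp add: L2_loc_def)
  have m: "(\<lambda>x. G x $ i) \<in> borel_measurable lebesgue"
    unfolding cart_eq_inner_axis using Gm by (intro borel_measurable_inner) simp_all
  have "set_integrable lebesgue K (\<lambda>x. (norm (G x $ i))\<^sup>2)" if K: "compact K" for K
    unfolding set_integrable_def
  proof (rule Bochner_Integration.integrable_bound)
    show "integrable lebesgue (\<lambda>x. indicator K x *\<^sub>R (norm (G x))\<^sup>2)"
      using G K unfolding L2_loc_def set_integrable_def by blast
    have [measurable]: "K \<in> sets lebesgue" using borel_compact[OF K] by simp
    show "(\<lambda>x. indicator K x *\<^sub>R (norm (G x $ i))\<^sup>2) \<in> borel_measurable lebesgue"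
      using m by measurable
    have "(norm (G x $ i))\<^sup>2 \<le> (norm (G x))\<^sup>2" for x
      using Finite_Cartesian_Product.norm_nth_le[of "G x" i] by (intro power_mono) simp_all
    then show "AE x in lebesgue. norm (indicator K x *\<^sub>R (norm (G x $ i))\<^sup>2) \<le> norm (indicator K x *\<^sub>R (norm (G x))\<^sup>2)"
      by (intro AE_I2) (simp add: indicator_def)
  qed
  with m show ?thesis by (simp add: L2_loc_def)
qed

lemma weak_gradient_borel_representative:
  fixes \<sigma> :: "real^'n::finite \<Rightarrow> real"
  assumes \<sigma>: "\<sigma> \<in> L2_loc" and wg: "weak_gradient \<sigma> G"
  obtains s g where "borel_L2_loc s" "\<And>i. borel_L2_loc (g i)" "AE x in lborel. \<sigma> x = s x"
    "AE x in lborel. \<forall>i. G x $ i = g i x"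
    "\<And>\<eta> i. \<eta> \<in> Cc_infinity \<Longrightarrow> (LINT x|lborel. s x * partial_deriv i \<eta> x) = - (LINT x|lborel. g i x * \<eta> x)"
proof -
  obtain s where s: "borel_L2_loc s" "AE x in lborel. \<sigma> x = s x"
    using L2_loc_borel_representative[OF \<sigma>] by blast
  have "G \<in> L2_loc" using wg by (simp add: weak_gradient_def)
  then have "\<forall>i. \<exists>f. borel_L2_loc f \<and> (AE x in lborel. G x $ i = f x)"
    using L2_loc_borel_representative[OF L2_loc_component] by metis
  then obtain g where g: "\<And>i. borel_L2_loc (g i)" "\<And>i. AE x in lborel. G x $ i = g i x" by metis
  have [measurable]: "s \<in> borel_measurable borel" "\<And>i. g i \<in> borel_measurable borel"
    using s(1) g(1) by (simp_all add: borel_L2_loc_def)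
  have "AE x in lborel. \<forall>i\<in>UNIV. G x $ i = g i x"
    by (rule AE_finite_allI) (simp_all add: g(2))
  then have ae: "AE x in lborel. \<forall>i. G x $ i = g i x" by simp
  have "(LINT x|lborel. s x * partial_deriv i \<eta> x) = - (LINT x|lborel. g i x * \<eta> x)" if \<eta>: "\<eta> \<in> Cc_infinity" for \<eta> i
  proof -
    have [measurable]: "\<eta> \<in> borel_measurable borel" "partial_deriv i \<eta> \<in> borel_measurable borel"
      using Cc_infinity_continuous[OF \<eta>] Cc_infinity_partial_deriv(1)[OF \<eta>] by (simp_all add: borel_measurable_continuous_onI)
    have "(LINT x|lebesgue. \<sigma> x * partial_deriv i \<eta> x) = (LINT x|lborel. s x * partial_deriv i \<eta> x)"
      by (rule lebesgue_integral_borel_representative(1)) (measurable, use s(2) in \<open>eventually_elim, simp\<close>)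
    moreover have "(LINT x|lebesgue. G x $ i * \<eta> x) = (LINT x|lborel. g i x * \<eta> x)"
      by (rule lebesgue_integral_borel_representative(1)) (measurable, use g(2)[of i] in \<open>eventually_elim, simp\<close>)
    ultimately show ?thesis using wg \<eta> unfolding weak_gradient_def by metis
  qed
  with s g(1) ae show ?thesis using that by blast
qed

lemma borel_L2_loc_times_test:
  assumes s: "borel_L2_loc s" and \<zeta>: "\<zeta> \<in> Cc_infinity"
  shows "integrable lborel (\<lambda>x. s x * \<zeta> x)" "integrable lborel (\<lambda>x. (s x * \<zeta> x)\<^sup>2)"
proof -
  define K where "K = closure {x. \<zeta> x \<noteq> 0}"
  have K: "compact K" using \<zeta> by (simp add: K_def Cc_infinity_def)
  have \<zeta>0: "\<zeta> x = 0" if "x \<notin> K" for x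
    using that closure_subset[of "{x. \<zeta> x \<noteq> 0}"] unfolding K_def by blast
  obtain M where M: "0 \<le> M" "\<And>x. \<bar>\<zeta> x\<bar> \<le> M" using Cc_infinity_bounded[OF \<zeta>] by blast
  have [measurable]: "s \<in> borel_measurable borel" using s by (simp add: borel_L2_loc_def)
  have [measurable]: "\<zeta> \<in> borel_measurable borel"
    using Cc_infinity_continuous[OF \<zeta>] by (rule borel_measurable_continuous_onI)
  have i1: "integrable lborel (\<lambda>x. indicator K x * (s x)\<^sup>2)" using s K by (simp add: borel_L2_loc_def)
  have i2: "integrable lborel (\<lambda>x. indicator K x :: real)"
    using K emeasure_compact_finite[OF K] by (intro integrable_real_indicator) (simp_all add: borel_compact)
  have i3: "integrable lborel (\<lambda>x. M * (indicator K x + indicator K x * (s x)\<^sup>2))"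
    using i1 i2 by (intro integrable_mult_right Bochner_Integration.integrable_add)
  have b1: "\<bar>s x * \<zeta> x\<bar> \<le> M * (indicator K x + indicator K x * (s x)\<^sup>2)" for x
  proof (cases "x \<in> K")
    case True
    have "0 \<le> (\<bar>s x\<bar> - 1)\<^sup>2 + (s x)\<^sup>2 + 1" by simp
    then have "\<bar>s x\<bar> \<le> 1 + (s x)\<^sup>2" by (simp add: power2_eq_square algebra_simps)
    then have "\<bar>s x\<bar> * \<bar>\<zeta> x\<bar> \<le> (1 + (s x)\<^sup>2) * M" using M(2)[of x] by (intro mult_mono) simp_all
    then show ?thesis using True by (simp add: abs_mult mult.commute)
  next
    case False then show ?thesis using \<zeta>0 by simp
  qed
  show "integrable lborel (\<lambda>x. s x * \<zeta> x)"
  proof (rule Bochner_Integration.integrable_bound[OF i3])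
    show "AE x in lborel. norm (s x * \<zeta> x) \<le> norm (M * (indicator K x + indicator K x * (s x)\<^sup>2))"
      using b1 abs_ge_self order_trans unfolding real_norm_def by (intro AE_I2) blast
  qed simp
  have b2: "(s x * \<zeta> x)\<^sup>2 \<le> M\<^sup>2 * (indicator K x * (s x)\<^sup>2)" for x
  proof (cases "x \<in> K")
    case True
    have "(\<zeta> x)\<^sup>2 \<le> M\<^sup>2" using M(1) M(2)[of x] by (simp add: abs_le_square_iff[symmetric])
    then have "(s x)\<^sup>2 * (\<zeta> x)\<^sup>2 \<le> (s x)\<^sup>2 * M\<^sup>2" by (intro mult_left_mono) simp_all
    then show ?thesis using True by (simp add: power_mult_distrib mult.commute)
  next
    case False then show ?thesis using \<zeta>0 by simp
  qed
  show "integrable lborel (\<lambda>x. (s x * \<zeta> x)\<^sup>2)"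
  proof (rule Bochner_Integration.integrable_bound[OF integrable_mult_right[OF i1, of "M\<^sup>2"]])
    show "AE x in lborel. norm ((s x * \<zeta> x)\<^sup>2) \<le> norm (M\<^sup>2 * (indicator K x * (s x)\<^sup>2))"
      using b2 by (intro AE_I2) (simp add: indicator_def)
  qed simp
qed

lemma Cc_infinity_mult_Ck:
  assumes \<eta>: "\<eta> \<in> Cc_infinity" and f: "\<And>k. Ck k f"
  shows "(\<lambda>x. \<eta> x * f x) \<in> Cc_infinity"
proof -
  have "Ck k (\<lambda>x. \<eta> x * f x)" for k using \<eta> f unfolding Cc_infinity_def by (intro Ck_mult) simp_all
  moreover have "bounded {x. \<eta> x \<noteq> 0}" using \<eta> by (simp add: Cc_infinity_def)
  then have "bounded {x. \<eta> x * f x \<noteq> 0}" by (rule bounded_subset) (simp add: Collect_mono)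
  ultimately show ?thesis by (simp add: Cc_infinity_def)
qed

text \<open>The derivative of the mollification falls on the kernel; as \<open>y \<mapsto> \<eta>(y) \<rho>(x - y)\<close> is a test function, the
definition of the weak gradient moves it back to \<open>s \<eta>\<close>.\<close>

lemma partial_deriv_conv_weak:
  fixes s :: "real^'n::finite \<Rightarrow> real"
  assumes s: "borel_L2_loc s" and g: "\<And>i. borel_L2_loc (g i)"
    and w: "\<And>\<eta> i. \<eta> \<in> Cc_infinity \<Longrightarrow> (LINT x|lborel. s x * partial_deriv i \<eta> x) = - (LINT x|lborel. g i x * \<eta> x)"
    and \<eta>: "\<eta> \<in> Cc_infinity" and \<rho>: "\<rho> \<in> Cc_infinity"
  shows "partial_deriv i (convolution (\<lambda>y. s y * \<eta> y) \<rho>) x = convolution (\<lambda>y. s y * partial_deriv i \<eta> y + g i y * \<eta> y) \<rho> x"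
proof -
  have ck: "Ck k \<eta>" "Ck k \<rho>" for k using \<eta> \<rho> by (simp_all add: Cc_infinity_def)
  have d: "\<eta> differentiable (at y)" "\<rho> differentiable (at y)" for y
    using ck[of 1] by simp_all
  have r: "Ck k (\<lambda>y. \<rho> (x - y))" "Ck k (\<lambda>y. partial_deriv i \<rho> (x - y))" for k
    using ck(2) Cc_infinity_partial_deriv(4)[OF \<rho>] by (auto intro!: Ck_reflect simp: Cc_infinity_def)
  define K where "K = closure {x. \<eta> x \<noteq> 0}"
  have K: "compact K" using \<eta> by (simp add: K_def Cc_infinity_def)
  have \<eta>0: "s y * \<eta> y = 0" if "y \<notin> K" for y
    using that closure_subset[of "{x. \<eta> x \<noteq> 0}"] unfolding K_def by auto
  let ?\<zeta> = "\<lambda>y. \<eta> y * \<rho> (x - y)"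
  have \<zeta>: "?\<zeta> \<in> Cc_infinity" by (rule Cc_infinity_mult_Ck[OF \<eta> r(1)])
  have rd: "(\<lambda>y. \<rho> (x - y)) differentiable (at y)" for y using r(1)[of 1] by simp
  have p\<zeta>: "partial_deriv i ?\<zeta> y = \<eta> y * (- partial_deriv i \<rho> (x - y)) + partial_deriv i \<eta> y * \<rho> (x - y)" for y
    unfolding partial_deriv_mult(1)[OF d(1) rd] partial_deriv_reflect[OF d(2)] ..
  have i1: "integrable lborel (\<lambda>y. s y * (\<eta> y * partial_deriv i \<rho> (x - y)))"
    by (rule borel_L2_loc_times_test(1)[OF s Cc_infinity_mult_Ck[OF \<eta> r(2)]])
  have i2: "integrable lborel (\<lambda>y. s y * (partial_deriv i \<eta> y * \<rho> (x - y)))"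
    by (rule borel_L2_loc_times_test(1)[OF s Cc_infinity_mult_Ck[OF Cc_infinity_partial_deriv(4)[OF \<eta>] r(1)]])
  have i3: "integrable lborel (\<lambda>y. g i y * (\<eta> y * \<rho> (x - y)))"
    by (rule borel_L2_loc_times_test(1)[OF g \<zeta>])
  have "(LINT y|lborel. s y * partial_deriv i ?\<zeta> y)
      = (LINT y|lborel. s y * (partial_deriv i \<eta> y * \<rho> (x - y)) - s y * (\<eta> y * partial_deriv i \<rho> (x - y)))"
    unfolding p\<zeta> by (simp add: algebra_simps)
  also have "\<dots> = (LINT y|lborel. s y * (partial_deriv i \<eta> y * \<rho> (x - y))) - (LINT y|lborel. s y * (\<eta> y * partial_deriv i \<rho> (x - y)))"
    using i1 i2 by simp
  finally have "(LINT y|lborel. s y * (\<eta> y * partial_deriv i \<rho> (x - y)))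
     = (LINT y|lborel. s y * (partial_deriv i \<eta> y * \<rho> (x - y))) + (LINT y|lborel. g i y * (\<eta> y * \<rho> (x - y)))"
    using w[OF \<zeta>, of i] by simp
  also have "\<dots> = (LINT y|lborel. s y * (partial_deriv i \<eta> y * \<rho> (x - y)) + g i y * (\<eta> y * \<rho> (x - y)))"
    using i2 i3 by simp
  also have "\<dots> = convolution (\<lambda>y. s y * partial_deriv i \<eta> y + g i y * \<eta> y) \<rho> x"
    unfolding convolution_def by (simp add: algebra_simps)
  finally have e: "(LINT y|lborel. s y * (\<eta> y * partial_deriv i \<rho> (x - y)))
     = convolution (\<lambda>y. s y * partial_deriv i \<eta> y + g i y * \<eta> y) \<rho> x" .
  have "partial_deriv i (convolution (\<lambda>y. s y * \<eta> y) \<rho>) x = convolution (\<lambda>y. s y * \<eta> y) (partial_deriv i \<rho>) x"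
    by (rule conv_Cc_infinity(2)[OF borel_L2_loc_times_test(1)[OF s \<eta>] K _ \<rho>]) (rule \<eta>0)
  also have "\<dots> = (LINT y|lborel. s y * (\<eta> y * partial_deriv i \<rho> (x - y)))"
    unfolding convolution_def mult.assoc ..
  finally show ?thesis unfolding e .
qed

definition mollifier_sequence :: "(nat \<Rightarrow> real^'n::finite \<Rightarrow> real) \<Rightarrow> bool" where
  "mollifier_sequence \<rho> \<longleftrightarrow> (\<forall>n. \<rho> n \<in> Cc_infinity \<and> (\<forall>x. 0 \<le> \<rho> n x) \<and>
     (\<forall>x. norm x \<ge> 1 / real (Suc n) \<longrightarrow> \<rho> n x = 0) \<and> integrable lborel (\<rho> n) \<and> (LINT x|lborel. \<rho> n x) = 1)"

lemma mollifier_sequence_exists: "\<exists>\<rho> :: nat \<Rightarrow> real^'n::finite \<Rightarrow> real. mollifier_sequence \<rho>"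
proof -
  have "\<forall>n. \<exists>\<rho> :: real^'n \<Rightarrow> real. \<rho> \<in> Cc_infinity \<and> (\<forall>x. 0 \<le> \<rho> x) \<and>
     (\<forall>x. norm x \<ge> 1 / real (Suc n) \<longrightarrow> \<rho> x = 0) \<and> integrable lborel \<rho> \<and> (LINT x|lborel. \<rho> x) = 1"
  proof
    fix n
    have "0 < 1 / real (Suc n)" by simp
    then obtain \<rho> :: "real^'n \<Rightarrow> real" where "\<rho> \<in> Cc_infinity" "\<And>x. 0 \<le> \<rho> x"
      "\<And>x. norm x \<ge> 1 / real (Suc n) \<Longrightarrow> \<rho> x = 0" "integrable lborel \<rho>" "(LINT x|lborel. \<rho> x) = 1"
      by (rule mollifier) (rule that)
    then show "\<exists>\<rho> :: real^'n \<Rightarrow> real. \<rho> \<in> Cc_infinity \<and> (\<forall>x. 0 \<le> \<rho> x) \<and>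
     (\<forall>x. norm x \<ge> 1 / real (Suc n) \<longrightarrow> \<rho> x = 0) \<and> integrable lborel \<rho> \<and> (LINT x|lborel. \<rho> x) = 1"
      by (intro exI[of _ \<rho>] conjI allI impI)
  qed
  from choice[OF this] show ?thesis unfolding mollifier_sequence_def .
qed

text \<open>Weak convergence of mollifications in \<open>L\<^sup>2\<close>. In \<open>conv_error\<close> the weight \<open>t\<close> makes the term with \<open>H\<close>
small, and then continuity of translations makes the other term small.\<close>

lemma conv_weak_convergence:
  fixes U H :: "real^'n::finite \<Rightarrow> real"
  assumes U[measurable]: "U \<in> borel_measurable borel" and Ui: "integrable lborel U" "integrable lborel (\<lambda>x. (U x)\<^sup>2)"
    and H[measurable]: "H \<in> borel_measurable borel" and Hi: "integrable lborel (\<lambda>x. (H x)\<^sup>2)"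
    and \<rho>: "mollifier_sequence \<rho>"
  shows "integrable lborel (\<lambda>x. H x * U x)" "integrable lborel (\<lambda>x. H x * convolution U (\<rho> n) x)"
    and "(\<lambda>n. LINT x|lborel. H x * convolution U (\<rho> n) x) \<longlonglongrightarrow> (LINT x|lborel. H x * U x)"
proof -
  show HU: "integrable lborel (\<lambda>x. H x * U x)"
  proof (rule Bochner_Integration.integrable_bound[OF Bochner_Integration.integrable_add[OF Hi Ui(2)]])
    have "\<bar>H x * U x\<bar> \<le> (H x)\<^sup>2 + (U x)\<^sup>2" for x
    proof -
      have "0 \<le> (\<bar>H x\<bar> - \<bar>U x\<bar>)\<^sup>2 + (H x)\<^sup>2 + (U x)\<^sup>2" by simp
      then show ?thesis by (simp add: power2_eq_square algebra_simps abs_mult)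
    qed
    then show "AE x in lborel. norm (H x * U x) \<le> norm ((H x)\<^sup>2 + (U x)\<^sup>2)" by simp
  qed simp
  have \<rho>n: "\<rho> n \<in> Cc_infinity" "0 \<le> \<rho> n x" "norm x \<ge> 1 / real (Suc n) \<Longrightarrow> \<rho> n x = 0"
    "integrable lborel (\<rho> n)" "(LINT x|lborel. \<rho> n x) = 1" for n x
    using \<rho> unfolding mollifier_sequence_def by blast+
  define A where "A = (LINT x|lborel. (H x)\<^sup>2)"
  have A0: "0 \<le> A" by (simp add: A_def)
  have err: "integrable lborel (\<lambda>x. H x * (convolution U (\<rho> n) x - U x))"
     "\<bar>LINT x|lborel. H x * (convolution U (\<rho> n) x - U x)\<bar> \<le> (t * A + B / t) / 2"
    if B: "0 \<le> B" "\<And>y. \<rho> n y \<noteq> 0 \<Longrightarrow> (\<integral>\<^sup>+x. ennreal ((U (x - y) - U x)\<^sup>2) \<partial>lborel) \<le> ennreal B" and t: "0 < t" for n B t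
  proof -
    obtain M where M: "\<And>x. \<bar>\<rho> n x\<bar> \<le> M" using Cc_infinity_bounded[OF \<rho>n(1)] by blast
    note ce = conv_error[OF U Ui(1) H Hi Cc_infinity_continuous[OF \<rho>n(1)] M \<rho>n(2) \<rho>n(4) \<rho>n(5) B t]
    show "integrable lborel (\<lambda>x. H x * (convolution U (\<rho> n) x - U x))" by (rule ce(1))
    show "\<bar>LINT x|lborel. H x * (convolution U (\<rho> n) x - U x)\<bar> \<le> (t * A + B / t) / 2"
      unfolding A_def by (rule ce(2))
  qed
  define B0 where "B0 = 4 * (LINT x|lborel. (U x)\<^sup>2)"
  have B0: "0 \<le> B0" by (simp add: B0_def)
  have bb: "(\<integral>\<^sup>+x. ennreal ((U (x - y) - U x)\<^sup>2) \<partial>lborel) \<le> ennreal B0" for y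
  proof -
    have sh: "integrable lborel (\<lambda>x. (U (x - y))\<^sup>2)" "(LINT x|lborel. (U (x - y))\<^sup>2) = (LINT x|lborel. (U x)\<^sup>2)"
      using lborel_integral_shift[of "\<lambda>x. (U x)\<^sup>2" "- y"] Ui(2) by simp_all
    have i: "integrable lborel (\<lambda>x. 2 * (U (x - y))\<^sup>2 + 2 * (U x)\<^sup>2)" using sh Ui(2) by simp
    have "(U (x - y) - U x)\<^sup>2 \<le> 2 * (U (x - y))\<^sup>2 + 2 * (U x)\<^sup>2" for x
      using square_diff_le[of "U (x - y)" "U x" 0] by simp
    then have "(\<integral>\<^sup>+x. ennreal ((U (x - y) - U x)\<^sup>2) \<partial>lborel) \<le> (\<integral>\<^sup>+x. ennreal (2 * (U (x - y))\<^sup>2 + 2 * (U x)\<^sup>2) \<partial>lborel)"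
      by (intro nn_integral_mono ennreal_leI)
    also have "\<dots> = ennreal (LINT x|lborel. 2 * (U (x - y))\<^sup>2 + 2 * (U x)\<^sup>2)"
      by (rule nn_integral_eq_integral[OF i]) simp
    also have "(LINT x|lborel. 2 * (U (x - y))\<^sup>2 + 2 * (U x)\<^sup>2) = B0" using sh Ui(2) by (simp add: B0_def)
    finally show ?thesis .
  qed
  have dint: "integrable lborel (\<lambda>x. H x * (convolution U (\<rho> n) x - U x))" for n
    by (rule err(1)[OF B0 bb zero_less_one])
  have eq: "H x * convolution U (\<rho> n) x = H x * (convolution U (\<rho> n) x - U x) + H x * U x" for n x
    by (simp add: algebra_simps)
  show "integrable lborel (\<lambda>x. H x * convolution U (\<rho> n) x)"
    unfolding eq by (intro Bochner_Integration.integrable_add dint HU)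
  have diff: "(LINT x|lborel. H x * convolution U (\<rho> n) x) - (LINT x|lborel. H x * U x)
     = (LINT x|lborel. H x * (convolution U (\<rho> n) x - U x))" for n
    unfolding eq Bochner_Integration.integral_add[OF dint HU] by simp
  show "(\<lambda>n. LINT x|lborel. H x * convolution U (\<rho> n) x) \<longlonglongrightarrow> (LINT x|lborel. H x * U x)"
  proof (rule LIMSEQ_I)
    fix r :: real assume r: "r > 0"
    define t where "t = r / (A + 1)"
    have t: "t > 0" using r A0 by (simp add: t_def)
    have tA: "t * A \<le> r"
    proof -
      have "t * A \<le> t * (A + 1)" using t by simp
      also have "\<dots> = r" using A0 by (simp add: t_def)
      finally show ?thesis .
    qed
    have "t * r / 2 > 0" using t r by simp
    then obtain \<delta> where \<delta>: "\<delta> > 0" "\<And>y. norm y < \<delta> \<Longrightarrow> (\<integral>\<^sup>+x. ennreal ((U (x - y) - U x)\<^sup>2) \<partial>lborel) \<le> ennreal (t * r / 2)"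
      using L2_translation_continuous[OF U Ui(2)] by blast
    obtain N where N: "1 / real (Suc N) < \<delta>" using \<delta>(1) nat_approx_posE by blast
    show "\<exists>no. \<forall>n\<ge>no. norm ((LINT x|lborel. H x * convolution U (\<rho> n) x) - (LINT x|lborel. H x * U x)) < r"
    proof (intro exI allI impI)
      fix n assume n: "n \<ge> N"
      have "1 / real (Suc n) \<le> 1 / real (Suc N)" using n by (simp add: field_simps)
      have "\<bar>LINT x|lborel. H x * (convolution U (\<rho> n) x - U x)\<bar> \<le> (t * A + (t * r / 2) / t) / 2"
      proof (rule err(2)[OF _ _ t])
        show "0 \<le> t * r / 2" using t r by simp
        fix y assume "\<rho> n y \<noteq> 0"
        then have "norm y < 1 / real (Suc n)" using \<rho>n(3)[of n y] by linarith
        then have "norm y < \<delta>" using N \<open>1 / real (Suc n) \<le> 1 / real (Suc N)\<close> by linarith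
        then show "(\<integral>\<^sup>+x. ennreal ((U (x - y) - U x)\<^sup>2) \<partial>lborel) \<le> ennreal (t * r / 2)" by (rule \<delta>(2))
      qed
      also have "(t * A + (t * r / 2) / t) / 2 < r" using t tA r by simp
      finally show "norm ((LINT x|lborel. H x * convolution U (\<rho> n) x) - (LINT x|lborel. H x * U x)) < r"
        unfolding diff by simp
    qed
  qed
qed

lemma conv_eq_0:
  assumes \<rho>: "mollifier_sequence \<rho>" and ae: "AE y in lborel. norm (x - y) < 1 \<longrightarrow> U y = 0"
  shows "convolution U (\<rho> n) x = 0"
  unfolding convolution_def
proof (rule integral_eq_zero_AE)
  show "AE y in lborel. U y * \<rho> n (x - y) = 0"
    using ae
  proof eventually_elim
    case (elim y)
    show ?case
    proof (cases "norm (x - y) < 1")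
      case True then show ?thesis using elim by simp
    next
      case False
      have "1 / real (Suc n) \<le> 1" by simp
      then have "norm (x - y) \<ge> 1 / real (Suc n)" using False by linarith
      then have "\<rho> n (x - y) = 0" using \<rho> unfolding mollifier_sequence_def by blast
      then show ?thesis by simp
    qed
  qed
qed

lemma test_gradient_integrable:
  fixes s g \<eta> :: "real^'n::finite \<Rightarrow> real" and i :: 'n
  assumes s: "borel_L2_loc s" and g: "borel_L2_loc g" and \<eta>: "\<eta> \<in> Cc_infinity"
  defines "U \<equiv> \<lambda>y. s y * partial_deriv i \<eta> y + g y * \<eta> y"
  shows "U \<in> borel_measurable borel" "integrable lborel U" "integrable lborel (\<lambda>y. (U y)\<^sup>2)"
proof -
  have [measurable]: "s \<in> borel_measurable borel" "g \<in> borel_measurable borel"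
    using s g by (simp_all add: borel_L2_loc_def)
  have [measurable]: "\<eta> \<in> borel_measurable borel" "partial_deriv i \<eta> \<in> borel_measurable borel"
    using Cc_infinity_continuous[OF \<eta>] Cc_infinity_partial_deriv(1)[OF \<eta>] by (simp_all add: borel_measurable_continuous_onI)
  show m: "U \<in> borel_measurable borel" unfolding U_def by measurable
  note i1 = borel_L2_loc_times_test[OF s Cc_infinity_partial_deriv(4)[OF \<eta>, of i]]
  note i2 = borel_L2_loc_times_test[OF g \<eta>]
  show "integrable lborel U" unfolding U_def using i1(1) i2(1) by (rule Bochner_Integration.integrable_add)
  have i3: "integrable lborel (\<lambda>y. 2 * (s y * partial_deriv i \<eta> y)\<^sup>2 + 2 * (g y * \<eta> y)\<^sup>2)"
    using i1(2) i2(2) by simp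
  show "integrable lborel (\<lambda>y. (U y)\<^sup>2)"
  proof (rule Bochner_Integration.integrable_bound[OF i3])
    have "(U y)\<^sup>2 \<le> 2 * (s y * partial_deriv i \<eta> y)\<^sup>2 + 2 * (g y * \<eta> y)\<^sup>2" for y
      using square_diff_le[of "U y" 0 "g y * \<eta> y"] by (simp add: U_def)
    then show "AE y in lborel. norm ((U y)\<^sup>2) \<le> norm (2 * (s y * partial_deriv i \<eta> y)\<^sup>2 + 2 * (g y * \<eta> y)\<^sup>2)" by simp
  qed (use m in simp)
qed

text \<open>Test \<open>div(\<phi>\<^sup>2\<nabla>\<sigma>) = 0\<close> with the mollifications of \<open>\<eta>\<sigma>\<close>. Their gradients are the mollifications of
\<open>\<eta>\<nabla>\<sigma> + \<sigma>\<nabla>\<eta>\<close>, and \<open>\<phi>\<^sup>2\<nabla>\<sigma>\<close> is square integrable near their common compact support, so the limit is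
\<open>\<integral> \<phi>\<^sup>2\<nabla>\<sigma> \<bullet> (\<eta>\<nabla>\<sigma> + \<sigma>\<nabla>\<eta>) = 0\<close>.\<close>

theorem div_zero_imp_sigma_div_nonneg:
  fixes \<phi> \<sigma> :: "real^'n::finite \<Rightarrow> real"
  assumes \<phi>: "\<phi> \<in> Linf_loc" and \<sigma>: "\<sigma> \<in> L2_loc" and wg: "weak_gradient \<sigma> G" and dz: "div_zero \<phi> G"
  shows "sigma_div_nonneg \<phi> \<sigma> G"
  unfolding sigma_div_nonneg_def
proof (intro ballI impI)
  fix \<eta> :: "real^'n \<Rightarrow> real" assume \<eta>: "\<eta> \<in> Cc_infinity"
  obtain s g where s: "borel_L2_loc s" and g: "\<And>i. borel_L2_loc (g i)"
    and sae: "AE x in lborel. \<sigma> x = s x" and gae: "AE x in lborel. \<forall>i. G x $ i = g i x"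
    and w: "\<And>\<eta> i. \<eta> \<in> Cc_infinity \<Longrightarrow> (LINT x|lborel. s x * partial_deriv i \<eta> x) = - (LINT x|lborel. g i x * \<eta> x)"
    by (rule weak_gradient_borel_representative[OF \<sigma> wg]) (rule that)
  have "\<phi> \<in> borel_measurable lebesgue" using \<phi> by (simp add: Linf_loc_def)
  from completion_ex_borel_measurable_real[OF this]
  obtain p where p: "p \<in> borel_measurable lborel" and pae: "AE x in lborel. \<phi> x = p x" by blast
  have [measurable]: "p \<in> borel_measurable borel" using p by simp
  have [measurable]: "s \<in> borel_measurable borel" "\<And>i. g i \<in> borel_measurable borel"
    using s g by (simp_all add: borel_L2_loc_def)
  obtain \<rho> :: "nat \<Rightarrow> real^'n \<Rightarrow> real" where \<rho>: "mollifier_sequence \<rho>" using mollifier_sequence_exists by blast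
  have \<rho>C: "\<rho> n \<in> Cc_infinity" for n using \<rho> unfolding mollifier_sequence_def by blast
  define K0 where "K0 = closure {x. \<eta> x \<noteq> 0}"
  have K0: "compact K0" using \<eta> by (simp add: K0_def Cc_infinity_def)
  have \<eta>0: "\<eta> x = 0" if "x \<notin> K0" for x using that unfolding K0_def by (rule Cc_infinity_zero_outside)
  have p\<eta>0: "partial_deriv i \<eta> x = 0" if "x \<notin> K0" for x i
    using that unfolding K0_def by (rule Cc_infinity_partial_deriv(3)[OF \<eta>])
  \<comment> \<open>All mollifications of \<open>\<eta>\<sigma>\<close> are supported in \<open>K\<close>, since the kernels live in the unit ball.\<close>
  define K where "K = {a + b |a b. a \<in> K0 \<and> b \<in> cball (0::real^'n) 1}"
  have K: "compact K" unfolding K_def by (rule compact_sums[OF K0 compact_cball])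
  then have [measurable]: "K \<in> sets borel" by (rule borel_compact)
  have K0K: "x \<in> K" if "x \<in> K0" for x
    unfolding K_def using that by (intro CollectI exI[of _ x] exI[of _ 0]) simp
  obtain C where C: "AE x in lebesgue. x \<in> K \<longrightarrow> \<bar>\<phi> x\<bar> \<le> C" using \<phi> K unfolding Linf_loc_def by blast
  have pC: "AE x in lborel. x \<in> K \<longrightarrow> \<bar>p x\<bar> \<le> C"
    using C[unfolded AE_completion_iff] pae by eventually_elim simp
  define H where "H = (\<lambda>i x. indicator K x * (p x)\<^sup>2 * g i x)"
  have Hm[measurable]: "H i \<in> borel_measurable borel" for i unfolding H_def by measurable
  have Hi: "integrable lborel (\<lambda>x. (H i x)\<^sup>2)" for i
  proof (rule Bochner_Integration.integrable_bound)
    have "integrable lborel (\<lambda>x. indicator K x * (g i x)\<^sup>2)" using g[of i] K by (simp add: borel_L2_loc_def)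
    then show "integrable lborel (\<lambda>x. C ^ 4 * (indicator K x * (g i x)\<^sup>2))" by (rule integrable_mult_right)
    show "AE x in lborel. norm ((H i x)\<^sup>2) \<le> norm (C ^ 4 * (indicator K x * (g i x)\<^sup>2))"
      using pC
    proof eventually_elim
      case (elim x)
      show ?case
      proof (cases "x \<in> K")
        case True
        have "\<bar>p x\<bar> ^ 4 \<le> C ^ 4" using elim True by (intro power_mono) simp_all
        then have "(p x) ^ 4 \<le> C ^ 4" by simp
        then have "(p x) ^ 4 * (g i x)\<^sup>2 \<le> C ^ 4 * (g i x)\<^sup>2" by (intro mult_right_mono) simp_all
        then show ?thesis using True by (simp add: H_def power_mult_distrib)
      next
        case False then show ?thesis by (simp add: H_def)
      qed
    qed
  qed simp
  define U where "U = (\<lambda>i y. s y * partial_deriv i \<eta> y + g i y * \<eta> y)"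
  have Um: "U i \<in> borel_measurable borel" "integrable lborel (U i)" "integrable lborel (\<lambda>y. (U i y)\<^sup>2)" for i
    unfolding U_def by (rule test_gradient_integrable[OF s g \<eta>])+
  note convolution = conv_weak_convergence[OF Um Hm Hi \<rho>]
  define u where "u = (\<lambda>y. s y * \<eta> y)"
  have u: "integrable lborel u" unfolding u_def by (rule borel_L2_loc_times_test(1)[OF s \<eta>])
  have u0: "u x = 0" if "x \<notin> K0" for x using \<eta>0[OF that] by (simp add: u_def)
  have vC: "convolution u (\<rho> n) \<in> Cc_infinity" for n
    by (rule conv_Cc_infinity(1)[OF u K0 _ \<rho>C]) (rule u0)
  have vp: "partial_deriv i (convolution u (\<rho> n)) x = convolution (U i) (\<rho> n) x" for i n x
    unfolding u_def U_def by (rule partial_deriv_conv_weak[OF s g w \<eta> \<rho>C])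
  have vK: "convolution (U i) (\<rho> n) x = 0" if "x \<notin> K" for i n x
  proof (rule conv_eq_0[OF \<rho>], intro AE_I2 impI)
    fix y assume y: "norm (x - y) < 1"
    have "y \<notin> K0"
    proof
      assume "y \<in> K0"
      then have "x \<in> K" unfolding K_def using y by (intro CollectI exI[of _ y] exI[of _ "x - y"]) simp
      with that show False by simp
    qed
    then show "U i y = 0" by (simp add: U_def \<eta>0 p\<eta>0)
  qed
  have zero: "(\<Sum>i\<in>UNIV. LINT x|lborel. H i x * convolution (U i) (\<rho> n) x) = 0" for n
  proof -
    have "(LINT x|lebesgue. (\<phi> x)\<^sup>2 * (G x \<bullet> grad (convolution u (\<rho> n)) x)) = 0"
      using dz vC unfolding div_zero_def by blast
    moreover have "(LINT x|lebesgue. (\<phi> x)\<^sup>2 * (G x \<bullet> grad (convolution u (\<rho> n)) x))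
        = (LINT x|lborel. (\<Sum>i\<in>UNIV. H i x * convolution (U i) (\<rho> n) x))"
    proof (rule lebesgue_integral_borel_representative(1))
      have "(\<lambda>x. H i x * convolution (U i) (\<rho> n) x) \<in> borel_measurable borel" for i
        using borel_measurable_integrable[OF convolution(2)] by simp
      then show "(\<lambda>x. \<Sum>i\<in>UNIV. H i x * convolution (U i) (\<rho> n) x) \<in> borel_measurable borel"
        by (intro borel_measurable_sum)
      show "AE x in lborel. (\<phi> x)\<^sup>2 * (G x \<bullet> grad (convolution u (\<rho> n)) x) = (\<Sum>i\<in>UNIV. H i x * convolution (U i) (\<rho> n) x)"
        using pae gae
      proof eventually_elim
        case (elim x)
        have "(\<phi> x)\<^sup>2 * (G x \<bullet> grad (convolution u (\<rho> n)) x) = (\<Sum>i\<in>UNIV. (p x)\<^sup>2 * (g i x * convolution (U i) (\<rho> n) x))"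
          using elim by (simp add: inner_vec_def grad_def vp sum_distrib_left)
        also have "\<dots> = (\<Sum>i\<in>UNIV. H i x * convolution (U i) (\<rho> n) x)"
          by (rule sum.cong[OF refl], cases "x \<in> K") (simp_all add: H_def vK)
        finally show ?case .
      qed
    qed
    moreover have "(LINT x|lborel. (\<Sum>i\<in>UNIV. H i x * convolution (U i) (\<rho> n) x)) = (\<Sum>i\<in>UNIV. LINT x|lborel. H i x * convolution (U i) (\<rho> n) x)"
      by (rule Bochner_Integration.integral_sum) (rule convolution(2))
    ultimately show ?thesis by simp
  qed
  have "(\<lambda>n. \<Sum>i\<in>UNIV. LINT x|lborel. H i x * convolution (U i) (\<rho> n) x) \<longlonglongrightarrow> (\<Sum>i\<in>UNIV. LINT x|lborel. H i x * U i x)"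
    by (rule tendsto_sum) (rule convolution(3))
  then have z: "(\<Sum>i\<in>UNIV. LINT x|lborel. H i x * U i x) = 0"
    unfolding zero by (simp add: LIMSEQ_const_iff)
  have "(LINT x|lebesgue. \<eta> x * (\<phi> x)\<^sup>2 * (norm (G x))\<^sup>2 + (\<phi> x)\<^sup>2 * \<sigma> x * (G x \<bullet> grad \<eta> x))
      = (LINT x|lborel. (\<Sum>i\<in>UNIV. H i x * U i x))"
  proof (rule lebesgue_integral_borel_representative(1))
    show "(\<lambda>x. \<Sum>i\<in>UNIV. H i x * U i x) \<in> borel_measurable borel"
      using Um(1) by (intro borel_measurable_sum borel_measurable_times Hm)
    show "AE x in lborel. \<eta> x * (\<phi> x)\<^sup>2 * (norm (G x))\<^sup>2 + (\<phi> x)\<^sup>2 * \<sigma> x * (G x \<bullet> grad \<eta> x) = (\<Sum>i\<in>UNIV. H i x * U i x)"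
      using pae gae sae
    proof eventually_elim
      case (elim x)
      have "(norm (G x))\<^sup>2 = (\<Sum>i\<in>UNIV. g i x * g i x)"
        unfolding power2_norm_eq_inner inner_vec_def using elim(2) by simp
      moreover have "G x \<bullet> grad \<eta> x = (\<Sum>i\<in>UNIV. g i x * partial_deriv i \<eta> x)"
        unfolding inner_vec_def grad_def using elim(2) by simp
      ultimately have "\<eta> x * (\<phi> x)\<^sup>2 * (norm (G x))\<^sup>2 + (\<phi> x)\<^sup>2 * \<sigma> x * (G x \<bullet> grad \<eta> x)
         = (\<Sum>i\<in>UNIV. (p x)\<^sup>2 * (g i x * U i x))"
        using elim(1,3) by (simp add: U_def sum_distrib_left sum.distrib[symmetric] algebra_simps)
      also have "\<dots> = (\<Sum>i\<in>UNIV. H i x * U i x)"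
      proof (rule sum.cong[OF refl])
        fix i
        show "(p x)\<^sup>2 * (g i x * U i x) = H i x * U i x"
        proof (cases "x \<in> K")
          case False
          then have "x \<notin> K0" using K0K by blast
          then have "U i x = 0" by (simp add: U_def \<eta>0 p\<eta>0)
          then show ?thesis by simp
        qed (simp add: H_def)
      qed
      finally show ?case .
    qed
  qed
  also have "\<dots> = (\<Sum>i\<in>UNIV. LINT x|lborel. H i x * U i x)"
    by (rule Bochner_Integration.integral_sum) (rule convolution(1))
  finally show "(LINT x|lebesgue. \<eta> x * (\<phi> x)\<^sup>2 * (norm (G x))\<^sup>2 + (\<phi> x)\<^sup>2 * \<sigma> x * (G x \<bullet> grad \<eta> x)) \<le> 0"
    unfolding z by simp
qed

text \<open>Apply the assumption to the parts of \<open>B\<close> where \<open>s\<close> exceeds \<open>c\<close> and where it stays below \<open>c\<close>.\<close>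

lemma AE_const_if_averages_const:
  fixes s :: "'a::euclidean_space \<Rightarrow> real"
  assumes [measurable]: "s \<in> borel_measurable borel" "B \<in> sets borel"
    and fin: "emeasure lborel B < \<infinity>" and int: "integrable lborel (\<lambda>x. indicator B x * s x)"
    and avg: "\<And>A. A \<in> sets borel \<Longrightarrow> A \<subseteq> B \<Longrightarrow> (LINT x|lborel. indicator A x * s x) = c * measure lborel A"
  shows "AE x in lborel. x \<in> B \<longrightarrow> s x = c"
proof -
  have one: "AE x in lborel. indicator A x * (s x - c) = 0"
    if A[measurable]: "A \<in> sets borel" and AB: "A \<subseteq> B" and sgn: "\<And>x. 0 \<le> e * (indicator A x * (s x - c))" and e: "e \<noteq> 0" for A and e :: real
  proof -
    have Af: "emeasure lborel A < \<infinity>" using emeasure_mono[OF AB, of lborel] fin by (simp add: le_less_trans)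
    have i1: "integrable lborel (\<lambda>x. indicator A x * s x)"
    proof (rule Bochner_Integration.integrable_bound[OF int])
      show "AE x in lborel. norm (indicator A x * s x) \<le> norm (indicator B x * s x)"
        using AB by (intro AE_I2) (auto simp: indicator_def)
    qed simp
    have i2: "integrable lborel (\<lambda>x. indicator A x * c)" using Af by simp
    have i: "integrable lborel (\<lambda>x. e * (indicator A x * (s x - c)))"
      unfolding right_diff_distrib using i1 i2 by simp
    have "(LINT x|lborel. e * (indicator A x * (s x - c))) = e * ((LINT x|lborel. indicator A x * s x) - (LINT x|lborel. indicator A x * c))"
      unfolding right_diff_distrib[of "indicator A _"] using i1 i2 by simp
    also have "\<dots> = 0" unfolding avg[OF A AB] by simp
    finally have "(LINT x|lborel. e * (indicator A x * (s x - c))) = 0" .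
    then have "AE x in lborel. e * (indicator A x * (s x - c)) = 0"
      using integral_nonneg_eq_0_iff_AE[OF i] sgn by simp
    then show ?thesis using e by simp
  qed
  have "AE x in lborel. indicator {x \<in> B. s x > c} x * (s x - c) = 0"
    by (rule one[where e = 1]) (measurable, auto simp: indicator_def)
  moreover have "AE x in lborel. indicator {x \<in> B. s x < c} x * (s x - c) = 0"
    by (rule one[where e = "-1"]) (measurable, auto simp: indicator_def)
  ultimately show ?thesis
  proof eventually_elim
    case (elim x)
    then show ?case by (cases "s x" c rule: linorder_cases) (simp_all add: indicator_def)
  qed
qed

text \<open>On a ball the mollifications of \<open>\<sigma>\<close>, cut off outside a larger ball, have zero gradient and are constants \<open>c\<^sub>n\<close>. Weak convergence,
tested with the indicator of the ball, shows that \<open>c\<^sub>n\<close> converges, and tested with indicators of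
subsets it shows that the limit is the average of \<open>\<sigma>\<close> over each of them.\<close>

theorem weak_gradient_zero_imp_const:
  fixes \<sigma> :: "real^'n::finite \<Rightarrow> real"
  assumes \<sigma>: "\<sigma> \<in> L2_loc" and wg: "weak_gradient \<sigma> G" and G0: "AE x in lebesgue. G x = 0"
  shows "\<exists>c. AE x in lebesgue. \<sigma> x = c"
proof -
  obtain s g where s: "borel_L2_loc s" and g: "\<And>i. borel_L2_loc (g i)"
    and sae: "AE x in lborel. \<sigma> x = s x" and gae: "AE x in lborel. \<forall>i. G x $ i = g i x"
    and w: "\<And>\<eta> i. \<eta> \<in> Cc_infinity \<Longrightarrow> (LINT x|lborel. s x * partial_deriv i \<eta> x) = - (LINT x|lborel. g i x * \<eta> x)"
    by (rule weak_gradient_borel_representative[OF \<sigma> wg]) (rule that)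
  have g0: "AE x in lborel. \<forall>i. g i x = 0"
    using gae G0[unfolded AE_completion_iff] by eventually_elim (metis zero_index)
  have sm[measurable]: "s \<in> borel_measurable borel" using s by (simp add: borel_L2_loc_def)
  obtain \<rho> :: "nat \<Rightarrow> real^'n \<Rightarrow> real" where \<rho>: "mollifier_sequence \<rho>" using mollifier_sequence_exists by blast
  have \<rho>C: "\<rho> n \<in> Cc_infinity" for n using \<rho> unfolding mollifier_sequence_def by blast
  have local_const: "\<exists>c. AE x in lborel. x \<in> ball 0 (real m) \<longrightarrow> s x = c" if m: "m > 0" for m
  proof -
    let ?B = "ball (0::real^'n) (real m)"
    have "\<exists>C. \<exists>\<eta> :: real^'n \<Rightarrow> real. radial_cutoff C (real m + 1) (real m + 2) \<eta>"
    proof (rule radial_cutoff_exists)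
      fix C assume ex: "\<And>r R. 0 \<le> r \<Longrightarrow> r < R \<Longrightarrow> \<exists>\<eta> :: real^'n \<Rightarrow> real. radial_cutoff C r R \<eta>"
      have "\<exists>\<eta> :: real^'n \<Rightarrow> real. radial_cutoff C (real m + 1) (real m + 2) \<eta>" by (rule ex) simp_all
      then show ?thesis by blast
    qed
    then obtain \<eta> :: "real^'n \<Rightarrow> real" where \<eta>: "\<eta> \<in> Cc_infinity"
      and \<eta>1: "\<And>x. norm x \<le> real m + 1 \<Longrightarrow> \<eta> x = 1" and \<eta>g: "\<And>x. norm x \<le> real m + 1 \<Longrightarrow> grad \<eta> x = 0"
      unfolding radial_cutoff_def by blast
    have \<eta>p: "partial_deriv i \<eta> x = 0" if "norm x \<le> real m + 1" for i x
    proof -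
      have "grad \<eta> x $ i = 0" using \<eta>g[OF that] by simp
      then show ?thesis by (simp add: grad_def)
    qed
    define K0 where "K0 = closure {x. \<eta> x \<noteq> 0}"
    have K0: "compact K0" using \<eta> by (simp add: K0_def Cc_infinity_def)
    define u where "u = (\<lambda>y. s y * \<eta> y)"
    have u: "integrable lborel u" "integrable lborel (\<lambda>x. (u x)\<^sup>2)"
      unfolding u_def by (rule borel_L2_loc_times_test[OF s \<eta>])+
    have um: "u \<in> borel_measurable borel" using borel_measurable_integrable[OF u(1)] by simp
    have u0: "u x = 0" if "x \<notin> K0" for x
      using that Cc_infinity_zero_outside[of x \<eta>] unfolding K0_def u_def by simp
    have vp: "partial_deriv i (convolution u (\<rho> n)) x = 0" if x: "x \<in> ?B" for i n x
    proof -
      have "partial_deriv i (convolution u (\<rho> n)) x = convolution (\<lambda>y. s y * partial_deriv i \<eta> y + g i y * \<eta> y) (\<rho> n) x"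
        unfolding u_def by (rule partial_deriv_conv_weak[OF s g w \<eta> \<rho>C])
      also have "\<dots> = 0"
      proof (rule conv_eq_0[OF \<rho>])
        show "AE y in lborel. norm (x - y) < 1 \<longrightarrow> s y * partial_deriv i \<eta> y + g i y * \<eta> y = 0"
          using g0
        proof eventually_elim
          case (elim y)
          have "norm y \<le> norm x + norm (x - y)" by (rule norm_triangle_sub[of y x, unfolded norm_minus_commute[of y x]])
          then have "norm y \<le> real m + 1" if "norm (x - y) < 1" using x that by simp
          then show ?case using elim \<eta>p by simp
        qed
      qed
      finally show ?thesis .
    qed
    have "\<exists>c. \<forall>x\<in>?B. convolution u (\<rho> n) x = c" for n
    proof (rule has_derivative_zero_constant)
      fix x assume x: "x \<in> ?B"
      have "grad (convolution u (\<rho> n)) x = 0" using vp[OF x] by (simp add: grad_def vec_eq_iff)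
      moreover have "(convolution u (\<rho> n) has_derivative (\<lambda>v. grad (convolution u (\<rho> n)) x \<bullet> v)) (at x)"
        by (rule Cc_infinity_has_derivative[OF conv_Cc_infinity(1)[OF u(1) K0 _ \<rho>C]]) (rule u0)
      ultimately have "(convolution u (\<rho> n) has_derivative (\<lambda>v. 0)) (at x)" by simp
      then show "(convolution u (\<rho> n) has_derivative (\<lambda>v. 0)) (at x within ?B)" by (rule has_derivative_at_withinI)
    qed (rule convex_ball)
    then have "\<forall>n. \<exists>c. \<forall>x\<in>?B. convolution u (\<rho> n) x = c" by blast
    from choice[OF this] obtain c where c: "\<And>n x. x \<in> ?B \<Longrightarrow> convolution u (\<rho> n) x = c n" by blast
    have Bf: "emeasure lborel ?B < \<infinity>" by (rule emeasure_bounded_finite) simp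
    have lim: "(\<lambda>n. c n * measure lborel A) \<longlonglongrightarrow> (LINT x|lborel. indicator A x * s x)"
      if A[measurable]: "A \<in> sets borel" and AB: "A \<subseteq> ?B" for A
    proof -
      have Af: "emeasure lborel A < \<infinity>" using emeasure_mono[OF AB, of lborel] Bf by (simp add: le_less_trans)
      have "(indicator A x :: real)\<^sup>2 = indicator A x" for x by (simp add: indicator_def)
      then have i: "integrable lborel (\<lambda>x. (indicator A x :: real)\<^sup>2)" using Af by simp
      have "(\<lambda>n. LINT x|lborel. indicator A x * convolution u (\<rho> n) x) \<longlonglongrightarrow> (LINT x|lborel. indicator A x * u x)"
        by (rule conv_weak_convergence(3)[OF um u _ i \<rho>]) simp
      moreover have "(LINT x|lborel. indicator A x * convolution u (\<rho> n) x) = c n * measure lborel A" for n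
      proof -
        have "(\<lambda>x. indicator A x * convolution u (\<rho> n) x) = (\<lambda>x. c n * indicator A x)"
          using c AB by (auto simp: indicator_def fun_eq_iff)
        then show ?thesis by simp
      qed
      moreover have "(LINT x|lborel. indicator A x * u x) = (LINT x|lborel. indicator A x * s x)"
      proof -
        have "(\<lambda>x. indicator A x * u x) = (\<lambda>x. indicator A x * s x)"
        proof
          show "indicator A x * u x = indicator A x * s x" for x
            using \<eta>1[of x] AB by (cases "x \<in> A") (auto simp: u_def)
        qed
        then show ?thesis by simp
      qed
      ultimately show ?thesis by simp
    qed
    define M where "M = measure lborel ?B"
    have M: "M > 0" unfolding M_def using m content_ball_pos[of "real m" "0::real^'n"] by simp
    define cc where "cc = (LINT x|lborel. indicator ?B x * s x) / M"
    have "(\<lambda>n. c n * M / M) \<longlonglongrightarrow> cc"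
      unfolding cc_def M_def by (intro tendsto_divide lim tendsto_const) (use M in \<open>simp_all add: M_def\<close>)
    then have ccl: "c \<longlonglongrightarrow> cc" using M by simp
    have "AE x in lborel. x \<in> ?B \<longrightarrow> s x = cc"
    proof (rule AE_const_if_averages_const[OF sm _ Bf])
      show "integrable lborel (\<lambda>x. indicator ?B x * s x)"
      proof (rule Bochner_Integration.integrable_bound[OF u(1)])
        have "indicator ?B x * s x = indicator ?B x * u x" for x
          using \<eta>1[of x] by (cases "x \<in> ?B") (simp_all add: u_def)
        then show "AE x in lborel. norm (indicator ?B x * s x) \<le> norm (u x)"
          by (intro AE_I2) (simp add: indicator_def)
        have [measurable]: "?B \<in> sets borel" by simp
        show "(\<lambda>x. indicator ?B x * s x) \<in> borel_measurable lborel" by measurable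
      qed
      fix A :: "(real^'n) set" assume A: "A \<in> sets borel" "A \<subseteq> ?B"
      have "(\<lambda>n. c n * measure lborel A) \<longlonglongrightarrow> cc * measure lborel A" by (intro tendsto_mult ccl tendsto_const)
      with lim[OF A] show "(LINT x|lborel. indicator A x * s x) = cc * measure lborel A"
        by (rule LIMSEQ_unique)
    qed simp
    then show ?thesis by blast
  qed
  then have "\<forall>m. \<exists>c. AE x in lborel. x \<in> ball 0 (real (Suc m)) \<longrightarrow> s x = c" by blast
  from choice[OF this] obtain c where c: "\<And>m. AE x in lborel. x \<in> ball 0 (real (Suc m)) \<longrightarrow> s x = c m" by blast
  have cm: "c m = c 0" for m
  proof (rule ccontr)
    assume ne: "c m \<noteq> c 0"
    have "AE x in lborel. x \<notin> ball (0::real^'n) 1"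
      using c[of m] c[of 0]
    proof eventually_elim
      case (elim x)
      show ?case
      proof
        assume x: "x \<in> ball 0 1"
        then have "x \<in> ball 0 (real (Suc m))" "x \<in> ball 0 (real (Suc 0))" by simp_all
        with elim ne show False by simp
      qed
    qed
    then have "AE x in lebesgue. x \<notin> ball (0::real^'n) 1" by (rule AE_completion)
    then have "ball (0::real^'n) 1 \<in> null_sets lebesgue" by (subst AE_iff_null_sets) simp_all
    then have "negligible (ball (0::real^'n) 1)" by (simp add: negligible_iff_null_sets)
    then have "ball (0::real^'n) 1 = {}" using open_not_negligible open_ball by blast
    then show False by simp
  qed
  have "AE x in lborel. \<forall>m. x \<in> ball 0 (real (Suc m)) \<longrightarrow> s x = c 0"
    unfolding AE_all_countable
  proof
    show "AE x in lborel. x \<in> ball 0 (real (Suc m)) \<longrightarrow> s x = c 0" for m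
      using c[of m] unfolding cm[of m] .
  qed
  then have "AE x in lborel. \<sigma> x = c 0"
    using sae
  proof eventually_elim
    case (elim x)
    obtain m where "norm x < real m" using reals_Archimedean2 by blast
    then have "x \<in> ball 0 (real (Suc m))" by simp
    then have "s x = c 0" using elim(1) by blast
    then show ?case using elim(2) by simp
  qed
  then have "AE x in lebesgue. \<sigma> x = c 0" by (rule AE_completion)
  then show ?thesis ..
qed

section \<open>Admissible functions from a growth inequality\<close>

text \<open>The interpolating function has slope \<open>s k\<close> on \<open>[P k, P (k + 1)]\<close>. It is written as a sum of clamped linear
functions, of which only finitely many are nonzero at each point, so that continuity and monotonicity are
inherited from the summands.\<close>

lemma piecewise_linear_admissible:
  fixes P s :: "nat \<Rightarrow> real" and \<Psi> :: "real \<Rightarrow> real"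
  assumes P0: "P 0 = 1" and P: "\<And>k. P k < P (Suc k)" and unb: "\<And>x. \<exists>n. x < P n"
    and s: "\<And>k. 0 < s k" and sum: "summable (\<lambda>k. (P (Suc k) - P k) / s k)"
    and bound: "\<And>k r. P k \<le> r \<Longrightarrow> r \<le> P (Suc k) \<Longrightarrow> (\<Sum>j<Suc k. s j * (P (Suc j) - P j)) \<le> \<Psi> r"
  shows "\<exists>h. continuous_on {1..} h \<and> mono_on {1..} h \<and> (\<forall>r\<ge>1. 0 \<le> h r \<and> h r \<le> \<Psi> r)
     \<and> integral_recip_deriv h \<noteq> \<infinity>"
proof -
  have sm: "strict_mono P" using P by (simp add: strict_mono_Suc_iff)
  have Pmono: "P i \<le> P j" if "i \<le> j" for i j using that strict_mono_less_eq[OF sm] by simp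
  define H where "H = (\<lambda>n x. \<Sum>k<n. s k * max 0 (min x (P (Suc k)) - P k))"
  have Hext: "H m x = H n x" if "x \<le> P n" "n \<le> m" for m n x
    unfolding H_def
  proof (rule sum.mono_neutral_right)
    show "\<forall>k\<in>{..<m} - {..<n}. s k * max 0 (min x (P (Suc k)) - P k) = 0"
    proof
      fix k assume "k \<in> {..<m} - {..<n}"
      then have "P n \<le> P k" by (intro Pmono) simp
      then show "s k * max 0 (min x (P (Suc k)) - P k) = 0" using that(1) by simp
    qed
  qed (use that(2) in auto)
  have Hext': "H m x = H n x" if "x \<le> P n" "x \<le> P m" for m n x
    using Hext[of x n m] Hext[of x m n] that by (cases "n \<le> m") simp_all
  define h where "h = (\<lambda>x. H (SOME n. x < P n) x)"
  have hH: "h x = H n x" if "x \<le> P n" for n x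
    unfolding h_def by (rule Hext'[OF that]) (use someI_ex[OF unb[of x]] in simp)
  have Hc: "continuous_on UNIV (H n)" for n unfolding H_def by (intro continuous_intros)
  have hc: "isCont h x" for x
  proof -
    obtain n where n: "x < P n" using unb by blast
    have "isCont (H n) x" using Hc[of n] by (simp add: continuous_on_eq_continuous_at)
    moreover have "\<forall>\<^sub>F y in nhds x. h y = H n y"
      using eventually_nhds_in_open[OF open_lessThan, of x "P n"] n
      by (auto elim!: eventually_mono intro!: hH)
    ultimately show ?thesis by (simp add: isCont_cong)
  qed
  have Hmono: "H n x \<le> H n y" if "x \<le> y" for n x y
    unfolding H_def using that s by (intro sum_mono mult_left_mono) (auto simp: less_imp_le)
  have hmono: "h x \<le> h y" if "x \<le> y" for x y
  proof -
    obtain n where n: "y < P n" using unb by blast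
    have "h x = H n x" "h y = H n y" using n that by (intro hH; simp)+
    then show ?thesis using Hmono[OF that] by simp
  qed
  have h0: "0 \<le> h x" for x
  proof -
    obtain n where n: "x < P n" using unb by blast
    have "0 \<le> H n x" unfolding H_def using s by (intro sum_nonneg mult_nonneg_nonneg) (simp_all add: less_imp_le)
    then show ?thesis using hH[of x n] n by simp
  qed
  have loc: "\<exists>k. P k \<le> x \<and> x < P (Suc k)" if "1 \<le> x" for x
  proof -
    define m where "m = (LEAST n. x < P n)"
    have m: "x < P m" unfolding m_def by (rule LeastI_ex[OF unb])
    have "m \<noteq> 0" using m that P0 by (intro notI) simp
    then obtain k where k: "m = Suc k" using not0_implies_Suc by blast
    have "\<not> x < P k" using not_less_Least[of k "\<lambda>n. x < P n"] k unfolding m_def by simp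
    then show ?thesis using m k by (intro exI[of _ k]) simp
  qed
  have hb: "h x \<le> \<Psi> x" if x1: "1 \<le> x" for x
  proof -
    obtain k where k: "P k \<le> x" "x < P (Suc k)" using loc[OF x1] by blast
    have "h x = H (Suc k) x" using k by (intro hH) simp
    also have "\<dots> \<le> (\<Sum>j<Suc k. s j * (P (Suc j) - P j))"
      unfolding H_def
    proof (intro sum_mono mult_left_mono)
      fix j show "max 0 (min x (P (Suc j)) - P j) \<le> P (Suc j) - P j" using P[of j] by simp
      show "0 \<le> s j" using s[of j] by simp
    qed
    also have "\<dots> \<le> \<Psi> x" using k by (intro bound) simp_all
    finally show ?thesis .
  qed
  have der: "deriv h x = s k" if x: "P k < x" "x < P (Suc k)" for x k
  proof (rule DERIV_imp_deriv)
    define c where "c = (\<Sum>j<k. s j * (P (Suc j) - P j))"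
    have lin: "h y = c + s k * (y - P k)" if y: "P k < y" "y < P (Suc k)" for y
    proof -
      have "h y = H (Suc k) y" using y by (intro hH) simp
      also have "\<dots> = (\<Sum>j<k. s j * max 0 (min y (P (Suc j)) - P j)) + s k * (y - P k)"
        using y by (simp add: H_def)
      also have "(\<Sum>j<k. s j * max 0 (min y (P (Suc j)) - P j)) = c"
        unfolding c_def
      proof (rule sum.cong[OF refl])
        fix j assume "j \<in> {..<k}"
        then have "P (Suc j) \<le> y" using Pmono[of "Suc j" k] y by simp
        then show "s j * max 0 (min y (P (Suc j)) - P j) = s j * (P (Suc j) - P j)"
          using P[of j] by simp
      qed
      finally show ?thesis .
    qed
    have "((\<lambda>y. c + s k * (y - P k)) has_real_derivative s k) (at x)"
      by (auto intro!: derivative_eq_intros)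
    moreover have "\<forall>\<^sub>F y in nhds x. h y = c + s k * (y - P k)"
      using eventually_nhds_in_open[of "{P k<..<P (Suc k)}" x] x
      by (auto elim!: eventually_mono intro!: lin)
    ultimately show "(h has_real_derivative s k) (at x)" by (subst DERIV_cong_ev[OF refl _ refl])
  qed
  have "integral_recip_deriv h \<le> (\<Sum>k. ennreal ((P (Suc k) - P k) / s k))"
  proof -
    have "AE x in lborel. x \<notin> range P"
      by (rule AE_not_in) (intro countable_imp_null_set_lborel, simp)
    then have "AE x in lborel. 1 / ennreal (deriv h x) * indicator {1..} x
        \<le> (\<Sum>k. ennreal (1 / s k) * indicator {P k<..<P (Suc k)} x)"
    proof eventually_elim
      case (elim x)
      show ?case
      proof (cases "1 \<le> x")
        case True
        obtain k where k: "P k \<le> x" "x < P (Suc k)" using loc[OF True] by blast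
        have kx: "P k < x" using k(1) elim by (metis le_less rangeI)
        define f where "f = (\<lambda>k. ennreal (1 / s k) * indicator {P k<..<P (Suc k)} x)"
        have "1 / ennreal (deriv h x) * indicator {1..} x = f k"
          using True kx k(2) s[of k] der[OF kx k(2)] by (simp add: f_def divide_ennreal[symmetric])
        also have "\<dots> \<le> suminf f" using sum_le_suminf[of f "{k}"] by simp
        finally show ?thesis by (simp only: f_def)
      qed simp
    qed
    then have "integral_recip_deriv h \<le> (\<integral>\<^sup>+x. (\<Sum>k. ennreal (1 / s k) * indicator {P k<..<P (Suc k)} x) \<partial>lborel)"
      unfolding integral_recip_deriv_def nn_integral_completion by (rule nn_integral_mono_AE)
    also have "\<dots> = (\<Sum>k. \<integral>\<^sup>+x. ennreal (1 / s k) * indicator {P k<..<P (Suc k)} x \<partial>lborel)"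
      by (rule nn_integral_suminf) simp
    also have "\<dots> = (\<Sum>k. ennreal ((P (Suc k) - P k) / s k))"
    proof (rule suminf_cong)
      fix k
      have "(\<integral>\<^sup>+x. ennreal (1 / s k) * indicator {P k<..<P (Suc k)} x \<partial>lborel) = ennreal (1 / s k) * ennreal (P (Suc k) - P k)"
        using P[of k] by (subst nn_integral_cmult_indicator) simp_all
      also have "\<dots> = ennreal ((P (Suc k) - P k) / s k)"
        using P[of k] s[of k] by (simp add: ennreal_mult[symmetric])
      finally show "(\<integral>\<^sup>+x. ennreal (1 / s k) * indicator {P k<..<P (Suc k)} x \<partial>lborel) = ennreal ((P (Suc k) - P k) / s k)" .
    qed
    finally show ?thesis .
  qed
  also have "\<dots> < \<infinity>"
  proof -
    have "0 \<le> (P (Suc k) - P k) / s k" for k using P[of k] s[of k] by simp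
    then show ?thesis using sum by (subst suminf_ennreal2) simp_all
  qed
  finally have "integral_recip_deriv h \<noteq> \<infinity>" by simp
  moreover have "continuous_on {1..} h" by (intro continuous_at_imp_continuous_on ballI hc)
  moreover have "mono_on {1..} h" by (intro mono_onI hmono)
  ultimately show ?thesis using h0 hb by (intro exI[of _ h]) simp
qed

lemma level_sequence:
  fixes E :: "real \<Rightarrow> real"
  assumes cont: "continuous_on {a..} E" and grow: "\<And>x y. a \<le> x \<Longrightarrow> x \<le> y \<Longrightarrow> y - x \<le> E y - E x"
  obtains R where "R 0 = a" "\<And>k. R k < R (Suc k)" "\<And>k. a \<le> R k" "\<And>x. \<exists>n. x < R n" "\<And>k. E (R (Suc k)) - E (R k) = ln 2"
proof -
  have "\<exists>r\<ge>a. E r = E a + real k * ln 2" for k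
  proof -
    define b where "b = a + real k * ln 2"
    have b: "a \<le> b" by (simp add: b_def)
    have "E a + real k * ln 2 \<le> E b" using grow[OF order_refl b] by (simp add: b_def)
    moreover have "continuous_on {a..b} E" using cont by (rule continuous_on_subset) simp
    ultimately show ?thesis using IVT'[of E a "E a + real k * ln 2" b] b by auto
  qed
  then obtain R where R: "\<And>k. a \<le> R k" "\<And>k. E (R k) = E a + real k * ln 2" by metis
  have inj: "x < y" if "a \<le> x" "a \<le> y" "E x < E y" for x y
    using grow[of y x] that by (cases "x < y") auto
  show ?thesis
  proof (rule that[of R])
    show "R 0 = a" using grow[OF order_refl R(1), of 0] R(1)[of 0] R(2)[of 0] by simp
    show "R k < R (Suc k)" for k by (rule inj[OF R(1) R(1)]) (simp add: R(2))
    show "a \<le> R k" for k by (rule R(1))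
    show "\<exists>n. x < R n" for x
    proof -
      obtain n where n: "(E (max a x) - E a) / ln 2 < real n" using reals_Archimedean2 by blast
      then have "E (max a x) < E (R n)" by (simp add: R(2) divide_less_eq algebra_simps)
      then have "max a x < R n" by (rule inj[OF max.cobounded1 R(1)])
      then show ?thesis by (intro exI[of _ n]) simp
    qed
    show "E (R (Suc k)) - E (R k) = ln 2" for k by (simp add: R(2) algebra_simps)
  qed
qed

text \<open>The grid consists of level points of \<open>E(x) = x + ln h(x) + ln D(x)\<close>, spaced by \<open>ln 2\<close>: each of the three
summands is nondecreasing, so \<open>h\<close> and \<open>D\<close> at most double from one grid point to the next, and the first
summand makes the grid unbounded. On an interval of length \<open>\<delta>\<close> the slope is half the slope of \<open>h\<close>, which keeps
the interpolation below \<open>h\<close> since \<open>h\<close> at most doubles. The reciprocal slope then contributes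
\<open>2\<delta>\<^sup>2/\<Delta>h \<le> 2C \<Delta>D/D\<^sup>2 \<le> - 4C \<Delta>(1/D)\<close>, which telescopes. On the initial interval,
where \<open>D\<close> may vanish, a small constant slope is used.\<close>

lemma admissible_from_growth:
  fixes h D \<Psi> :: "real \<Rightarrow> real"
  assumes hc: "continuous_on {1..} h" and Dc: "continuous_on {1..} D"
    and hm: "\<And>x y. 1 \<le> x \<Longrightarrow> x \<le> y \<Longrightarrow> h x \<le> h y" and Dm: "\<And>x y. 1 \<le> x \<Longrightarrow> x \<le> y \<Longrightarrow> D x \<le> D y"
    and h0: "\<And>x. 1 \<le> x \<Longrightarrow> 0 \<le> h x"
    and R0: "1 \<le> R0" "0 < D R0"
    and ineq: "\<And>x y. 1 \<le> x \<Longrightarrow> x < y \<Longrightarrow> (D x * (y - x))\<^sup>2 \<le> C * ((h y - h x) * (D y - D x))"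
    and \<Psi>: "continuous_on {1..} \<Psi>" "\<And>R. 1 \<le> R \<Longrightarrow> 0 < \<Psi> R" "\<And>R. 1 \<le> R \<Longrightarrow> h R \<le> \<Psi> R"
  shows "\<exists>h. continuous_on {1..} h \<and> mono_on {1..} h \<and> (\<forall>r\<ge>1. 0 \<le> h r \<and> h r \<le> \<Psi> r)
     \<and> integral_recip_deriv h \<noteq> \<infinity>"
proof -
  have dh: "h x < h y" if x: "1 \<le> x" "x < y" and Dx: "0 < D x" for x y
  proof -
    have "0 < (D x * (y - x))\<^sup>2" using x Dx by simp
    then have "0 < C * ((h y - h x) * (D y - D x))" using ineq[OF x] by linarith
    then have "h y \<noteq> h x" by auto
    then show ?thesis using hm[of x y] x by simp
  qed
  \<comment> \<open>One step beyond \<open>R0\<close> the growth inequality makes \<open>h\<close> positive as well, so that its logarithm is defined.\<close>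
  define a where "a = R0 + 1"
  have a: "1 < a" "0 < h a" "0 < D a"
  proof -
    show "1 < a" using R0 by (simp add: a_def)
    show "0 < h a" using dh[OF R0(1) _ R0(2), of a] h0[OF R0(1)] by (simp add: a_def)
    show "0 < D a" using Dm[OF R0(1), of a] R0(2) by (simp add: a_def)
  qed
  have pos: "0 < h x" "0 < D x" if "a \<le> x" for x
    using hm[of a x] Dm[of a x] a that by simp_all
  define E where "E = (\<lambda>x. x + ln (h x) + ln (D x))"
  have sub: "{a..} \<subseteq> {1..}" using a(1) by auto
  have Ec: "continuous_on {a..} E"
    unfolding E_def using pos
    by (intro continuous_intros continuous_on_subset[OF hc sub] continuous_on_subset[OF Dc sub]) (auto simp: less_imp_neq[symmetric])
  have lnm: "ln (h x) \<le> ln (h y)" "ln (D x) \<le> ln (D y)" if "a \<le> x" "x \<le> y" for x y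
    using that pos[of x] pos[of y] hm[of x y] Dm[of x y] a(1) by simp_all
  have grow: "y - x \<le> E y - E x" if "a \<le> x" "x \<le> y" for x y
    using lnm[OF that] by (simp add: E_def)
  obtain R where R: "R 0 = a" "\<And>k. R k < R (Suc k)" "\<And>k. a \<le> R k" "\<And>x. \<exists>n. x < R n" "\<And>k. E (R (Suc k)) - E (R k) = ln 2"
    by (rule level_sequence[OF Ec grow]) (assumption, assumption, rule that)
  have R1: "1 \<le> R k" for k using R(3)[of k] a(1) by simp
  have dbl: "h (R (Suc k)) \<le> 2 * h (R k)" "D (R (Suc k)) \<le> 2 * D (R k)" for k
  proof -
    have Rk: "R k \<le> R (Suc k)" using R(2)[of k] by simp
    note l = lnm[OF R(3)[of k] Rk]
    have e: "(R (Suc k) - R k) + (ln (h (R (Suc k))) - ln (h (R k))) + (ln (D (R (Suc k))) - ln (D (R k))) = ln 2"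
      using R(5)[of k] by (simp add: E_def)
    have "ln (h (R (Suc k))) \<le> ln 2 + ln (h (R k))" "ln (D (R (Suc k))) \<le> ln 2 + ln (D (R k))"
      using e l Rk by linarith+
    then have "ln (h (R (Suc k))) \<le> ln (2 * h (R k))" "ln (D (R (Suc k))) \<le> ln (2 * D (R k))"
      using pos[OF R(3)[of k]] by (simp_all add: ln_mult)
    then show "h (R (Suc k)) \<le> 2 * h (R k)" "D (R (Suc k)) \<le> 2 * D (R k)"
      using pos[OF R(3)[of k]] pos[OF R(3)[of "Suc k"]] by simp_all
  qed
  define \<delta> where "\<delta> = (\<lambda>k. R (Suc k) - R k)"
  have \<delta>: "\<delta> k > 0" for k using R(2)[of k] by (simp add: \<delta>_def)
  define dH where "dH = (\<lambda>k. h (R (Suc k)) - h (R k))"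
  have dH: "dH k > 0" for k using dh[OF R1 R(2) pos(2)[OF R(3)], of k] by (simp add: dH_def)
  have Cpos: "0 < C"
  proof (rule ccontr)
    assume "\<not> 0 < C"
    moreover have "0 \<le> (h (R 1) - h (R 0)) * (D (R 1) - D (R 0))"
      using hm[OF R1[of 0], of "R 1"] Dm[OF R1[of 0], of "R 1"] R(2)[of 0] by simp
    ultimately have "C * ((h (R 1) - h (R 0)) * (D (R 1) - D (R 0))) \<le> 0" by (simp add: mult_nonpos_nonneg)
    moreover have r01: "R 0 < R 1" using R(2)[of 0] by simp
    moreover have "0 < (D (R 0) * (R 1 - R 0))\<^sup>2" using pos(2)[OF R(3)[of 0]] r01 by simp
    ultimately show False using ineq[OF R1[of 0] r01] by linarith
  qed
  \<comment> \<open>On \<open>[1,a]\<close> the slope \<open>\<epsilon>\<close> must respect \<open>\<Psi>\<close> there, and the total rise must leave room below \<open>h a / 2\<close>.\<close>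
  have "continuous_on {1..a} \<Psi>" using \<Psi>(1) by (rule continuous_on_subset) simp
  then obtain z where z: "z \<in> {1..a}" "\<forall>y\<in>{1..a}. \<Psi> z \<le> \<Psi> y"
    using continuous_attains_inf[of "{1..a}" \<Psi>] a(1) by auto
  define \<epsilon> where "\<epsilon> = min (\<Psi> z) (h a / 2) / (a - 1)"
  have \<epsilon>: "\<epsilon> > 0" "\<epsilon> * (a - 1) \<le> \<Psi> z" "\<epsilon> * (a - 1) \<le> h a / 2"
    using a \<Psi>(2)[of z] z(1) by (simp_all add: \<epsilon>_def)
  define P where "P = case_nat 1 R"
  define s where "s = case_nat \<epsilon> (\<lambda>k. dH k / (2 * \<delta> k))"
  have Ps: "P 0 = 1" "P (Suc k) = R k" "s 0 = \<epsilon>" "s (Suc k) = dH k / (2 * \<delta> k)" for k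
    by (simp_all add: P_def s_def)
  have tel: "(\<Sum>j<Suc k. s j * (P (Suc j) - P j)) = \<epsilon> * (a - 1) + (h (R k) - h a) / 2" for k
  proof (induction k)
    case 0 then show ?case by (simp add: Ps R(1))
  next
    case (Suc k)
    have "s (Suc k) * (P (Suc (Suc k)) - P (Suc k)) = dH k / (2 * \<delta> k) * \<delta> k"
      by (simp only: Ps \<delta>_def)
    also have "\<dots> = (h (R (Suc k)) - h (R k)) / 2" using \<delta>[of k] by (simp add: dH_def)
    finally have e: "s (Suc k) * (P (Suc (Suc k)) - P (Suc k)) = (h (R (Suc k)) - h (R k)) / 2" .
    show ?case unfolding sum.lessThan_Suc[of _ "Suc k"] Suc.IH e by (simp add: field_simps)
  qed
  show ?thesis
  proof (rule piecewise_linear_admissible[of P s])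
    show "P 0 = 1" by (rule Ps)
    show "P k < P (Suc k)" for k using R(2) R(1) a(1) by (cases k) (simp_all add: Ps)
    show "\<exists>n. x < P n" for x using R(4)[of x] Ps(2) by metis
    show "0 < s k" for k using \<epsilon>(1) dH \<delta> by (cases k) (simp_all add: Ps)
    show "summable (\<lambda>k. (P (Suc k) - P k) / s k)"
    proof (subst summable_Suc_iff[symmetric], rule summable_comparison_test')
      have dec: "decseq (\<lambda>k. inverse (D (R k)))"
      proof (rule decseq_SucI)
        show "inverse (D (R (Suc k))) \<le> inverse (D (R k))" for k
          using Dm[OF R1 less_imp_le[OF R(2)], of k] pos(2)[OF R(3)] by (intro le_imp_inverse_le)
      qed
      have "0 \<le> inverse (D (R k))" for k using pos(2)[OF R(3)[of k]] by simp
      then obtain l where "(\<lambda>k. inverse (D (R k))) \<longlonglongrightarrow> l"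
        using decseq_convergent[OF dec, of 0] by blast
      from telescope_summable'[OF this]
      show "summable (\<lambda>k. 4 * C * (inverse (D (R k)) - inverse (D (R (Suc k)))))"
        by (rule summable_mult)
      fix k :: nat
      show "norm ((P (Suc (Suc k)) - P (Suc k)) / s (Suc k)) \<le> 4 * C * (inverse (D (R k)) - inverse (D (R (Suc k))))" 
      proof -
        define d d' where "d = D (R k)" and "d' = D (R (Suc k))"
        have d: "0 < d" "d \<le> d'" "d' \<le> 2 * d"
          using pos(2)[OF R(3)[of k]] Dm[OF R1[of k] less_imp_le[OF R(2)[of k]]] dbl(2)[of k] by (simp_all add: d_def d'_def)
        have "(d * \<delta> k)\<^sup>2 \<le> C * (dH k * (d' - d))"
          using ineq[OF R1 R(2), of k] by (simp add: d_def d'_def \<delta>_def dH_def)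
        then have i: "(\<delta> k)\<^sup>2 / dH k \<le> C * (d' - d) / d\<^sup>2"
          using d(1) dH[of k] by (simp add: power_mult_distrib divide_simps) (simp add: mult_ac)
        have e: "(P (Suc (Suc k)) - P (Suc k)) / s (Suc k) = \<delta> k / (dH k / (2 * \<delta> k))"
          by (simp only: Ps \<delta>_def)
        have "\<delta> k / (dH k / (2 * \<delta> k)) = 2 * ((\<delta> k)\<^sup>2 / dH k)"
          by (simp add: power2_eq_square)
        also have "\<dots> \<le> 2 * (C * (d' - d) / d\<^sup>2)" using i by simp
        also have "\<dots> \<le> 4 * C * (inverse d - inverse d')"
        proof -
          have "(d' - d) / d\<^sup>2 \<le> 2 * ((d' - d) / (d * d'))"
          proof -
            have "d * d' \<le> d * (2 * d)" by (rule mult_left_mono[OF d(3)]) (use d(1) in simp)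
            then have w2: "d * d' \<le> 2 * d\<^sup>2" by (simp only: power2_eq_square mult.left_commute)
            have w1: "0 < d * d'" by (rule mult_pos_pos) (use d(1,2) in linarith)+
            have "(2 * (d' - d)) / (2 * d\<^sup>2) \<le> (2 * (d' - d)) / (d * d')"
              by (rule frac_le[OF _ order_refl w1 w2]) (use d(2) in simp)
            moreover have "(2 * (d' - d)) / (2 * d\<^sup>2) = (d' - d) / d\<^sup>2" by (rule mult_divide_mult_cancel_left) simp
            ultimately show ?thesis by (simp only: times_divide_eq_right)
          qed
          moreover have "(d' - d) / (d * d') = inverse d - inverse d'" using d by (simp add: field_simps)
          ultimately have m: "(d' - d) / d\<^sup>2 \<le> 2 * (inverse d - inverse d')" by (simp only:)
          have "2 * C * ((d' - d) / d\<^sup>2) \<le> 2 * C * (2 * (inverse d - inverse d'))"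
            by (rule mult_left_mono[OF m]) (use Cpos in simp)
          moreover have "2 * (C * (d' - d) / d\<^sup>2) = 2 * C * ((d' - d) / d\<^sup>2)" by simp
          moreover have "2 * C * (2 * (inverse d - inverse d')) = 4 * C * (inverse d - inverse d')" by simp
          ultimately show ?thesis by (simp only:)
        qed
        finally have "(P (Suc (Suc k)) - P (Suc k)) / s (Suc k) \<le> 4 * C * (inverse d - inverse d')" unfolding e .
        moreover have "0 \<le> (P (Suc (Suc k)) - P (Suc k)) / s (Suc k)"
          using \<delta>[of k] dH[of k] unfolding e by simp
        ultimately show ?thesis by (simp add: d_def d'_def)
      qed
    qed
    fix k r assume r: "P k \<le> r" "r \<le> P (Suc k)"
    show "(\<Sum>j<Suc k. s j * (P (Suc j) - P j)) \<le> \<Psi> r"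
    proof (cases k)
      case 0
      have "\<Psi> z \<le> \<Psi> r" using r z(2) R(1) by (simp add: 0 Ps)
      then show ?thesis using \<epsilon>(2) by (simp add: 0 Ps R(1))
    next
      case (Suc l)
      have rl: "R l \<le> r" using r(1) unfolding Suc Ps(2) .
      have "\<epsilon> * (a - 1) + (h (R k) - h a) / 2 \<le> h (R k) / 2" using \<epsilon>(3) by (simp add: field_simps)
      also have "\<dots> \<le> h (R l)" using dbl(1)[of l] unfolding Suc by linarith
      also have "\<dots> \<le> h r" by (rule hm[OF R1 rl])
      also have "\<dots> \<le> \<Psi> r" using rl R1[of l] by (intro \<Psi>(3)) simp
      finally show ?thesis unfolding tel .
    qed
  qed
qed

section \<open>The Caccioppoli inequality and the equivalence\<close>

definition ball_integral :: "('a::euclidean_space \<Rightarrow> real) \<Rightarrow> real \<Rightarrow> real" where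
  "ball_integral f R = (LINT x:ball 0 R|lebesgue. f x)"

text \<open>Continuity in the radius holds because spheres are null sets.\<close>

lemma ball_integral_properties:
  fixes f :: "'a::euclidean_space \<Rightarrow> real"
  assumes int: "\<And>R. set_integrable lebesgue (ball 0 R) f" and nonneg: "\<And>x. 0 \<le> f x"
  shows "0 \<le> ball_integral f R"
    and "r \<le> R \<Longrightarrow> ball_integral f r \<le> ball_integral f R"
    and "r \<le> R \<Longrightarrow> (LINT x|lebesgue. indicator (ball 0 R - ball 0 r) x * f x) = ball_integral f R - ball_integral f r"
    and "integrable lebesgue (\<lambda>x. indicator (ball 0 R - ball 0 r) x * f x)"
    and "continuous_on S (ball_integral f)"
proof -
  have i: "integrable lebesgue (\<lambda>x. indicator (ball 0 R) x * f x)" for R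
    using int[of R] unfolding set_integrable_def by simp
  have m: "ball_integral f R = (LINT x|lebesgue. indicator (ball 0 R) x * f x)" for R
    unfolding ball_integral_def set_lebesgue_integral_def by simp
  show "0 \<le> ball_integral f R" for R unfolding m using nonneg by (intro integral_nonneg_AE) simp
  show mono: "ball_integral f r \<le> ball_integral f R" if "r \<le> R" for r R
    unfolding m
  proof (rule integral_mono[OF i i])
    show "indicator (ball 0 r) x * f x \<le> indicator (ball 0 R) x * f x" for x
      using nonneg[of x] that by (intro mult_right_mono) (auto simp: indicator_def)
  qed
  have d: "indicator (ball 0 R - ball 0 r) x * f x = indicator (ball 0 R) x * f x - indicator (ball 0 r \<inter> ball 0 R) x * f x" for r R x
    by (auto simp: indicator_def)
  have rR: "ball (0::'a) r \<inter> ball 0 R = ball 0 (min r R)" for r R by auto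
  show "(LINT x|lebesgue. indicator (ball 0 R - ball 0 r) x * f x) = ball_integral f R - ball_integral f r" if "r \<le> R"
    unfolding d rR using i that by (simp add: m min_def)
  show "integrable lebesgue (\<lambda>x. indicator (ball 0 R - ball 0 r) x * f x)"
    unfolding d rR by (rule Bochner_Integration.integrable_diff[OF i i])
  have "isCont (ball_integral f) R" for R
    unfolding continuous_at_sequentially o_def
  proof (intro allI impI)
    fix X assume X: "X \<longlonglongrightarrow> R"
    have "sphere (0::'a) R \<in> null_sets lebesgue"
      using negligible_sphere[of "0::'a" R] by (simp add: negligible_iff_null_sets)
    then have ae: "AE x in lebesgue. x \<notin> sphere (0::'a) R" by (rule AE_not_in)
    have "\<forall>\<^sub>F n in sequentially. X n < R + 1" using X by (rule order_tendstoD) simp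
    then obtain N where N: "\<And>n. n \<ge> N \<Longrightarrow> X n < R + 1" unfolding eventually_sequentially by blast
    have "(\<lambda>n. ball_integral f (X (n + N))) \<longlonglongrightarrow> ball_integral f R"
      unfolding m
    proof (rule integral_dominated_convergence[OF _ _ i[of "R + 1"]])
      show "(\<lambda>x. indicator (ball 0 R) x * f x) \<in> borel_measurable lebesgue"
        using i borel_measurable_integrable by blast
      show "(\<lambda>x. indicator (ball 0 (X (n + N))) x * f x) \<in> borel_measurable lebesgue" for n
        using i borel_measurable_integrable by blast
      show "AE x in lebesgue. norm (indicator (ball 0 (X (n + N))) x * f x) \<le> indicator (ball 0 (R + 1)) x * f x" for n
        using N[of "n + N"] nonneg by (intro AE_I2) (auto simp: indicator_def)
      show "AE x in lebesgue. (\<lambda>n. indicator (ball 0 (X (n + N))) x * f x) \<longlonglongrightarrow> indicator (ball 0 R) x * f x"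
        using ae
      proof eventually_elim
        case (elim x)
        have X': "(\<lambda>n. X (n + N)) \<longlonglongrightarrow> R" using X by (rule LIMSEQ_ignore_initial_segment)
        have "norm x < R \<or> R < norm x" using elim by auto
        then have "\<forall>\<^sub>F n in sequentially. (indicator (ball 0 (X (n + N))) x :: real) = indicator (ball 0 R) x"
        proof
          assume lt: "norm x < R"
          show ?thesis using order_tendstoD(1)[OF X' lt] by eventually_elim (simp add: lt)
        next
          assume gt: "R < norm x"
          show ?thesis using order_tendstoD(2)[OF X' gt] by eventually_elim (use gt in simp)
        qed
        then have "(\<lambda>n. indicator (ball 0 (X (n + N))) x :: real) \<longlonglongrightarrow> indicator (ball 0 R) x"
          by (rule tendsto_eventually)
        then show ?case by (intro tendsto_intros)
      qed
    qed
    then show "(\<lambda>n. ball_integral f (X n)) \<longlonglongrightarrow> ball_integral f R" by (rule LIMSEQ_offset)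
  qed
  then show "continuous_on S (ball_integral f)" by (intro continuous_at_imp_continuous_on ballI)
qed

lemma Linf_L2_set_integrable:
  fixes \<phi> :: "real^'n::finite \<Rightarrow> real" and f :: "real^'n \<Rightarrow> 'b::euclidean_space"
  assumes \<phi>: "\<phi> \<in> Linf_loc" and f: "f \<in> L2_loc"
  shows "set_integrable lebesgue (ball 0 R) (\<lambda>x. (\<phi> x)\<^sup>2 * (norm (f x))\<^sup>2)"
  unfolding set_integrable_def
proof -
  have [measurable]: "\<phi> \<in> borel_measurable lebesgue" "f \<in> borel_measurable lebesgue"
    using \<phi> f by (simp_all add: Linf_loc_def L2_loc_def)
  have K: "compact (cball (0::real^'n) R)" by (rule compact_cball)
  then obtain C where C: "AE x in lebesgue. x \<in> cball 0 R \<longrightarrow> \<bar>\<phi> x\<bar> \<le> C" using \<phi> unfolding Linf_loc_def by blast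
  have "set_integrable lebesgue (cball 0 R) (\<lambda>x. (norm (f x))\<^sup>2)"
    using f K unfolding L2_loc_def by blast
  then have "integrable lebesgue (\<lambda>x. indicator (cball 0 R) x *\<^sub>R (norm (f x))\<^sup>2)"
    unfolding set_integrable_def .
  then have i: "integrable lebesgue (\<lambda>x. C\<^sup>2 * (indicator (cball 0 R) x *\<^sub>R (norm (f x))\<^sup>2))" by (rule integrable_mult_right)
  show "integrable lebesgue (\<lambda>x. indicator (ball 0 R) x *\<^sub>R ((\<phi> x)\<^sup>2 * (norm (f x))\<^sup>2))"
  proof (rule Bochner_Integration.integrable_bound[OF i])
    have [measurable]: "ball (0::real^'n) R \<in> sets lebesgue" by simp
    show "(\<lambda>x. indicator (ball 0 R) x *\<^sub>R ((\<phi> x)\<^sup>2 * (norm (f x))\<^sup>2)) \<in> borel_measurable lebesgue" by measurable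
    show "AE x in lebesgue. norm (indicator (ball 0 R) x *\<^sub>R ((\<phi> x)\<^sup>2 * (norm (f x))\<^sup>2)) \<le> norm (C\<^sup>2 * (indicator (cball 0 R) x *\<^sub>R (norm (f x))\<^sup>2))"
      using C
    proof eventually_elim
      case (elim x)
      show ?case
      proof (cases "x \<in> ball 0 R")
        case True
        then have "\<bar>\<phi> x\<bar> \<le> C" "x \<in> cball 0 R" using elim by simp_all
        then have "(\<phi> x)\<^sup>2 \<le> C\<^sup>2" by (simp add: abs_le_square_iff[symmetric])
        then have "(\<phi> x)\<^sup>2 * (norm (f x))\<^sup>2 \<le> C\<^sup>2 * (norm (f x))\<^sup>2" by (rule mult_right_mono) simp
        then show ?thesis using True \<open>x \<in> cball 0 R\<close> by simp
      qed simp
    qed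
  qed
qed

text \<open>Optimising over \<open>t\<close>, with \<open>t = X/A\<close>; when \<open>A = 0\<close> a large \<open>t\<close> forces \<open>X = 0\<close>.\<close>

lemma product_bound_from_AM_GM:
  fixes X A B :: real
  assumes X: "0 \<le> X" and A: "0 \<le> A" and B: "0 \<le> B" and le: "\<And>t. 0 < t \<Longrightarrow> X \<le> (t * A + B / t) / 2"
  shows "X\<^sup>2 \<le> A * B"
proof (cases "X = 0")
  case True then show ?thesis using A B by simp
next
  case False
  then have X: "0 < X" using X by simp
  show ?thesis
  proof (cases "A = 0")
    case True
    have "X \<le> (B / ((B + 1) / X)) / 2" using le[of "(B + 1) / X"] True X B by simp
    also have "\<dots> = X * (B / (B + 1)) / 2" using X by simp
    also have "\<dots> < X"
    proof -
      define q where "q = B / (B + 1)"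
      have "q < 2" using B by (simp add: q_def divide_less_eq)
      then have "X * q < X * 2" using X by (rule mult_strict_left_mono)
      then show ?thesis unfolding q_def[symmetric] by simp
    qed
    finally show ?thesis by simp
  next
    case False
    then have A: "0 < A" using A by simp
    have "X \<le> (X / A * A + B / (X / A)) / 2" using X A by (intro le) simp
    then have "X \<le> B * A / X" using A by simp
    then show ?thesis using X by (simp add: power2_eq_square le_divide_eq mult.commute)
  qed
qed

text \<open>With a cutoff \<open>\<eta>\<close> that is \<open>1\<close> on \<open>B\<^sub>r\<close> and \<open>0\<close> off \<open>B\<^sub>R\<close>, the hypothesis gives
\<open>D(r) \<le> - \<integral> \<phi>\<^sup>2 \<sigma> \<nabla>\<sigma> \<bullet> \<nabla>\<eta>\<close>, and \<open>\<nabla>\<eta>\<close> lives on the annulus, where it is at most \<open>C/(R - r)\<close>. Bounding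
\<open>|\<sigma>| |\<nabla>\<sigma>|\<close> by a weighted arithmetic mean with free weight \<open>t\<close> amounts to the Cauchy-Schwarz inequality on
the annulus.\<close>

theorem caccioppoli:
  fixes \<phi> \<sigma> :: "real^'n::finite \<Rightarrow> real"
  assumes \<phi>: "\<phi> \<in> Linf_loc" and \<sigma>: "\<sigma> \<in> L2_loc" and G: "G \<in> L2_loc" and sd: "sigma_div_nonneg \<phi> \<sigma> G"
  defines "h \<equiv> ball_integral (\<lambda>x. (\<phi> x)\<^sup>2 * (norm (\<sigma> x))\<^sup>2)" and "D \<equiv> ball_integral (\<lambda>x. (\<phi> x)\<^sup>2 * (norm (G x))\<^sup>2)"
  shows "\<exists>C. \<forall>r R. 0 \<le> r \<longrightarrow> r < R \<longrightarrow> (D r * (R - r))\<^sup>2 \<le> C * ((h R - h r) * (D R - D r))"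
proof -
  have [measurable]: "\<phi> \<in> borel_measurable lebesgue" "\<sigma> \<in> borel_measurable lebesgue" "G \<in> borel_measurable lebesgue"
    using \<phi> \<sigma> G by (simp_all add: Linf_loc_def L2_loc_def)
  let ?a = "\<lambda>x. (\<phi> x)\<^sup>2 * (norm (\<sigma> x))\<^sup>2" and ?d = "\<lambda>x. (\<phi> x)\<^sup>2 * (norm (G x))\<^sup>2"
  have n: "0 \<le> ?a x" "0 \<le> ?d x" for x by simp_all
  note pa = ball_integral_properties[OF Linf_L2_set_integrable[OF \<phi> \<sigma>] n(1), folded h_def]
  note pd = ball_integral_properties[OF Linf_L2_set_integrable[OF \<phi> G] n(2), folded D_def]
  have main: "(D r * (R - r))\<^sup>2 \<le> C\<^sup>2 * ((h R - h r) * (D R - D r))"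
    if r: "0 \<le> r" "r < R" and C: "0 < C" and ex: "\<exists>\<eta> :: real^'n \<Rightarrow> real. radial_cutoff C r R \<eta>" for r R C
  proof -
    obtain \<eta> :: "real^'n \<Rightarrow> real" where \<eta>: "\<eta> \<in> Cc_infinity" "\<And>x. 0 \<le> \<eta> x" "\<And>x. norm x \<le> r \<Longrightarrow> \<eta> x = 1"
      "\<And>x. norm x \<ge> R \<Longrightarrow> \<eta> x = 0" "\<And>x. norm x \<le> r \<or> norm x \<ge> R \<Longrightarrow> grad \<eta> x = 0"
      "\<And>x. norm (grad \<eta> x) \<le> C / (R - r)"
      using ex unfolding radial_cutoff_def by blast
    obtain M where M: "\<And>x. \<bar>\<eta> x\<bar> \<le> M" using Cc_infinity_bounded[OF \<eta>(1)] by blast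
    define k where "k = C / (R - r)"
    have k: "k > 0" using C r by (simp add: k_def)
    have "continuous_on UNIV (grad \<eta>)"
      unfolding grad_def by (intro continuous_on_vec_lambda Cc_infinity_partial_deriv(1)[OF \<eta>(1)])
    then have [measurable]: "grad \<eta> \<in> borel_measurable lebesgue"
      by (intro measurable_completion) (simp add: borel_measurable_continuous_onI)
    have [measurable]: "\<eta> \<in> borel_measurable lebesgue"
      using Cc_infinity_continuous[OF \<eta>(1)] by (intro measurable_completion) (simp add: borel_measurable_continuous_onI)
    let ?ann = "ball (0::real^'n) R - ball 0 r"
    let ?e1 = "\<lambda>x. \<eta> x * (\<phi> x)\<^sup>2 * (norm (G x))\<^sup>2" and ?e2 = "\<lambda>x. (\<phi> x)\<^sup>2 * \<sigma> x * (G x \<bullet> grad \<eta> x)"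
    have iD: "integrable lebesgue (\<lambda>x. indicator (ball 0 \<rho>) x * ?d x)" for \<rho>
      using Linf_L2_set_integrable[OF \<phi> G, of \<rho>] unfolding set_integrable_def by simp
    have i1: "integrable lebesgue ?e1"
    proof (rule Bochner_Integration.integrable_bound[OF integrable_mult_right[OF iD[of R], of M]])
      show "AE x in lebesgue. norm (?e1 x) \<le> norm (M * (indicator (ball 0 R) x * ?d x))"
      proof (intro AE_I2)
        fix x
        show "norm (?e1 x) \<le> norm (M * (indicator (ball 0 R) x * ?d x))"
        proof (cases "x \<in> ball 0 R")
          case True
          have "\<bar>\<eta> x\<bar> * ?d x \<le> \<bar>M\<bar> * ?d x" using M[of x] by (intro mult_right_mono n(2)) linarith
          then show ?thesis using True by (simp add: abs_mult mult.assoc)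
        next
          case False
          then show ?thesis using \<eta>(4)[of x] by simp
        qed
      qed
    qed measurable
    define b where "b = (\<lambda>t x. k / 2 * (t * (indicator ?ann x * ?a x) + (indicator ?ann x * ?d x) / t))"
    have ib: "integrable lebesgue (b t)" for t
      unfolding b_def by (intro integrable_mult_right Bochner_Integration.integrable_add integrable_divide pa(4) pd(4))
    have e2b: "\<bar>?e2 x\<bar> \<le> b t x" if t: "t > 0" for t x
    proof (cases "x \<in> ?ann")
      case True
      have "\<bar>G x \<bullet> grad \<eta> x\<bar> \<le> norm (G x) * norm (grad \<eta> x)" by (rule Cauchy_Schwarz_ineq2)
      also have "\<dots> \<le> norm (G x) * k" using \<eta>(6)[of x] unfolding k_def by (intro mult_left_mono) simp_all
      finally have gx: "\<bar>G x \<bullet> grad \<eta> x\<bar> \<le> norm (G x) * k" .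
      define u v where "u = norm (\<sigma> x)" and "v = norm (G x)"
      have "0 \<le> (t * u - v)\<^sup>2 / t" using t by simp
      also have "\<dots> = t * u\<^sup>2 + v\<^sup>2 / t - 2 * (u * v)" using t by (simp add: power2_eq_square field_simps)
      finally have uv: "u * v \<le> (t * u\<^sup>2 + v\<^sup>2 / t) / 2" by simp
      have "\<bar>?e2 x\<bar> = (\<phi> x)\<^sup>2 * (u * \<bar>G x \<bullet> grad \<eta> x\<bar>)" by (simp add: abs_mult u_def)
      also have "\<dots> \<le> (\<phi> x)\<^sup>2 * (u * (v * k))" using gx unfolding v_def by (intro mult_left_mono) (simp_all add: u_def)
      also have "\<dots> = (\<phi> x)\<^sup>2 * k * (u * v)" by simp
      also have "\<dots> \<le> (\<phi> x)\<^sup>2 * k * ((t * u\<^sup>2 + v\<^sup>2 / t) / 2)" using k by (intro mult_left_mono uv) simp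
      also have "\<dots> = b t x" using True t by (simp add: b_def u_def v_def field_simps)
      finally show ?thesis .
    next
      case False
      then have "norm x \<le> r \<or> norm x \<ge> R" by auto
      then show ?thesis using \<eta>(5)[of x] False by (simp add: b_def)
    qed
    have i2: "integrable lebesgue ?e2"
    proof (rule Bochner_Integration.integrable_bound[OF ib[of 1]])
      show "AE x in lebesgue. norm (?e2 x) \<le> norm (b 1 x)"
      proof (intro AE_I2)
        show "norm (?e2 x) \<le> norm (b 1 x)" for x
          using e2b[OF zero_less_one, of x] abs_ge_self[of "b 1 x"] unfolding real_norm_def by linarith
      qed
    qed measurable
    have "D r * (R - r) \<le> (t * (C * (h R - h r)) + (C * (D R - D r)) / t) / 2" if t: "t > 0" for t
    proof -
      have "D r = (LINT x|lebesgue. indicator (ball 0 r) x * ?d x)"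
        unfolding D_def ball_integral_def set_lebesgue_integral_def by simp
      also have "\<dots> \<le> (LINT x|lebesgue. ?e1 x)"
      proof (rule integral_mono[OF iD i1])
        show "indicator (ball 0 r) x * ?d x \<le> ?e1 x" for x
          using \<eta>(3)[of x] \<eta>(2)[of x] by (cases "x \<in> ball 0 r") simp_all
      qed
      also have "\<dots> \<le> - (LINT x|lebesgue. ?e2 x)"
      proof -
        have "(LINT x|lebesgue. ?e1 x + ?e2 x) \<le> 0"
          using sd \<eta>(1,2) unfolding sigma_div_nonneg_def by blast
        then show ?thesis using i1 i2 by simp
      qed
      also have "\<dots> \<le> (LINT x|lebesgue. \<bar>?e2 x\<bar>)"
        using integral_abs_bound[of lebesgue ?e2] by linarith
      also have "\<dots> \<le> (LINT x|lebesgue. b t x)"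
        by (rule integral_mono[OF integrable_abs[OF i2] ib]) (rule e2b[OF t])
      also have "\<dots> = k / 2 * (t * (h R - h r) + (D R - D r) / t)"
        unfolding b_def using pa(3)[of r R] pd(3)[of r R] pa(4)[of R r] pd(4)[of R r] r by simp
      finally have "D r * (R - r) \<le> k / 2 * (t * (h R - h r) + (D R - D r) / t) * (R - r)"
        using r by (intro mult_right_mono) simp_all
      also have "\<dots> = (t * (C * (h R - h r)) + (C * (D R - D r)) / t) / 2"
        using r by (simp add: k_def field_simps)
      finally show ?thesis .
    qed
    then have "(D r * (R - r))\<^sup>2 \<le> (C * (h R - h r)) * (C * (D R - D r))"
      using pd(1)[of r] pa(2)[of r R] pd(2)[of r R] r C by (intro product_bound_from_AM_GM) simp_all
    then show ?thesis by (simp add: power2_eq_square mult_ac)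
  qed
  show ?thesis
  proof (rule radial_cutoff_exists)
    fix C :: real assume C: "0 < C"
      and ex: "\<And>r R. 0 \<le> r \<Longrightarrow> r < R \<Longrightarrow> \<exists>\<eta> :: real^'n \<Rightarrow> real. radial_cutoff C r R \<eta>"
    show ?thesis
      by (intro exI[of _ "C\<^sup>2"] allI impI main[OF _ _ C ex])
  qed
qed

text \<open>If \<open>D\<close> were positive at some radius, \<open>admissible_from_growth\<close> would produce an admissible function that
contradicts the hypothesis.\<close>

theorem integral_infinite_imp_property_P:
  fixes \<Psi> :: "real \<Rightarrow> real"
  assumes \<Psi>: "continuous_on {1..} \<Psi>" "\<And>R. 1 \<le> R \<Longrightarrow> 0 < \<Psi> R"
    and inf: "\<And>h. continuous_on {1..} h \<Longrightarrow> mono_on {1..} h \<Longrightarrow> \<forall>r\<ge>1. 0 \<le> h r \<and> h r \<le> \<Psi> r \<Longrightarrow> integral_recip_deriv h = \<infinity>"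
  shows "property_P TYPE('n::finite) \<Psi>"
  unfolding property_P_def
proof (intro allI impI)
  fix \<phi> \<sigma> :: "real^'n \<Rightarrow> real" and G
  assume \<phi>: "\<phi> \<in> Linf_loc" "AE x in lebesgue. 0 < \<phi> x" and H1: "\<sigma> \<in> H1_loc" and wg: "weak_gradient \<sigma> G"
    and sd: "sigma_div_nonneg \<phi> \<sigma> G" and le: "\<forall>R\<ge>1. (LINT x:ball 0 R|lebesgue. (\<phi> x * \<sigma> x)\<^sup>2) \<le> \<Psi> R"
  have \<sigma>: "\<sigma> \<in> L2_loc" using H1 by (simp add: H1_loc_def)
  have G: "G \<in> L2_loc" using wg by (simp add: weak_gradient_def)
  define h where "h = ball_integral (\<lambda>x. (\<phi> x)\<^sup>2 * (norm (\<sigma> x))\<^sup>2)"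
  define D where "D = ball_integral (\<lambda>x. (\<phi> x)\<^sup>2 * (norm (G x))\<^sup>2)"
  have n: "0 \<le> (\<phi> x)\<^sup>2 * (norm (\<sigma> x))\<^sup>2" "0 \<le> (\<phi> x)\<^sup>2 * (norm (G x))\<^sup>2" for x by simp_all
  note pa = ball_integral_properties[OF Linf_L2_set_integrable[OF \<phi>(1) \<sigma>] n(1), folded h_def]
  note pd = ball_integral_properties[OF Linf_L2_set_integrable[OF \<phi>(1) G] n(2), folded D_def]
  obtain C where C: "\<And>r R. 0 \<le> r \<Longrightarrow> r < R \<Longrightarrow> (D r * (R - r))\<^sup>2 \<le> C * ((h R - h r) * (D R - D r))"
    using caccioppoli[OF \<phi>(1) \<sigma> G sd, folded h_def D_def] by blast
  have h\<Psi>: "h R \<le> \<Psi> R" if "1 \<le> R" for R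
  proof -
    have "h R = (LINT x:ball 0 R|lebesgue. (\<phi> x * \<sigma> x)\<^sup>2)"
      by (simp add: h_def ball_integral_def power_mult_distrib)
    then show ?thesis using le that by simp
  qed
  have D0: "D R = 0" if R: "1 \<le> R" for R
  proof (rule ccontr)
    assume "D R \<noteq> 0"
    then have "0 < D R" using pd(1)[of R] by simp
    have "\<exists>h. continuous_on {1..} h \<and> mono_on {1..} h \<and> (\<forall>r\<ge>1. 0 \<le> h r \<and> h r \<le> \<Psi> r) \<and> integral_recip_deriv h \<noteq> \<infinity>"
    proof (rule admissible_from_growth[of h D R C \<Psi>])
      show "(D x * (y - x))\<^sup>2 \<le> C * ((h y - h x) * (D y - D x))" if "1 \<le> x" "x < y" for x y
        using that by (intro C) simp_all
      show "continuous_on {1..} h" by (rule pa(5))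
      show "continuous_on {1..} D" by (rule pd(5))
      show "h x \<le> h y" if "1 \<le> x" "x \<le> y" for x y using that(2) by (rule pa(2))
      show "D x \<le> D y" if "1 \<le> x" "x \<le> y" for x y using that(2) by (rule pd(2))
      show "0 \<le> h x" if "1 \<le> x" for x by (rule pa(1))
      show "1 \<le> R" "0 < D R" by fact+
      show "continuous_on {1..} \<Psi>" by (rule \<Psi>(1))
      show "0 < \<Psi> x" if "1 \<le> x" for x using that by (rule \<Psi>(2))
      show "h x \<le> \<Psi> x" if "1 \<le> x" for x using that by (rule h\<Psi>)
    qed
    then show False using inf by blast
  qed
  have loc: "AE x in lebesgue. x \<in> ball 0 (real (Suc m)) \<longrightarrow> G x = 0" for m
  proof -
    have i: "integrable lebesgue (\<lambda>x. indicator (ball 0 (real (Suc m))) x *\<^sub>R ((\<phi> x)\<^sup>2 * (norm (G x))\<^sup>2))"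
      using Linf_L2_set_integrable[OF \<phi>(1) G, of "real (Suc m)"] unfolding set_integrable_def .
    have "(LINT x|lebesgue. indicator (ball 0 (real (Suc m))) x *\<^sub>R ((\<phi> x)\<^sup>2 * (norm (G x))\<^sup>2)) = 0"
      using D0[of "real (Suc m)"] unfolding D_def ball_integral_def set_lebesgue_integral_def by simp
    then have "AE x in lebesgue. indicator (ball 0 (real (Suc m))) x *\<^sub>R ((\<phi> x)\<^sup>2 * (norm (G x))\<^sup>2) = 0"
      using integral_nonneg_eq_0_iff_AE[OF i] by simp
    then show ?thesis using \<phi>(2) by eventually_elim (simp add: indicator_def)
  qed
  have "AE x in lebesgue. \<forall>m. x \<in> ball 0 (real (Suc m)) \<longrightarrow> G x = 0"
    unfolding AE_all_countable by (intro allI loc)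
  then have "AE x in lebesgue. G x = 0"
  proof eventually_elim
    case (elim x)
    obtain m where "norm x < real m" using reals_Archimedean2 by blast
    then have "x \<in> ball 0 (real (Suc m))" by simp
    with elim show ?case by blast
  qed
  then show "\<exists>c. AE x in lebesgue. \<sigma> x = c" by (rule weak_gradient_zero_imp_const[OF \<sigma> wg])
qed

theorem theorem1p2:
  fixes \<Psi> :: "real \<Rightarrow> real"
  assumes "continuous_on {1..} \<Psi>"
    and "\<And>R. 1 \<le> R \<Longrightarrow> 0 < \<Psi> R"
  shows "(property_P TYPE('n::finite) \<Psi> \<longleftrightarrow> property_P' TYPE('n) \<Psi>) \<and>
    (property_P' TYPE('n) \<Psi> \<longleftrightarrow>
      (\<forall>h :: real \<Rightarrow> real.
         continuous_on {1..} h \<and> mono_on {1..} h \<and> (\<forall>r\<ge>1. 0 \<le> h r \<and> h r \<le> \<Psi> r) \<longrightarrow>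
         integral_recip_deriv h = \<infinity>))"
proof -
  have 1: "property_P' TYPE('n) \<Psi>" if P: "property_P TYPE('n) \<Psi>"
    unfolding property_P'_def
  proof (intro allI impI)
    fix \<phi> \<sigma> :: "real^'n \<Rightarrow> real" and G
    assume a: "\<phi> \<in> Linf_loc" "AE x in lebesgue. 0 < \<phi> x" "\<sigma> \<in> H1_loc" "weak_gradient \<sigma> G" "div_zero \<phi> G"
      "\<forall>R\<ge>1. (LINT x:ball 0 R|lebesgue. (\<phi> x * \<sigma> x)\<^sup>2) \<le> \<Psi> R"
    have "\<sigma> \<in> L2_loc" using a(3) by (simp add: H1_loc_def)
    then have "sigma_div_nonneg \<phi> \<sigma> G" by (rule div_zero_imp_sigma_div_nonneg[OF a(1) _ a(4,5)])
    then show "\<exists>c. AE x in lebesgue. \<sigma> x = c" using P a unfolding property_P_def by blast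
  qed
  have 2: "integral_recip_deriv h = \<infinity>"
    if "property_P' TYPE('n) \<Psi>" and h: "continuous_on {1..} h \<and> mono_on {1..} h \<and> (\<forall>r\<ge>1. 0 \<le> h r \<and> h r \<le> \<Psi> r)" for h
    by (rule property_P'_imp_integral_infinite[OF assms _ _ _ _ that(1)]) (use h in simp_all)
  have 3: "property_P TYPE('n) \<Psi>"
    if "\<forall>h :: real \<Rightarrow> real. continuous_on {1..} h \<and> mono_on {1..} h \<and> (\<forall>r\<ge>1. 0 \<le> h r \<and> h r \<le> \<Psi> r) \<longrightarrow>
         integral_recip_deriv h = \<infinity>"
    by (rule integral_infinite_imp_property_P[OF assms]) (use that in simp_all)
  from 1 2 3 show ?thesis by blast
qed

end
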